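(* Let $\alpha,\beta\in\Delta_+$ be positive roots with root vectors $e_\alpha\in\mathfrak g_\alpha$, $e_\beta\in\mathfrak g_\beta$ such that $[e_\alpha,e_\beta]=0$. Let $\rho_\alpha:\mathfrak g\to \mathrm{End}(V_\alpha)$ and $\rho_\beta:\mathfrak g\to \mathrm{End}(V_\beta)$ be finite-dimensional bottom-weight representations equipped with adapted bases. Let $v_i,v_j$ be vectors of the adapted basis of $V_\alpha$ with weights $\omega_i,\omega_j$ satisfying $\omega_j-\omega_i=\alpha$, and let $v_k,v_l$ be vectors of the adapted basis of $V_\beta$ with weights $\omega'_k,\omega'_l$ satisfying $\omega'_l-\omega'_k=\beta$. Assume that $$\rho_\alpha(\theta(e_\beta))(v_i)=\rho_\alpha(\theta(e_\beta))(v_j)=0,\qquad \rho_\beta(\theta(e_\alpha))(v_k)=\rho_\beta(\theta(e_\alpha))(v_l)=0 .$$ Put $$\mathscr T^{\rho_\alpha}_\alpha=\frac{F^{\rho_\alpha}_j}{F^{\rho_\alpha}_i}\,\mathscr T^{e_\alpha},\qquad \mathscr T^{\rho_\beta}_\beta=\frac{F^{\rho_\beta}_l}{F^{\rho_\beta}_k}\,\mathscr T^{e_\beta},$$ smooth vector fields on the open subsets $\{F_i^{\rho_\alpha}\neq 0\}$ and $\{F_k^{\rho_\beta}\neq0\}$ of $K$, respectively. Then, on the common domains of definition, $$[\mathscr T^{\rho_\alpha}_\alpha,\mathscr T^{\rho_\beta}_\beta]=0,\qquad [\mathscr T^\Lambda,\mathscr T^{\rho_\alpha}_\alpha]=0,\qquad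 [\mathscr T^\Lambda,\mathscr T^{\rho_\beta}_\beta]=0\quad\text{for all }\Lambda\in\mathfrak a .$$
   Context: Setting. $\mathfrak g$ is a non-compact real form of a complex semisimple Lie algebra, $\theta$ a Cartan involution of $\mathfrak g$, and $\mathfrak g=\mathfrak k\oplus\mathfrak p$ the Cartan decomposition ($\theta=+1$ on $\mathfrak k$, $\theta=-1$ on $\mathfrak p$). $G$ is the 1-connected Lie group with Lie algebra $\mathfrak g$ and $K\subset G$ is the connected subgroup with Lie algebra $\mathfrak k$. $\mathfrak a\subset\mathfrak p$ is a maximal commutative subspace; for $\alpha\in\mathfrak a^*$ let $\mathfrak g_\alpha=\{X\in\mathfrak g: [H,X]=\alpha(H)X\ \forall H\in\mathfrak a\}$; nonzero $\alpha$ with $\mathfrak g_\alpha\ne0$ are the (restricted) roots. A set $\Delta_+$ of positive roots is fixed. Set $\mathfrak b_-=\mathfrak a\oplus\bigoplus_{\alpha\in\Delta_+}\mathfrak g_{-\alpha}$. Then $\mathfrak g=\mathfrak k\oplus\mathfrak b_-$, and $M:\mathfrak g\to\mathfrak k$ denotes the projection onto $\mathfrak k$ along $\mathfrak b_-$. Generalised Toda fields. For $X\in\mathfrak g$, $\mathscr T^X$ is the vector field on $K$ given by $\mathscr T^X(k)=dR_k(M(Ad_k(X)))$, where $R_k$ is right translation by $k$ and $Ad$ is the adjoint action of $K\subset G$ on $\mathfrak g$. For $X=\Lambda\in\mathfrak a$ it is called a Toda field. Representations. A finite-dimensional bottom-weight representation $\rho:\mathfrak g\to \mathrm{End}(V)$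 is a real representation generated by a nonzero vector $v_-$ (lowest vector) such that $\rho(x)v_-=0$ for all $x\in\mathfrak g_{-\alpha}$, $\alpha\in\Delta_+$, and $\rho(h)v_-=\omega_1(h)v_-$ for all $h\in\mathfrak a$, for some $\omega_1\in\mathfrak a^*$. Let $\hat\rho$ be the induced representation of $K$. $V$ is equipped with a $K$-invariant Euclidean inner product $\langle\cdot,\cdot\rangle$ for which $\rho(L)$ is symmetric for $L\in\mathfrak p$ and $\rho(O)$ is skew-symmetric for $O\in\mathfrak k$. An adapted basis is an orthonormal basis $v_-=v_1,\dots,v_N$ of $V$ consisting of weight vectors: $\rho(h)v_i=\omega_i(h)v_i$ for all $h\in\mathfrak a$, with $\omega_i\in\mathfrak a^*$. Define smooth functions on $K$ by $F^\rho_i(k)=\langle\hat\rho(k)(v_i),v_-\rangle$. *)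

theory Defs
  imports "HOL-Analysis.Analysis" "HOL-Algebra.Group"
begin

section \<open>Smooth manifolds\<close>

text \<open>The predicates \<open>Ck_on\<close> and \<open>smooth_on\<close> are only used for open sets.\<close>

primrec Ck_on :: "nat \<Rightarrow> 'a::euclidean_space set \<Rightarrow> ('a \<Rightarrow> 'b::real_normed_vector) \<Rightarrow> bool" where
  "Ck_on 0 S f \<longleftrightarrow> continuous_on S f"
| "Ck_on (Suc n) S f \<longleftrightarrow>
     (\<exists>D. (\<forall>x\<in>S. (f has_derivative D x) (at x)) \<and> (\<forall>v. Ck_on n S (\<lambda>x. D x v)))"

definition smooth_on :: "'a::euclidean_space set \<Rightarrow> ('a \<Rightarrow> 'b::real_normed_vector) \<Rightarrow> bool" where
  "smooth_on S f \<longleftrightarrow> (\<forall>n. Ck_on n S f)"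

text \<open>The underlying set of a manifold is the \<open>topspace\<close> of its topology. A chart \<open>(U, \<phi>)\<close>
  is given by its domain and a coordinate map which is only relevant on \<open>U\<close>. Atlases need not
  be maximal.\<close>

record ('a, 'e) manifold =
  mfd_top :: "'a topology"
  charts :: "('a set \<times> ('a \<Rightarrow> 'e)) set"

definition smooth_manifold :: "('a, 'e::euclidean_space) manifold \<Rightarrow> bool" where
  "smooth_manifold M \<longleftrightarrow>
     Hausdorff_space (mfd_top M) \<and> second_countable (mfd_top M) \<and>
     \<Union>(fst ` charts M) = topspace (mfd_top M) \<and>
     (\<forall>(U, \<phi>)\<in>charts M. openin (mfd_top M) U \<and> open (\<phi> ` U) \<and>
        homeomorphic_map (subtopology (mfd_top M) U) (top_of_set (\<phi> ` U)) \<phi>) \<and>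
     (\<forall>(U, \<phi>)\<in>charts M. \<forall>(V, \<psi>)\<in>charts M. smooth_on (\<phi> ` (U \<inter> V)) (\<psi> \<circ> inv_into U \<phi>))"

definition prod_manifold ::
  "('a, 'e) manifold \<Rightarrow> ('b, 'f) manifold \<Rightarrow> ('a \<times> 'b, 'e \<times> 'f) manifold" where
  "prod_manifold M N = \<lparr> mfd_top = prod_topology (mfd_top M) (mfd_top N),
     charts = {(U \<times> V, map_prod \<phi> \<psi>) | U \<phi> V \<psi>. (U, \<phi>) \<in> charts M \<and> (V, \<psi>) \<in> charts N} \<rparr>"

definition smooth_map ::
  "('a, 'e::euclidean_space) manifold \<Rightarrow> ('b, 'f::euclidean_space) manifold \<Rightarrow> ('a \<Rightarrow> 'b) \<Rightarrow> bool" where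
  "smooth_map M N F \<longleftrightarrow> continuous_map (mfd_top M) (mfd_top N) F \<and>
     (\<forall>(U, \<phi>)\<in>charts M. \<forall>(V, \<psi>)\<in>charts N.
        smooth_on (\<phi> ` {x\<in>U. F x \<in> V}) (\<psi> \<circ> F \<circ> inv_into U \<phi>))"

definition smooth_fun_on :: "('a, 'e::euclidean_space) manifold \<Rightarrow> 'a set \<Rightarrow> ('a \<Rightarrow> real) \<Rightarrow> bool" where
  "smooth_fun_on M W f \<longleftrightarrow> openin (mfd_top M) W \<and>
     (\<forall>(U, \<phi>)\<in>charts M. smooth_on (\<phi> ` (U \<inter> W)) (f \<circ> inv_into U \<phi>))"

definition smooth_near :: "('a, 'e::euclidean_space) manifold \<Rightarrow> 'a \<Rightarrow> ('a \<Rightarrow> real) \<Rightarrow> bool" where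
  "smooth_near M p f \<longleftrightarrow> (\<exists>W. p \<in> W \<and> smooth_fun_on M W f)"

text \<open>A tangent vector at \<open>p\<close> is the derivation \<open>f \<mapsto> (f \<circ> c)'(0)\<close> along a smooth curve
  \<open>c\<close>, defined near \<open>0\<close>, with \<open>c 0 = p\<close>. As a total functional it takes the value \<open>0\<close> on functions
  that are not smooth near \<open>p\<close>, so that equality of functionals is equality of tangent vectors
  and the zero tangent vector is \<open>\<lambda>f. 0\<close>.\<close>

definition smooth_curve :: "('a, 'e::euclidean_space) manifold \<Rightarrow> (real \<Rightarrow> 'a) \<Rightarrow> bool" where
  "smooth_curve M c \<longleftrightarrow> (\<exists>\<epsilon>>0. continuous_map (top_of_set {-\<epsilon><..<\<epsilon>}) (mfd_top M) c \<and>
     (\<forall>(U, \<phi>)\<in>charts M. smooth_on {t\<in>{-\<epsilon><..<\<epsilon>}. c t \<in> U} (\<phi> \<circ> c)))"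

type_synonym 'a tangent_vector = "('a \<Rightarrow> real) \<Rightarrow> real"
type_synonym 'a vector_field = "'a \<Rightarrow> 'a tangent_vector"

definition velocity :: "('a, 'e::euclidean_space) manifold \<Rightarrow> (real \<Rightarrow> 'a) \<Rightarrow> 'a tangent_vector" where
  "velocity M c = (\<lambda>f. if smooth_near M (c 0) f then deriv (\<lambda>t. f (c t)) 0 else 0)"

definition tangent_space :: "('a, 'e::euclidean_space) manifold \<Rightarrow> 'a \<Rightarrow> 'a tangent_vector set" where
  "tangent_space M p = {velocity M c | c. smooth_curve M c \<and> c 0 = p}"

definition differential ::
  "('a, 'e::euclidean_space) manifold \<Rightarrow> ('b, 'f::euclidean_space) manifold \<Rightarrow> ('a \<Rightarrow> 'b) \<Rightarrow>
     'a \<Rightarrow> 'a tangent_vector \<Rightarrow> 'b tangent_vector" where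
  "differential M N F p D = (\<lambda>f. if smooth_near N (F p) f then D (f \<circ> F) else 0)"

definition smooth_vector_field_on ::
  "('a, 'e::euclidean_space) manifold \<Rightarrow> 'a set \<Rightarrow> 'a vector_field \<Rightarrow> bool" where
  "smooth_vector_field_on M W X \<longleftrightarrow> openin (mfd_top M) W \<and>
     (\<forall>p\<in>W. X p \<in> tangent_space M p) \<and>
     (\<forall>V f. V \<subseteq> W \<longrightarrow> smooth_fun_on M V f \<longrightarrow> smooth_fun_on M V (\<lambda>p. X p f))"

definition lie_bracket ::
  "('a, 'e::euclidean_space) manifold \<Rightarrow> 'a vector_field \<Rightarrow> 'a vector_field \<Rightarrow> 'a vector_field" where
  "lie_bracket M X Y p =
     (\<lambda>f. if smooth_near M p f then X p (\<lambda>q. Y q f) - Y p (\<lambda>q. X q f) else 0)"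


section \<open>Lie groups\<close>

definition lie_group :: "'a monoid \<Rightarrow> ('a, 'e::euclidean_space) manifold \<Rightarrow> bool" where
  "lie_group G M \<longleftrightarrow> group G \<and> smooth_manifold M \<and> topspace (mfd_top M) = carrier G \<and>
     smooth_map (prod_manifold M M) M (\<lambda>(x, y). x \<otimes>\<^bsub>G\<^esub> y) \<and>
     smooth_map M M (\<lambda>x. inv\<^bsub>G\<^esub> x)"

text \<open>The counterpart of \<open>simply_connected\<close> for abstract topologies: all loops are
  homotopic as loops.\<close>

definition simply_connected_space :: "'a topology \<Rightarrow> bool" where
  "simply_connected_space T \<longleftrightarrow>
     (\<forall>p q. pathin T p \<and> p 1 = p 0 \<and> pathin T q \<and> q 1 = q 0 \<longrightarrow>
        homotopic_with (\<lambda>r. r 1 = r 0) (top_of_set {0..1}) T p q)"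

definition left_invariant_field ::
  "'a monoid \<Rightarrow> ('a, 'e::euclidean_space) manifold \<Rightarrow> 'a tangent_vector \<Rightarrow> 'a vector_field" where
  "left_invariant_field G M D g = differential M M (\<lambda>x. g \<otimes>\<^bsub>G\<^esub> x) \<one>\<^bsub>G\<^esub> D"

text \<open>\<open>lam\<close> identifies the Lie algebra \<open>(\<gg>, br)\<close> with the tangent space at the identity,
  carrying the bracket of left-invariant vector fields.\<close>

definition lie_algebra_of_group ::
  "'a monoid \<Rightarrow> ('a, 'e::euclidean_space) manifold \<Rightarrow> ('g::real_vector \<Rightarrow> 'g \<Rightarrow> 'g) \<Rightarrow>
     ('g \<Rightarrow> 'a tangent_vector) \<Rightarrow> bool" where
  "lie_algebra_of_group G M br lam \<longleftrightarrow>
     bij_betw lam UNIV (tangent_space M \<one>\<^bsub>G\<^esub>) \<and>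
     (\<forall>a b X Y f. lam (a *\<^sub>R X + b *\<^sub>R Y) f = a * lam X f + b * lam Y f) \<and>
     (\<forall>X Y. lam (br X Y) =
        lie_bracket M (left_invariant_field G M (lam X)) (left_invariant_field G M (lam Y)) \<one>\<^bsub>G\<^esub>)"

definition Ad ::
  "'a monoid \<Rightarrow> ('a, 'e::euclidean_space) manifold \<Rightarrow> ('g \<Rightarrow> 'a tangent_vector) \<Rightarrow> 'a \<Rightarrow> 'g \<Rightarrow> 'g" where
  "Ad G M lam g X = inv_into UNIV lam
     (differential M M (\<lambda>x. g \<otimes>\<^bsub>G\<^esub> x \<otimes>\<^bsub>G\<^esub> inv\<^bsub>G\<^esub> g) \<one>\<^bsub>G\<^esub> (lam X))"

text \<open>\<open>K\<close> with the manifold structure \<open>MK\<close> is the connected (immersed) Lie subgroup of \<open>G\<close>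
  with Lie algebra \<open>\<hh> \<subseteq> \<gg>\<close>.\<close>

definition connected_lie_subgroup ::
  "'a monoid \<Rightarrow> ('a, 'e::euclidean_space) manifold \<Rightarrow> ('g \<Rightarrow> 'a tangent_vector) \<Rightarrow> 'g set \<Rightarrow>
     'a set \<Rightarrow> ('a, 'f::euclidean_space) manifold \<Rightarrow> bool" where
  "connected_lie_subgroup G MG lam \<hh> K MK \<longleftrightarrow>
     subgroup K G \<and> lie_group (G\<lparr>carrier := K\<rparr>) MK \<and> connected_space (mfd_top MK) \<and>
     smooth_map MK MG (\<lambda>x. x) \<and>
     (\<forall>p\<in>K. inj_on (differential MK MG (\<lambda>x. x) p) (tangent_space MK p)) \<and>
     differential MK MG (\<lambda>x. x) \<one>\<^bsub>G\<^esub> ` tangent_space MK \<one>\<^bsub>G\<^esub> = lam ` \<hh>"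

text \<open>The tangent vector of \<open>K\<close> at the identity that corresponds to an element of its Lie
  algebra.\<close>

definition subgroup_vector ::
  "'a monoid \<Rightarrow> ('a, 'e::euclidean_space) manifold \<Rightarrow> ('g \<Rightarrow> 'a tangent_vector) \<Rightarrow>
     ('a, 'f::euclidean_space) manifold \<Rightarrow> 'g \<Rightarrow> 'a tangent_vector" where
  "subgroup_vector G MG lam MK Y =
     inv_into (tangent_space MK \<one>\<^bsub>G\<^esub>) (differential MK MG (\<lambda>x. x) \<one>\<^bsub>G\<^esub>) (lam Y)"


section \<open>Lie algebras\<close>

definition lie_algebra :: "('f::field \<Rightarrow> 'a::ab_group_add \<Rightarrow> 'a) \<Rightarrow> ('a \<Rightarrow> 'a \<Rightarrow> 'a) \<Rightarrow> bool" where
  "lie_algebra s br \<longleftrightarrow> vector_space s \<and>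
     (\<forall>x. Vector_Spaces.linear s s (br x)) \<and> (\<forall>y. Vector_Spaces.linear s s (\<lambda>x. br x y)) \<and>
     (\<forall>x. br x x = 0) \<and>
     (\<forall>x y z. br x (br y z) + br y (br z x) + br z (br x y) = 0)"

definition lie_ideal :: "('f::field \<Rightarrow> 'a::ab_group_add \<Rightarrow> 'a) \<Rightarrow> ('a \<Rightarrow> 'a \<Rightarrow> 'a) \<Rightarrow> 'a set \<Rightarrow> bool" where
  "lie_ideal s br I \<longleftrightarrow> module.subspace s I \<and> (\<forall>x. \<forall>y\<in>I. br x y \<in> I)"

primrec derived_series ::
  "('f::field \<Rightarrow> 'a::ab_group_add \<Rightarrow> 'a) \<Rightarrow> ('a \<Rightarrow> 'a \<Rightarrow> 'a) \<Rightarrow> 'a set \<Rightarrow> nat \<Rightarrow> 'a set" where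
  "derived_series s br I 0 = I"
| "derived_series s br I (Suc n) =
     module.span s {br x y | x y. x \<in> derived_series s br I n \<and> y \<in> derived_series s br I n}"

definition semisimple_lie_algebra ::
  "('f::field \<Rightarrow> 'a::ab_group_add \<Rightarrow> 'a) \<Rightarrow> ('a \<Rightarrow> 'a \<Rightarrow> 'a) \<Rightarrow> bool" where
  "semisimple_lie_algebra s br \<longleftrightarrow> lie_algebra s br \<and>
     (\<exists>B. finite B \<and> module.span s B = UNIV) \<and>
     (\<forall>I. lie_ideal s br I \<and> (\<exists>n. derived_series s br I n = {0}) \<longrightarrow> I = {0})"

text \<open>\<open>\<iota>\<close> embeds the real Lie algebra \<open>(\<gg>, br)\<close> as a real form of the complex Lie algebra
  \<open>(\<gg>\<^sub>\<complex>, brc)\<close>, that is \<open>\<gg>\<^sub>\<complex> = \<iota> \<gg> \<oplus> i \<iota> \<gg>\<close>.\<close>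

definition real_form ::
  "('g::real_vector \<Rightarrow> 'g \<Rightarrow> 'g) \<Rightarrow> (complex \<Rightarrow> 'c::ab_group_add \<Rightarrow> 'c) \<Rightarrow> ('c \<Rightarrow> 'c \<Rightarrow> 'c) \<Rightarrow>
     ('g \<Rightarrow> 'c) \<Rightarrow> bool" where
  "real_form br sc brc \<iota> \<longleftrightarrow> lie_algebra scaleR br \<and> lie_algebra sc brc \<and>
     (\<forall>X Y. \<iota> (X + Y) = \<iota> X + \<iota> Y) \<and> (\<forall>r X. \<iota> (r *\<^sub>R X) = sc (complex_of_real r) (\<iota> X)) \<and>
     (\<forall>X Y. \<iota> (br X Y) = brc (\<iota> X) (\<iota> Y)) \<and>
     bij (\<lambda>(X, Y). \<iota> X + sc \<i> (\<iota> Y))"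

text \<open>The trace is computed in the orthonormal basis of the type class; it does not depend on
  that choice.\<close>

definition killing_form :: "('g::euclidean_space \<Rightarrow> 'g \<Rightarrow> 'g) \<Rightarrow> 'g \<Rightarrow> 'g \<Rightarrow> real" where
  "killing_form br X Y = (\<Sum>b\<in>Basis. br X (br Y b) \<bullet> b)"

text \<open>A real form is compact iff its Killing form is negative definite.\<close>

definition noncompact_real_form ::
  "('g::euclidean_space \<Rightarrow> 'g \<Rightarrow> 'g) \<Rightarrow> (complex \<Rightarrow> 'c::ab_group_add \<Rightarrow> 'c) \<Rightarrow> ('c \<Rightarrow> 'c \<Rightarrow> 'c) \<Rightarrow>
     ('g \<Rightarrow> 'c) \<Rightarrow> bool" where
  "noncompact_real_form br sc brc \<iota> \<longleftrightarrow> semisimple_lie_algebra sc brc \<and> real_form br sc brc \<iota> \<and>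
     \<not> (\<forall>X. X \<noteq> 0 \<longrightarrow> killing_form br X X < 0)"

definition cartan_involution ::
  "('g::euclidean_space \<Rightarrow> 'g \<Rightarrow> 'g) \<Rightarrow> ('g \<Rightarrow> 'g) \<Rightarrow> bool" where
  "cartan_involution br \<theta> \<longleftrightarrow> linear \<theta> \<and> (\<forall>X Y. \<theta> (br X Y) = br (\<theta> X) (\<theta> Y)) \<and>
     (\<forall>X. \<theta> (\<theta> X) = X) \<and> (\<forall>X. X \<noteq> 0 \<longrightarrow> - killing_form br X (\<theta> X) > 0)"

definition cartan_k :: "('g::real_vector \<Rightarrow> 'g) \<Rightarrow> 'g set" where
  "cartan_k \<theta> = {X. \<theta> X = X}"

definition cartan_p :: "('g::real_vector \<Rightarrow> 'g) \<Rightarrow> 'g set" where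
  "cartan_p \<theta> = {X. \<theta> X = - X}"

definition maximal_commutative_in ::
  "('g::real_vector \<Rightarrow> 'g \<Rightarrow> 'g) \<Rightarrow> 'g set \<Rightarrow> 'g set \<Rightarrow> bool" where
  "maximal_commutative_in br \<pp> \<aa> \<longleftrightarrow>
     (let comm = (\<lambda>S. subspace S \<and> S \<subseteq> \<pp> \<and> (\<forall>x\<in>S. \<forall>y\<in>S. br x y = 0))
      in comm \<aa> \<and> (\<forall>S. comm S \<and> \<aa> \<subseteq> S \<longrightarrow> S = \<aa>))"

text \<open>Elements of the dual space of the subspace \<open>\<aa>\<close> are represented by functions that
  vanish outside \<open>\<aa>\<close> (they are linear on \<open>\<aa>\<close> only), so that equality of functionals on \<open>\<aa>\<close> is
  equality of functions.\<close>

definition dual_space :: "'g::real_vector set \<Rightarrow> ('g \<Rightarrow> real) set" where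
  "dual_space \<aa> = {\<alpha>. (\<forall>x\<in>\<aa>. \<forall>y\<in>\<aa>. \<alpha> (x + y) = \<alpha> x + \<alpha> y) \<and> (\<forall>r. \<forall>x\<in>\<aa>. \<alpha> (r *\<^sub>R x) = r * \<alpha> x) \<and>
     (\<forall>x. x \<notin> \<aa> \<longrightarrow> \<alpha> x = 0)}"

definition root_space ::
  "('g::real_vector \<Rightarrow> 'g \<Rightarrow> 'g) \<Rightarrow> 'g set \<Rightarrow> ('g \<Rightarrow> real) \<Rightarrow> 'g set" where
  "root_space br \<aa> \<alpha> = {X. \<forall>H\<in>\<aa>. br H X = \<alpha> H *\<^sub>R X}"

definition restricted_roots :: "('g::real_vector \<Rightarrow> 'g \<Rightarrow> 'g) \<Rightarrow> 'g set \<Rightarrow> ('g \<Rightarrow> real) set" where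
  "restricted_roots br \<aa> = {\<alpha>\<in>dual_space \<aa>. \<alpha> \<noteq> (\<lambda>_. 0) \<and> root_space br \<aa> \<alpha> \<noteq> {0}}"

definition positive_system :: "('g \<Rightarrow> real) set \<Rightarrow> ('g \<Rightarrow> real) set \<Rightarrow> bool" where
  "positive_system \<Delta> P \<longleftrightarrow> P \<subseteq> \<Delta> \<and>
     (\<forall>\<alpha>\<in>\<Delta>. (\<alpha> \<in> P) \<noteq> ((\<lambda>H. - \<alpha> H) \<in> P)) \<and>
     (\<forall>\<alpha>\<in>P. \<forall>\<beta>\<in>P. (\<lambda>H. \<alpha> H + \<beta> H) \<in> \<Delta> \<longrightarrow> (\<lambda>H. \<alpha> H + \<beta> H) \<in> P)"

definition b_minus ::
  "('g::real_vector \<Rightarrow> 'g \<Rightarrow> 'g) \<Rightarrow> 'g set \<Rightarrow> ('g \<Rightarrow> real) set \<Rightarrow> 'g set" where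
  "b_minus br \<aa> P = span (\<aa> \<union> (\<Union>\<alpha>\<in>P. root_space br \<aa> (\<lambda>H. - \<alpha> H)))"

definition projection_along :: "'g::real_vector set \<Rightarrow> 'g set \<Rightarrow> 'g \<Rightarrow> 'g" where
  "projection_along S T X = (THE Y. Y \<in> S \<and> X - Y \<in> T)"


section \<open>Generalised Toda fields and bottom-weight representations\<close>

definition toda_field ::
  "('g::real_vector \<Rightarrow> 'g \<Rightarrow> 'g) \<Rightarrow> ('g \<Rightarrow> 'g) \<Rightarrow> 'g set \<Rightarrow> ('g \<Rightarrow> real) set \<Rightarrow>
     'a monoid \<Rightarrow> ('a, 'e::euclidean_space) manifold \<Rightarrow> ('g \<Rightarrow> 'a tangent_vector) \<Rightarrow>
     ('a, 'f::euclidean_space) manifold \<Rightarrow> 'g \<Rightarrow> 'a vector_field" where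
  "toda_field br \<theta> \<aa> P G MG lam MK X k =
     differential MK MK (\<lambda>x. x \<otimes>\<^bsub>G\<^esub> k) \<one>\<^bsub>G\<^esub>
       (subgroup_vector G MG lam MK
         (projection_along (cartan_k \<theta>) (b_minus br \<aa> P) (Ad G MG lam k X)))"

definition lie_representation ::
  "('g::real_vector \<Rightarrow> 'g \<Rightarrow> 'g) \<Rightarrow> ('g \<Rightarrow> 'v::real_vector \<Rightarrow> 'v) \<Rightarrow> bool" where
  "lie_representation br \<rho> \<longleftrightarrow> bilinear \<rho> \<and>
     (\<forall>X Y v. \<rho> (br X Y) v = \<rho> X (\<rho> Y v) - \<rho> Y (\<rho> X v))"

definition bottom_weight_representation ::
  "('g::real_vector \<Rightarrow> 'g \<Rightarrow> 'g) \<Rightarrow> 'g set \<Rightarrow> ('g \<Rightarrow> real) set \<Rightarrow>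
     ('g \<Rightarrow> 'v::euclidean_space \<Rightarrow> 'v) \<Rightarrow> 'v \<Rightarrow> bool" where
  "bottom_weight_representation br \<aa> P \<rho> vm \<longleftrightarrow> lie_representation br \<rho> \<and> vm \<noteq> 0 \<and>
     (\<forall>S. subspace S \<and> vm \<in> S \<and> (\<forall>X. \<forall>u\<in>S. \<rho> X u \<in> S) \<longrightarrow> S = UNIV) \<and>
     (\<forall>\<alpha>\<in>P. \<forall>x\<in>root_space br \<aa> (\<lambda>H. - \<alpha> H). \<rho> x vm = 0) \<and>
     (\<exists>\<omega>\<in>dual_space \<aa>. \<forall>h\<in>\<aa>. \<rho> h vm = \<omega> h *\<^sub>R vm)"

text \<open>\<open>R\<close> is the smooth representation of \<open>G\<close> with differential \<open>\<rho>\<close> at the identity. If \<open>G\<close> is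
  simply connected then it exists, and it is unique on \<open>carrier G\<close>.\<close>

definition integrates_to ::
  "'a monoid \<Rightarrow> ('a, 'e::euclidean_space) manifold \<Rightarrow> ('g \<Rightarrow> 'a tangent_vector) \<Rightarrow>
     ('g \<Rightarrow> 'v::euclidean_space \<Rightarrow> 'v) \<Rightarrow> ('a \<Rightarrow> 'v \<Rightarrow> 'v) \<Rightarrow> bool" where
  "integrates_to G MG lam \<rho> R \<longleftrightarrow>
     (\<forall>g\<in>carrier G. linear (R g)) \<and> R \<one>\<^bsub>G\<^esub> = id \<and>
     (\<forall>g\<in>carrier G. \<forall>h\<in>carrier G. R (g \<otimes>\<^bsub>G\<^esub> h) = R g \<circ> R h) \<and>
     (\<forall>u w. smooth_fun_on MG (carrier G) (\<lambda>g. R g u \<bullet> w)) \<and>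
     (\<forall>X u w. lam X (\<lambda>g. R g u \<bullet> w) = \<rho> X u \<bullet> w)"

text \<open>The inner product on \<open>V\<close> is the one of the type class.\<close>

definition compatible_inner_product ::
  "('g::real_vector \<Rightarrow> 'g) \<Rightarrow> 'a set \<Rightarrow> ('g \<Rightarrow> 'v::euclidean_space \<Rightarrow> 'v) \<Rightarrow> ('a \<Rightarrow> 'v \<Rightarrow> 'v) \<Rightarrow> bool" where
  "compatible_inner_product \<theta> K \<rho> R \<longleftrightarrow>
     (\<forall>k\<in>K. \<forall>u w. R k u \<bullet> R k w = u \<bullet> w) \<and>
     (\<forall>L\<in>cartan_p \<theta>. \<forall>u w. \<rho> L u \<bullet> w = u \<bullet> \<rho> L w) \<and>
     (\<forall>A\<in>cartan_k \<theta>. \<forall>u w. \<rho> A u \<bullet> w = - (u \<bullet> \<rho> A w))"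

text \<open>The basis vectors are \<open>v 1, \<dots>, v N\<close> with \<open>N = DIM('v)\<close>, and \<open>\<omega> i\<close> is the weight of \<open>v i\<close>.\<close>

definition adapted_basis ::
  "'g::real_vector set \<Rightarrow> ('g \<Rightarrow> 'v::euclidean_space \<Rightarrow> 'v) \<Rightarrow> 'v \<Rightarrow> (nat \<Rightarrow> 'v) \<Rightarrow>
     (nat \<Rightarrow> 'g \<Rightarrow> real) \<Rightarrow> bool" where
  "adapted_basis \<aa> \<rho> vm v \<omega> \<longleftrightarrow> v 1 = vm \<and>
     (\<forall>i\<in>{1..DIM('v)}. \<forall>j\<in>{1..DIM('v)}. v i \<bullet> v j = (if i = j then 1 else 0)) \<and>
     (\<forall>i\<in>{1..DIM('v)}. \<omega> i \<in> dual_space \<aa> \<and> (\<forall>h\<in>\<aa>. \<rho> h (v i) = \<omega> i h *\<^sub>R v i))"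

definition F_coeff :: "('a \<Rightarrow> 'v::euclidean_space \<Rightarrow> 'v) \<Rightarrow> (nat \<Rightarrow> 'v) \<Rightarrow> 'v \<Rightarrow> nat \<Rightarrow> 'a \<Rightarrow> real" where
  "F_coeff R v vm i k = R k (v i) \<bullet> vm"

definition scale_field :: "('a \<Rightarrow> real) \<Rightarrow> 'a vector_field \<Rightarrow> 'a vector_field" where
  "scale_field f X p = (\<lambda>h. f p * X p h)"

end

theory Submission
  imports Defs
begin

text \<open>\<^emph>\<open>Proof idea.\<close> Along \<open>\<T>\<^sup>X\<close> the function \<open>k \<mapsto> Ad\<^sub>k Y\<close> has derivative \<open>[M (Ad\<^sub>k X), Ad\<^sub>k Y]\<close>. Since
  \<open>\<kk>\<close> and \<open>\<bb>\<^sub>-\<close> are complementary subalgebras, this makes \<open>[\<T>\<^sup>X, \<T>\<^sup>Y]\<close> and \<open>\<T>\<close> of \<open>[X, Y]\<close> agree on these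
  functions, and hence everywhere, because \<open>\<gg>\<close> has trivial centre. Write \<open>F\<^sub>u k\<close> for the inner product of
  \<open>R k u\<close> with the lowest vector. That vector is an eigenvector of \<open>\<bb>\<^sub>-\<close> and the transpose of \<open>\<rho> X\<close> is
  \<open>- \<rho> (\<theta> X)\<close>, so \<open>\<T>\<^sup>X F\<^sub>u\<close> is \<open>F\<close> at \<open>\<rho> (\<theta> X) u\<close> plus a multiple of \<open>F\<^sub>u\<close> whose factor does not depend on
  \<open>u\<close>. In a quotient of two such functions the factor cancels: the quotient for \<open>\<alpha>\<close> is annihilated by the
  field of \<open>e\<^sub>\<beta>\<close>, and \<open>\<T>\<close> of \<open>\<Lambda>\<close> multiplies it by \<open>- \<alpha> \<Lambda>\<close>, which compensates \<open>[\<Lambda>, e\<^sub>\<alpha>] = \<alpha> \<Lambda> e\<^sub>\<alpha>\<close>.\<close>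

section \<open>Calculus of smooth functions\<close>

text \<open>Two tangent vectors can be compared on test functions only when both are known to be
  tangent vectors, that is, velocities of smooth curves. For the bracket of two fields this is the
  analytic obstacle: it is a derivation, but no curve comes with it. In a chart it becomes the
  derivative along an explicit coordinate vector, and a coordinate line is the missing curve. The
  functions \<open>ad k Y \<bullet> u\<close> separate tangent vectors because right translation
  makes every tangent vector of \<open>K\<close> a \<open>right_field Z k\<close> and
  \<open>ad k\<close> is onto: agreement on all of them makes the difference of the two
  representatives \<open>Z\<close> central. The projection exists because the operators
  \<open>br H\<close> with \<open>H\<close> in \<open>\<aa>\<close> commute and are symmetric for
  the inner product built from the Killing form and \<theta>; so the root spaces span, and \<theta>
  exchanges those of opposite roots. Right-invariant fields reverse brackets, yet here [X, Y]
  appears with its own sign. With x, y for the images of X, Y under \<open>ad k\<close>, the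
  fixed-field term - [Mx, My] is joined by M[Mx, y] - M[My, x], which comes from the dependence of
  \<open>ad k\<close> on \<open>k\<close>; the sum is M[x, y].\<close>

lemma Ck_on_SucI:
  "(\<And>x. x \<in> S \<Longrightarrow> (f has_derivative D x) (at x)) \<Longrightarrow> (\<And>v. Ck_on n S (\<lambda>x. D x v)) \<Longrightarrow> Ck_on (Suc n) S f"
  unfolding Ck_on.simps by blast

lemma Ck_on_cong:
  assumes "open S" "\<And>x. x \<in> S \<Longrightarrow> f x = g x" "Ck_on n S f"
  shows "Ck_on n S g"
proof (cases n)
  case 0
  then show ?thesis using assms continuous_on_cong[of S S f g] by simp
next
  case (Suc m)
  with assms obtain D where D: "\<forall>x\<in>S. (f has_derivative D x) (at x)" "\<forall>v. Ck_on m S (\<lambda>x. D x v)"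
    by auto
  have "(g has_derivative D x) (at x)" if "x \<in> S" for x
    using has_derivative_transform_within_open[OF D(1)[rule_format, OF that] assms(1) that] assms(2)
    by auto
  then show ?thesis using D Suc by auto
qed

lemma Ck_on_subset: "Ck_on n S f \<Longrightarrow> T \<subseteq> S \<Longrightarrow> Ck_on n T f"
proof (induction n arbitrary: f)
  case 0
  then show ?case by (auto intro: continuous_on_subset)
next
  case (Suc n)
  then obtain D where "\<forall>x\<in>S. (f has_derivative D x) (at x)" "\<forall>v. Ck_on n S (\<lambda>x. D x v)"
    by auto
  then show ?case
    by (intro Ck_on_SucI[of T f D]) (use Suc.IH Suc.prems in blast)+
qed

lemma Ck_on_SucD: "Ck_on (Suc n) S f \<Longrightarrow> Ck_on n S f"
proof (induction n arbitrary: f)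
  case 0
  then show ?case
    by (auto intro!: continuous_at_imp_continuous_on dest: has_derivative_continuous)
next
  case (Suc n)
  then obtain D where "\<forall>x\<in>S. (f has_derivative D x) (at x)" "\<forall>v. Ck_on (Suc n) S (\<lambda>x. D x v)"
    by (auto simp del: Ck_on.simps simp: Ck_on.simps(2)[of "Suc n"])
  then show ?case
    by (intro Ck_on_SucI[of S f D]) (use Suc.IH in blast)+
qed

text \<open>A derivative at a point is unique, so the witness \<open>D\<close> agrees on
  \<open>S\<close> with \<open>frechet_derivative f\<close>; openness of \<open>S\<close> allows the
  replacement inside the smoothness condition for \<open>D\<close> itself.\<close>

lemma Ck_on_Suc_frechet:
  assumes "open S"
  shows "Ck_on (Suc n) S f \<longleftrightarrow>
    (\<forall>x\<in>S. f differentiable at x) \<and> (\<forall>v. Ck_on n S (\<lambda>x. frechet_derivative f (at x) v))"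
proof
  assume "Ck_on (Suc n) S f"
  then obtain D where D: "\<forall>x\<in>S. (f has_derivative D x) (at x)" "\<forall>v. Ck_on n S (\<lambda>x. D x v)"
    by auto
  have "\<forall>x\<in>S. D x = frechet_derivative f (at x)"
    using D(1) frechet_derivative_at by blast
  then have "Ck_on n S (\<lambda>x. frechet_derivative f (at x) v)" for v
    using Ck_on_cong[OF assms _ D(2)[rule_format, of v]] by simp
  with D show "(\<forall>x\<in>S. f differentiable at x) \<and> (\<forall>v. Ck_on n S (\<lambda>x. frechet_derivative f (at x) v))"
    unfolding differentiable_def by blast
next
  assume "(\<forall>x\<in>S. f differentiable at x) \<and> (\<forall>v. Ck_on n S (\<lambda>x. frechet_derivative f (at x) v))"
  then show "Ck_on (Suc n) S f"
    by (intro Ck_on_SucI[where D = "\<lambda>x. frechet_derivative f (at x)"])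
       (simp_all add: frechet_derivative_works[symmetric])
qed

text \<open>Witnesses \<open>D\<close> chosen separately on the neighbourhoods would have to be
  glued. \<open>frechet_derivative f\<close> is one witness for all of them, and the induction
  applies to its directional values.\<close>

lemma Ck_on_local:
  assumes "\<And>x. x \<in> S \<Longrightarrow> \<exists>U. open U \<and> x \<in> U \<and> Ck_on n U f"
  shows "Ck_on n S f"
  using assms
proof (induction n arbitrary: f)
  case 0
  have "isCont f x" if "x \<in> S" for x
    using 0[OF that] by (auto simp: continuous_on_eq_continuous_at)
  then show ?case by (simp add: continuous_at_imp_continuous_on)
next
  case (Suc n)
  have *: "\<exists>U. open U \<and> x \<in> U \<and> f differentiable at x \<and> (\<forall>v. Ck_on n U (\<lambda>x. frechet_derivative f (at x) v))"
    if "x \<in> S" for x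
  proof -
    obtain U where "open U" "x \<in> U" "Ck_on (Suc n) U f" using Suc.prems[OF \<open>x \<in> S\<close>] by blast
    then show ?thesis using Ck_on_Suc_frechet[of U n f] by blast
  qed
  have "f differentiable at x" if "x \<in> S" for x
    using *[OF that] by blast
  moreover have "Ck_on n S (\<lambda>x. frechet_derivative f (at x) v)" for v
    by (rule Suc.IH) (use * in blast)
  ultimately show ?case
    by (intro Ck_on_SucI[where D = "\<lambda>x. frechet_derivative f (at x)"])
       (simp_all add: frechet_derivative_works[symmetric])
qed

lemma Ck_on_const: "Ck_on n S (\<lambda>x. c)"
proof (induction n arbitrary: c)
  case (Suc n)
  then show ?case by (auto intro!: exI[of _ "\<lambda>x v. 0"])
qed simp

lemma Ck_on_linear: "bounded_linear f \<Longrightarrow> Ck_on n S f"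
proof (cases n)
  case (Suc m)
  assume "bounded_linear f"
  then show ?thesis using Suc
    by (auto intro!: Ck_on_SucI[where D = "\<lambda>x. f"] Ck_on_const bounded_linear_imp_has_derivative simp del: Ck_on.simps)
qed (simp add: linear_continuous_on)

lemma Ck_on_linear_comp: "bounded_linear L \<Longrightarrow> Ck_on n S f \<Longrightarrow> Ck_on n S (\<lambda>x. L (f x))"
proof (induction n arbitrary: f)
  case 0
  then show ?case by (auto intro: bounded_linear.continuous_on)
next
  case (Suc n)
  then obtain D where D: "\<forall>x\<in>S. (f has_derivative D x) (at x)" "\<forall>v. Ck_on n S (\<lambda>x. D x v)"
    by auto
  show ?case
    by (rule Ck_on_SucI[where D = "\<lambda>x v. L (D x v)"])
       (use D Suc bounded_linear.has_derivative in blast)+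
qed

lemma Ck_on_add: "Ck_on n S f \<Longrightarrow> Ck_on n S g \<Longrightarrow> Ck_on n S (\<lambda>x. f x + g x)"
proof (induction n arbitrary: f g)
  case 0
  then show ?case by (auto intro: continuous_intros)
next
  case (Suc n)
  then obtain D E where "\<forall>x\<in>S. (f has_derivative D x) (at x)" "\<forall>v. Ck_on n S (\<lambda>x. D x v)"
    "\<forall>x\<in>S. (g has_derivative E x) (at x)" "\<forall>v. Ck_on n S (\<lambda>x. E x v)"
    by auto
  then show ?case using Suc.IH
    by (auto intro!: exI[of _ "\<lambda>x v. D x v + E x v"] has_derivative_add)
qed

lemma Ck_on_sum: "(\<And>i. i \<in> I \<Longrightarrow> Ck_on n S (f i)) \<Longrightarrow> Ck_on n S (\<lambda>x. \<Sum>i\<in>I. f i x)"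
  by (induction I rule: infinite_finite_induct) (auto intro: Ck_on_const Ck_on_add)

text \<open>The product rule expresses the derivative by products of \<open>f\<close>,
  \<open>g\<close> and their derivatives. The induction therefore runs over arbitrary factors, and
  \<open>Ck_on_SucD\<close> lowers the order of \<open>f\<close> and \<open>g\<close>
  themselves.\<close>

lemma Ck_on_bilinear:
  assumes "bounded_bilinear b"
  shows "Ck_on n S f \<Longrightarrow> Ck_on n S g \<Longrightarrow> Ck_on n S (\<lambda>x. b (f x) (g x))"
proof (induction n arbitrary: f g)
  case 0
  then show ?case using bounded_bilinear.continuous_on[OF assms] by auto
next
  case (Suc n)
  then obtain D E where DE: "\<forall>x\<in>S. (f has_derivative D x) (at x)" "\<forall>v. Ck_on n S (\<lambda>x. D x v)"
    "\<forall>x\<in>S. (g has_derivative E x) (at x)" "\<forall>v. Ck_on n S (\<lambda>x. E x v)"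
    by auto
  have fg: "Ck_on n S f" "Ck_on n S g" using Suc.prems Ck_on_SucD by blast+
  show ?case
  proof (rule Ck_on_SucI)
    show "((\<lambda>x. b (f x) (g x)) has_derivative (\<lambda>v. b (f x) (E x v) + b (D x v) (g x))) (at x)"
      if "x \<in> S" for x
      using bounded_bilinear.FDERIV[OF assms DE(1)[rule_format, OF that] DE(3)[rule_format, OF that]] .
    show "Ck_on n S (\<lambda>x. b (f x) (E x v) + b (D x v) (g x))" for v
      using fg DE by (intro Ck_on_add Suc.IH) blast+
  qed
qed

lemma Ck_on_componentwise:
  fixes f :: "'a::euclidean_space \<Rightarrow> 'b::euclidean_space"
  assumes "\<And>b. b \<in> Basis \<Longrightarrow> Ck_on n S (\<lambda>x. f x \<bullet> b)"
  shows "Ck_on n S f"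
proof -
  have "Ck_on n S (\<lambda>x. \<Sum>b\<in>Basis. (f x \<bullet> b) *\<^sub>R b)"
    by (intro Ck_on_sum Ck_on_bilinear[OF bounded_bilinear_scaleR] assms Ck_on_const)
  then show ?thesis by (simp add: euclidean_representation)
qed

text \<open>The chain rule gives \<open>D (g x) (E x v)\<close>, whose direction
  \<open>E x v\<close> moves with \<open>x\<close>, while the induction hypothesis handles fixed
  directions only. Expanding \<open>E x v\<close> in the basis yields a sum of products of scalar
  functions with \<open>D (g x) b\<close>.\<close>

lemma Ck_on_compose:
  fixes f :: "'b::euclidean_space \<Rightarrow> 'c::real_normed_vector" and g :: "'a::euclidean_space \<Rightarrow> 'b"
  assumes "open S" "g ` S \<subseteq> T" "Ck_on n T f" "Ck_on n S g"
  shows "Ck_on n S (\<lambda>x. f (g x))"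
  using assms(3,4)
proof (induction n arbitrary: f)
  case 0
  then show ?case using assms(2) by (auto intro: continuous_on_compose2)
next
  case (Suc n)
  then obtain D E where D: "\<forall>x\<in>T. (f has_derivative D x) (at x)" "\<forall>v. Ck_on n T (\<lambda>x. D x v)"
    and E: "\<forall>x\<in>S. (g has_derivative E x) (at x)" "\<forall>v. Ck_on n S (\<lambda>x. E x v)"
    by auto
  have g: "Ck_on n S g" using Suc.prems Ck_on_SucD by blast
  have "Ck_on n S (\<lambda>x. D (g x) (E x v))" for v
  proof (rule Ck_on_cong[OF assms(1)])
    show "Ck_on n S (\<lambda>x. \<Sum>b\<in>Basis. (E x v \<bullet> b) *\<^sub>R D (g x) b)"
      using E(2) Suc.IH[of "\<lambda>x. D x b" for b] D(2) g
      by (intro Ck_on_sum Ck_on_bilinear[OF bounded_bilinear_scaleR]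
          Ck_on_linear_comp[OF bounded_linear_inner_left]) auto
    fix x assume "x \<in> S"
    then have lin: "linear (D (g x))"
      using D(1) assms(2) has_derivative_linear by blast
    have "D (g x) (E x v) = D (g x) (\<Sum>b\<in>Basis. (E x v \<bullet> b) *\<^sub>R b)"
      by (simp add: euclidean_representation)
    then show "(\<Sum>b\<in>Basis. (E x v \<bullet> b) *\<^sub>R D (g x) b) = D (g x) (E x v)"
      by (simp add: linear_sum[OF lin] linear_cmul[OF lin])
  qed
  moreover have "((\<lambda>x. f (g x)) has_derivative (\<lambda>v. D (g x) (E x v))) (at x)" if "x \<in> S" for x
    using that D(1) E(1) assms(2) has_derivative_compose by blast
  ultimately show ?case by (rule Ck_on_SucI[rotated])
qed

text \<open>The derivative contains the inverse again, but at an order that the induction hypothesis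
  already covers.\<close>

lemma Ck_on_inverse:
  fixes f :: "'a::euclidean_space \<Rightarrow> real"
  assumes "\<And>x. x \<in> S \<Longrightarrow> f x \<noteq> 0"
  shows "Ck_on n S f \<Longrightarrow> Ck_on n S (\<lambda>x. inverse (f x))"
proof (induction n)
  case 0
  then show ?case using assms by (auto intro: continuous_on_inverse)
next
  case (Suc n)
  then obtain D where D: "\<forall>x\<in>S. (f has_derivative D x) (at x)" "\<forall>v. Ck_on n S (\<lambda>x. D x v)"
    by auto
  have "Ck_on n S (\<lambda>x. inverse (f x))" using Suc Ck_on_SucD by blast
  then have "Ck_on n S (\<lambda>x. (- 1) * (inverse (f x) * D x v * inverse (f x)))" for v
    using D(2) by (intro Ck_on_bilinear[OF bounded_bilinear_mult] Ck_on_const) auto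
  moreover have "((\<lambda>x. inverse (f x)) has_derivative (\<lambda>v. (- 1) * (inverse (f x) * D x v * inverse (f x)))) (at x)"
    if "x \<in> S" for x
    using Deriv.has_derivative_inverse[OF assms[OF that] D(1)[rule_format, OF that]] by simp
  ultimately show ?case by (rule Ck_on_SucI[rotated])
qed

lemma smooth_on_cong:
  "open S \<Longrightarrow> (\<And>x. x \<in> S \<Longrightarrow> f x = g x) \<Longrightarrow> smooth_on S f \<Longrightarrow> smooth_on S g"
  unfolding smooth_on_def using Ck_on_cong by blast

lemma smooth_on_subset: "smooth_on S f \<Longrightarrow> T \<subseteq> S \<Longrightarrow> smooth_on T f"
  unfolding smooth_on_def using Ck_on_subset by blast

lemma smooth_on_local:
  "(\<And>x. x \<in> S \<Longrightarrow> \<exists>U. open U \<and> x \<in> U \<and> smooth_on U f) \<Longrightarrow> smooth_on S f"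
  unfolding smooth_on_def using Ck_on_local by meson

lemma smooth_on_const: "smooth_on S (\<lambda>x. c)"
  unfolding smooth_on_def by (simp add: Ck_on_const)

lemma smooth_on_linear: "bounded_linear f \<Longrightarrow> smooth_on S f"
  unfolding smooth_on_def by (simp add: Ck_on_linear)

lemma smooth_on_linear_comp: "bounded_linear L \<Longrightarrow> smooth_on S f \<Longrightarrow> smooth_on S (\<lambda>x. L (f x))"
  unfolding smooth_on_def by (simp add: Ck_on_linear_comp)

lemma smooth_on_add: "smooth_on S f \<Longrightarrow> smooth_on S g \<Longrightarrow> smooth_on S (\<lambda>x. f x + g x)"
  unfolding smooth_on_def by (simp add: Ck_on_add)

lemma smooth_on_mult:
  fixes f g :: "'a::euclidean_space \<Rightarrow> real"
  shows "smooth_on S f \<Longrightarrow> smooth_on S g \<Longrightarrow> smooth_on S (\<lambda>x. f x * g x)"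
  unfolding smooth_on_def by (simp add: Ck_on_bilinear[OF bounded_bilinear_mult])

lemma smooth_on_componentwise:
  fixes f :: "'a::euclidean_space \<Rightarrow> 'b::euclidean_space"
  shows "(\<And>b. b \<in> Basis \<Longrightarrow> smooth_on S (\<lambda>x. f x \<bullet> b)) \<Longrightarrow> smooth_on S f"
  unfolding smooth_on_def by (simp add: Ck_on_componentwise)

lemma smooth_on_compose:
  fixes f :: "'b::euclidean_space \<Rightarrow> 'c::real_normed_vector" and g :: "'a::euclidean_space \<Rightarrow> 'b"
  assumes "open S" "smooth_on T f" "smooth_on S g" "\<And>x. x \<in> S \<Longrightarrow> g x \<in> T"
  shows "smooth_on S (\<lambda>x. f (g x))"
  using Ck_on_compose[of S g T _ f] assms unfolding smooth_on_def by (simp add: image_subset_iff)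

lemma smooth_on_inverse:
  fixes f :: "'a::euclidean_space \<Rightarrow> real"
  shows "(\<And>x. x \<in> S \<Longrightarrow> f x \<noteq> 0) \<Longrightarrow> smooth_on S f \<Longrightarrow> smooth_on S (\<lambda>x. inverse (f x))"
  unfolding smooth_on_def by (simp add: Ck_on_inverse)

lemma smooth_on_Pair:
  fixes f :: "'a::euclidean_space \<Rightarrow> 'b::euclidean_space" and g :: "'a \<Rightarrow> 'c::euclidean_space"
  assumes "smooth_on S f" "smooth_on S g"
  shows "smooth_on S (\<lambda>x. (f x, g x))"
proof (rule smooth_on_componentwise)
  fix b :: "'b \<times> 'c"
  show "smooth_on S (\<lambda>x. (f x, g x) \<bullet> b)"
    unfolding inner_prod_def fst_conv snd_conv
    by (intro smooth_on_add smooth_on_linear_comp[OF bounded_linear_inner_left] assms)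
qed

lemma smooth_on_imp_continuous_on: "smooth_on S f \<Longrightarrow> continuous_on S f"
  unfolding smooth_on_def by (metis Ck_on.simps(1))

lemma smooth_on_has_derivative:
  assumes "open S" "smooth_on S f" "x \<in> S"
  shows "(f has_derivative frechet_derivative f (at x)) (at x)"
  using assms Ck_on_Suc_frechet frechet_derivative_works unfolding smooth_on_def by blast

lemma smooth_on_frechet_derivative:
  assumes "open S" "smooth_on S f"
  shows "smooth_on S (\<lambda>x. frechet_derivative f (at x) v)"
  using assms Ck_on_Suc_frechet unfolding smooth_on_def by blast

section \<open>Symmetry of second derivatives\<close>

lemma has_real_derivative_compose_vector:
  assumes "(g has_vector_derivative w) (at t)" "(f has_derivative D) (at (g t))"
  shows "((\<lambda>t. f (g t)) has_real_derivative D w) (at t)"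
proof -
  have "((\<lambda>t. f (g t)) has_derivative (\<lambda>r. D (r *\<^sub>R w))) (at t)"
    using has_derivative_compose[OF assms(1)[unfolded has_vector_derivative_def] assms(2)] .
  then show ?thesis
    unfolding has_field_derivative_def
    by (rule has_derivative_eq_rhs)
       (auto simp: linear_cmul[OF has_derivative_linear[OF assms(2)]] mult.commute)
qed
text \<open>The mean value theorem in direction \<open>w\<close>, applied to the difference of
  \<open>f\<close> on two opposite sides of a parallelogram, and then in direction \<open>v\<close>,
  applied to the \<open>w\<close>-derivative. The second difference on the left is symmetric in
  \<open>v\<close> and \<open>w\<close>, whereas the right side fixes an order of
  differentiation.\<close>

lemma second_difference_mean_value:
  fixes f :: "'a::euclidean_space \<Rightarrow> real"
  assumes S: "open S" "smooth_on S f" and h: "h > 0"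
    and mem: "\<And>s t. 0 \<le> s \<Longrightarrow> s \<le> h \<Longrightarrow> 0 \<le> t \<Longrightarrow> t \<le> h \<Longrightarrow> x + s *\<^sub>R w + t *\<^sub>R v \<in> S"
  shows "\<exists>s t. 0 < s \<and> s < h \<and> 0 < t \<and> t < h \<and>
    f (x + h *\<^sub>R w + h *\<^sub>R v) - f (x + h *\<^sub>R w) - f (x + h *\<^sub>R v) + f x =
    h * h * frechet_derivative (\<lambda>y. frechet_derivative f (at y) w) (at (x + s *\<^sub>R w + t *\<^sub>R v)) v"
proof -
  let ?D = "\<lambda>y. frechet_derivative f (at y)"
  let ?E = "\<lambda>y. frechet_derivative (\<lambda>y. ?D y w) (at y)"
  have d1: "((\<lambda>s. f (y + s *\<^sub>R w)) has_real_derivative ?D (y + s *\<^sub>R w) w) (at s)"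
    if "y + s *\<^sub>R w \<in> S" for s y
    by (rule has_real_derivative_compose_vector[where g = "\<lambda>s. y + s *\<^sub>R w", OF _ smooth_on_has_derivative[OF S that]])
       (auto intro!: derivative_eq_intros)
  have d2: "((\<lambda>t. ?D (y + t *\<^sub>R v) w) has_real_derivative ?E (y + t *\<^sub>R v) v) (at t)"
    if "y + t *\<^sub>R v \<in> S" for t y
    by (rule has_real_derivative_compose_vector[where g = "\<lambda>t. y + t *\<^sub>R v", OF _ smooth_on_has_derivative[OF S(1) smooth_on_frechet_derivative[OF S] that]])
       (auto intro!: derivative_eq_intros)
  have swap: "x + h *\<^sub>R v + s *\<^sub>R w = x + s *\<^sub>R w + h *\<^sub>R v" for s by simp
  have "\<exists>s. 0 < s \<and> s < h \<and>
     (f (x + h *\<^sub>R v + h *\<^sub>R w) - f (x + h *\<^sub>R w)) - (f (x + h *\<^sub>R v + 0 *\<^sub>R w) - f (x + 0 *\<^sub>R w)) =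
     (h - 0) * (?D (x + h *\<^sub>R v + s *\<^sub>R w) w - ?D (x + s *\<^sub>R w) w)"
  proof (rule MVT2[OF h, of "\<lambda>s. f (x + h *\<^sub>R v + s *\<^sub>R w) - f (x + s *\<^sub>R w)"])
    fix s assume s: "0 \<le> s" "s \<le> h"
    have "x + h *\<^sub>R v + s *\<^sub>R w \<in> S" "x + s *\<^sub>R w \<in> S"
      using mem[of s h] mem[of s 0] s h swap[of s] by (simp_all only:) simp_all
    then show "((\<lambda>s. f (x + h *\<^sub>R v + s *\<^sub>R w) - f (x + s *\<^sub>R w)) has_real_derivative
        ?D (x + h *\<^sub>R v + s *\<^sub>R w) w - ?D (x + s *\<^sub>R w) w) (at s)"
      by (intro DERIV_diff d1)
  qed
  then obtain s where s: "0 < s" "s < h" and e1: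
    "(f (x + h *\<^sub>R v + h *\<^sub>R w) - f (x + h *\<^sub>R w)) - (f (x + h *\<^sub>R v) - f x) =
     h * (?D (x + h *\<^sub>R v + s *\<^sub>R w) w - ?D (x + s *\<^sub>R w) w)"
    by auto
  have "\<exists>t. 0 < t \<and> t < h \<and> ?D (x + s *\<^sub>R w + h *\<^sub>R v) w - ?D (x + s *\<^sub>R w + 0 *\<^sub>R v) w =
      (h - 0) * ?E (x + s *\<^sub>R w + t *\<^sub>R v) v"
  proof (rule MVT2[OF h, of "\<lambda>t. ?D (x + s *\<^sub>R w + t *\<^sub>R v) w"])
    fix t assume "0 \<le> t" "t \<le> h"
    then show "((\<lambda>t. ?D (x + s *\<^sub>R w + t *\<^sub>R v) w) has_real_derivative ?E (x + s *\<^sub>R w + t *\<^sub>R v) v) (at t)"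
      using mem[of s t] s by (intro d2) auto
  qed
  then obtain t where t: "0 < t" "t < h" and e2:
    "?D (x + s *\<^sub>R w + h *\<^sub>R v) w - ?D (x + s *\<^sub>R w) w = h * ?E (x + s *\<^sub>R w + t *\<^sub>R v) v"
    by auto
  have "f (x + h *\<^sub>R w + h *\<^sub>R v) - f (x + h *\<^sub>R w) - f (x + h *\<^sub>R v) + f x =
    h * h * ?E (x + s *\<^sub>R w + t *\<^sub>R v) v"
    using e1 e2 unfolding swap by (simp add: algebra_simps)
  then show ?thesis using s t by blast
qed

text \<open>On a small parallelogram the same second difference equals both mixed derivatives, each
  at some interior point. By continuity these values are close to the ones at \<open>x\<close>, so
  the latter cannot differ.\<close>

lemma frechet_derivative_symmetric:
  fixes f :: "'a::euclidean_space \<Rightarrow> real"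
  assumes S: "open S" "smooth_on S f" and x: "x \<in> S"
  shows "frechet_derivative (\<lambda>y. frechet_derivative f (at y) v) (at x) w =
    frechet_derivative (\<lambda>y. frechet_derivative f (at y) w) (at x) v"
proof (rule ccontr)
  let ?F = "\<lambda>v w z. frechet_derivative (\<lambda>y. frechet_derivative f (at y) v) (at z) w"
  assume ne: "\<not> ?thesis"
  \<comment> \<open>Half the supposed gap: two errors below \<open>e\<close> cannot bridge
    it.\<close>
  define e where "e = \<bar>?F v w x - ?F w v x\<bar> / 2"
  have e: "e > 0" using ne unfolding e_def by simp
  have "continuous_on S (?F v w)" for v w
    by (intro smooth_on_imp_continuous_on smooth_on_frechet_derivative S)
  then have "isCont (?F v w) x" for v w
    using S(1) x by (simp add: continuous_on_eq_continuous_at)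
  then have "(?F v w \<longlongrightarrow> ?F v w x) (nhds x)" for v w
    using tendsto_at_iff_tendsto_nhds isCont_def by blast
  then have "\<forall>\<^sub>F z in nhds x. dist (?F v w z) (?F v w x) < e" for v w
    using e tendstoD by blast
  moreover have "\<forall>\<^sub>F z in nhds x. z \<in> S"
    using S(1) x eventually_nhds by blast
  ultimately have "\<forall>\<^sub>F z in nhds x. dist (?F v w z) (?F v w x) < e \<and> dist (?F w v z) (?F w v x) < e \<and> z \<in> S"
    by (intro eventually_conj)
  then obtain d where d: "d > 0" and
    dd: "\<And>z. dist z x < d \<Longrightarrow> \<bar>?F v w z - ?F v w x\<bar> < e \<and> \<bar>?F w v z - ?F w v x\<bar> < e \<and> z \<in> S"
    unfolding eventually_nhds_metric dist_real_def by blast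
  \<comment> \<open>Small enough for both parallelograms with sides \<open>h *\<^sub>R v\<close> and
    \<open>h *\<^sub>R w\<close> to stay within distance \<open>d\<close> of \<open>x\<close>; the
    summand 1 keeps the denominator positive for zero vectors.\<close>
  define h where "h = d / (2 * (norm v + norm w + 1))"
  have n: "norm v + norm w + 1 > 0" by (simp add: add_nonneg_pos)
  have h: "h > 0" using d n unfolding h_def by simp
  have near: "dist (x + s *\<^sub>R a + t *\<^sub>R b) x < d"
    if "0 \<le> s" "s \<le> h" "0 \<le> t" "t \<le> h" "(a, b) = (v, w) \<or> (a, b) = (w, v)" for s t a b
  proof -
    have "dist (x + s *\<^sub>R a + t *\<^sub>R b) x = norm (s *\<^sub>R a + t *\<^sub>R b)"
      by (simp add: dist_norm algebra_simps)
    also have "\<dots> \<le> s * norm a + t * norm b"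
      using norm_triangle_ineq[of "s *\<^sub>R a" "t *\<^sub>R b"] that by simp
    also have "\<dots> \<le> h * norm a + h * norm b"
      using that by (intro add_mono mult_right_mono) auto
    also have "\<dots> = h * (norm v + norm w)" using that by (auto simp: algebra_simps)
    also have "\<dots> < h * (2 * (norm v + norm w + 1))"
      using h n by (intro mult_strict_left_mono) auto
    also have "\<dots> = d" unfolding h_def using n by simp
    finally show ?thesis .
  qed
  have memS: "x + s *\<^sub>R w + t *\<^sub>R v \<in> S" "x + s *\<^sub>R v + t *\<^sub>R w \<in> S"
    if "0 \<le> s" "s \<le> h" "0 \<le> t" "t \<le> h" for s t
    using dd[OF near[OF that]] by simp_all
  obtain s t where st: "0 < s" "s < h" "0 < t" "t < h" and 1:
    "f (x + h *\<^sub>R w + h *\<^sub>R v) - f (x + h *\<^sub>R w) - f (x + h *\<^sub>R v) + f x = h * h * ?F w v (x + s *\<^sub>R w + t *\<^sub>R v)"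
    using second_difference_mean_value[OF S h memS(1)] by blast
  obtain s' t' where st': "0 < s'" "s' < h" "0 < t'" "t' < h" and 2:
    "f (x + h *\<^sub>R v + h *\<^sub>R w) - f (x + h *\<^sub>R v) - f (x + h *\<^sub>R w) + f x = h * h * ?F v w (x + s' *\<^sub>R v + t' *\<^sub>R w)"
    using second_difference_mean_value[OF S h memS(2)] by blast
  have "x + h *\<^sub>R v + h *\<^sub>R w = x + h *\<^sub>R w + h *\<^sub>R v" by simp
  then have "h * h * ?F w v (x + s *\<^sub>R w + t *\<^sub>R v) = h * h * ?F v w (x + s' *\<^sub>R v + t' *\<^sub>R w)"
    using 1 2 by (simp only:)
  then have "?F w v (x + s *\<^sub>R w + t *\<^sub>R v) = ?F v w (x + s' *\<^sub>R v + t' *\<^sub>R w)"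
    using h by simp
  moreover have "\<bar>?F w v (x + s *\<^sub>R w + t *\<^sub>R v) - ?F w v x\<bar> < e"
    using dd near[of s t w v] st by simp
  moreover have "\<bar>?F v w (x + s' *\<^sub>R v + t' *\<^sub>R w) - ?F v w x\<bar> < e"
    using dd near[of s' t' v w] st' by simp
  ultimately have "\<bar>?F v w x - ?F w v x\<bar> < 2 * e" by linarith
  then show False unfolding e_def by simp
qed

section \<open>Smooth maps and tangent vectors\<close>

text \<open>Smooth curves with several parameters. Expressions such as a product of two curves at
  independent times become maps on an open Euclidean set, where ordinary differential calculus
  applies.\<close>

definition smooth_into ::
  "('a, 'e::euclidean_space) manifold \<Rightarrow> 'p::euclidean_space set \<Rightarrow> ('p \<Rightarrow> 'a) \<Rightarrow> bool" where
  "smooth_into M S h \<longleftrightarrow> continuous_map (top_of_set S) (mfd_top M) h \<and>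
     (\<forall>(U, \<phi>)\<in>charts M. smooth_on {t\<in>S. h t \<in> U} (\<phi> \<circ> h))"

text \<open>The part of \<open>smooth_manifold\<close> that is inherited by \<open>prod_manifold\<close> without any work and
  suffices to compose smooth maps.\<close>

definition injective_atlas :: "('a, 'e::euclidean_space) manifold \<Rightarrow> bool" where
  "injective_atlas M \<longleftrightarrow> \<Union>(fst ` charts M) = topspace (mfd_top M) \<and>
     (\<forall>(U, \<phi>)\<in>charts M. openin (mfd_top M) U \<and> inj_on \<phi> U)"

lemma smooth_intoI:
  assumes "continuous_map (top_of_set S) (mfd_top M) h"
    and "\<And>U \<phi>. (U, \<phi>) \<in> charts M \<Longrightarrow> smooth_on {t\<in>S. h t \<in> U} (\<phi> \<circ> h)"
  shows "smooth_into M S h"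
  using assms unfolding smooth_into_def by fast

lemma smooth_intoD:
  "smooth_into M S h \<Longrightarrow> (U, \<phi>) \<in> charts M \<Longrightarrow> smooth_on {t\<in>S. h t \<in> U} (\<phi> \<circ> h)"
  unfolding smooth_into_def by fast

lemma smooth_fun_onI':
  assumes "openin (mfd_top M) W"
    and "\<And>U \<phi>. (U, \<phi>) \<in> charts M \<Longrightarrow> smooth_on (\<phi> ` (U \<inter> W)) (f \<circ> inv_into U \<phi>)"
  shows "smooth_fun_on M W f"
  using assms unfolding smooth_fun_on_def by fast

lemma smooth_fun_onD:
  "smooth_fun_on M W f \<Longrightarrow> (U, \<phi>) \<in> charts M \<Longrightarrow> smooth_on (\<phi> ` (U \<inter> W)) (f \<circ> inv_into U \<phi>)"
  unfolding smooth_fun_on_def by fast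

lemma smooth_mapI':
  assumes "continuous_map (mfd_top M) (mfd_top N) F"
    and "\<And>U \<phi> V \<psi>. (U, \<phi>) \<in> charts M \<Longrightarrow> (V, \<psi>) \<in> charts N \<Longrightarrow>
      smooth_on (\<phi> ` {x\<in>U. F x \<in> V}) (\<psi> \<circ> F \<circ> inv_into U \<phi>)"
  shows "smooth_map M N F"
  using assms unfolding smooth_map_def by fast

lemma smooth_map_continuous: "smooth_map M N F \<Longrightarrow> continuous_map (mfd_top M) (mfd_top N) F"
  unfolding smooth_map_def by blast

lemma injective_atlasD:
  "injective_atlas M \<Longrightarrow> (U, \<phi>) \<in> charts M \<Longrightarrow> openin (mfd_top M) U \<and> inj_on \<phi> U"
  unfolding injective_atlas_def by fast

lemma smooth_into_continuous: "smooth_into M S h \<Longrightarrow> continuous_map (top_of_set S) (mfd_top M) h"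
  unfolding smooth_into_def by blast

lemma smooth_curve_iff: "smooth_curve M c \<longleftrightarrow> (\<exists>\<epsilon>>0. smooth_into M {-\<epsilon><..<\<epsilon>} c)"
  unfolding smooth_curve_def smooth_into_def ..

lemma
  assumes "smooth_manifold M" "(U, \<phi>) \<in> charts M"
  shows chart_openin: "openin (mfd_top M) U" and chart_image_open: "open (\<phi> ` U)"
    and chart_inj: "inj_on \<phi> U"
    and chart_homeomorphic: "homeomorphic_map (subtopology (mfd_top M) U) (top_of_set (\<phi> ` U)) \<phi>"
    and chart_subset: "U \<subseteq> topspace (mfd_top M)"
proof -
  show *: "openin (mfd_top M) U" "open (\<phi> ` U)"
    and h: "homeomorphic_map (subtopology (mfd_top M) U) (top_of_set (\<phi> ` U)) \<phi>"
    using assms unfolding smooth_manifold_def by auto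
  show U: "U \<subseteq> topspace (mfd_top M)" using * openin_subset by blast
  then show "inj_on \<phi> U"
    using homeomorphic_imp_injective_map[OF h] by (simp add: Int_absorb1)
qed

lemma chart_open_image:
  assumes "smooth_manifold M" "(U, \<phi>) \<in> charts M" "openin (mfd_top M) W"
  shows "open (\<phi> ` (U \<inter> W))"
proof -
  have "openin (subtopology (mfd_top M) U) (U \<inter> W)"
    using assms(3) by (simp add: openin_subtopology_Int2)
  then have "openin (top_of_set (\<phi> ` U)) (\<phi> ` (U \<inter> W))"
    using homeomorphic_imp_open_map[OF chart_homeomorphic[OF assms(1,2)]] unfolding open_map_def by blast
  then show ?thesis
    using chart_image_open[OF assms(1,2)] openin_open_eq by blast
qed

lemma smooth_manifold_atlas: "smooth_manifold M \<Longrightarrow> injective_atlas M"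
  unfolding injective_atlas_def
proof (intro conjI ballI)
  show "\<Union>(fst ` charts M) = topspace (mfd_top M)" if "smooth_manifold M"
    using that unfolding smooth_manifold_def by blast
  show "case C of (U, \<phi>) \<Rightarrow> openin (mfd_top M) U \<and> inj_on \<phi> U" if "smooth_manifold M" "C \<in> charts M" for C
  proof (cases C)
    case (Pair U \<phi>)
    then show ?thesis
      using chart_inj[of M U \<phi>] chart_openin[of M U \<phi>] that by simp
  qed
qed

lemma chart_at_point:
  assumes "injective_atlas M" "p \<in> topspace (mfd_top M)"
  obtains U \<phi> where "(U, \<phi>) \<in> charts M" "p \<in> U"
proof -
  have "p \<in> \<Union>(fst ` charts M)" using assms unfolding injective_atlas_def by simp
  then obtain C where "C \<in> charts M" "p \<in> fst C" by blast
  then show ?thesis using that[of "fst C" "snd C"] by simp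
qed

lemma prod_manifold_chart_cases:
  assumes "(U, \<phi>) \<in> charts (prod_manifold M N)"
  obtains A \<xi> B \<psi> where "U = A \<times> B" "\<phi> = map_prod \<xi> \<psi>" "(A, \<xi>) \<in> charts M" "(B, \<psi>) \<in> charts N"
  using assms unfolding prod_manifold_def manifold.simps mem_Collect_eq prod.inject by blast

text \<open>Makes the composition rules available for group multiplication, whose domain is a
  product.\<close>

lemma injective_atlas_prod:
  assumes "injective_atlas M" "injective_atlas N"
  shows "injective_atlas (prod_manifold M N)"
proof -
  have cover: "\<exists>C\<in>charts (prod_manifold M N). (p, q) \<in> fst C"
    if pq: "p \<in> topspace (mfd_top M)" "q \<in> topspace (mfd_top N)" for p q
  proof -
    obtain U \<phi> V \<psi> where "(U, \<phi>) \<in> charts M" "p \<in> U" "(V, \<psi>) \<in> charts N" "q \<in> V"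
      using chart_at_point[OF assms(1) pq(1)] chart_at_point[OF assms(2) pq(2)] by metis
    then show ?thesis
      by (intro bexI[of _ "(U \<times> V, map_prod \<phi> \<psi>)"]) (auto simp: prod_manifold_def)
  qed
  moreover have "openin (mfd_top (prod_manifold M N)) U \<and> inj_on \<phi> U \<and>
      U \<subseteq> topspace (mfd_top (prod_manifold M N))"
    if chart: "(U, \<phi>) \<in> charts (prod_manifold M N)" for U \<phi>
  proof -
    obtain A \<xi> B \<psi> where *: "U = A \<times> B" "\<phi> = map_prod \<xi> \<psi>" "(A, \<xi>) \<in> charts M" "(B, \<psi>) \<in> charts N"
      using chart by (rule prod_manifold_chart_cases)
    then have "openin (mfd_top M) A" "openin (mfd_top N) B" "inj_on \<xi> A" "inj_on \<psi> B"
      using assms unfolding injective_atlas_def by auto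
    then have "openin (mfd_top (prod_manifold M N)) U" "inj_on \<phi> U"
      using * by (auto simp: prod_manifold_def openin_prod_Times_iff inj_on_def)
    then show ?thesis using openin_subset by blast
  qed
  ultimately have 1: "openin (mfd_top (prod_manifold M N)) U \<and> inj_on \<phi> U \<and>
      U \<subseteq> topspace (mfd_top (prod_manifold M N))"
    if "(U, \<phi>) \<in> charts (prod_manifold M N)" for U \<phi> using that by blast
  have "topspace (mfd_top (prod_manifold M N)) \<subseteq> \<Union> (fst ` charts (prod_manifold M N))"
    using cover by (auto simp: prod_manifold_def)
  moreover have "\<Union> (fst ` charts (prod_manifold M N)) \<subseteq> topspace (mfd_top (prod_manifold M N))"
    using 1 by fastforce
  ultimately show ?thesis
    unfolding injective_atlas_def using 1 by blast
qed

lemma smooth_into_open_vimage: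
  assumes "smooth_into M S h" "open S" "openin (mfd_top M) W"
  shows "open {t\<in>S. h t \<in> W}"
proof -
  have "openin (top_of_set S) {t\<in>S. h t \<in> W}"
    using assms openin_continuous_map_preimage unfolding smooth_into_def by fastforce
  then show ?thesis using assms(2) openin_open_eq by blast
qed

lemma smooth_into_topspace: "smooth_into M S h \<Longrightarrow> t \<in> S \<Longrightarrow> h t \<in> topspace (mfd_top M)"
  unfolding smooth_into_def continuous_map_def by auto

text \<open>Near each parameter the composite factors through a chart as the coordinate expression
  of \<open>g\<close> after that of \<open>h\<close>. The target of \<open>g\<close> is left general
  so that both real functions and coordinate expressions of maps are covered.\<close>

lemma smooth_on_compose_smooth_into:
  assumes M: "injective_atlas M" and W: "openin (mfd_top M) W"
    and g: "\<And>U \<phi>. (U, \<phi>) \<in> charts M \<Longrightarrow> smooth_on (\<phi> ` (U \<inter> W)) (g \<circ> inv_into U \<phi>)"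
    and h: "smooth_into M S h" and S: "open S"
  shows "smooth_on {t\<in>S. h t \<in> W} (\<lambda>t. g (h t))"
proof (rule smooth_on_local)
  fix t assume t: "t \<in> {t\<in>S. h t \<in> W}"
  then have "h t \<in> topspace (mfd_top M)" using smooth_into_topspace[OF h] by auto
  then obtain U \<phi> where U: "(U, \<phi>) \<in> charts M" "h t \<in> U" using chart_at_point[OF M] by blast
  have U': "openin (mfd_top M) U" "inj_on \<phi> U" using M U unfolding injective_atlas_def by auto
  let ?O = "{t\<in>S. h t \<in> U \<inter> W}"
  have O: "open ?O" by (rule smooth_into_open_vimage[OF h S]) (use U' W in auto)
  have "smooth_on ?O (\<phi> \<circ> h)"
    using h U unfolding smooth_into_def by (force intro: smooth_on_subset)
  then have "smooth_on ?O (\<lambda>t. (g \<circ> inv_into U \<phi>) ((\<phi> \<circ> h) t))"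
    by (rule smooth_on_compose[OF O g[OF U(1)]]) auto
  then have "smooth_on ?O (\<lambda>t. g (h t))"
    by (rule smooth_on_cong[OF O, rotated]) (use U' in \<open>auto simp: inv_into_f_f\<close>)
  then show "\<exists>U. open U \<and> t \<in> U \<and> smooth_on U (\<lambda>t. g (h t))"
    using O t U by blast
qed

lemma smooth_fun_on_compose_smooth_into:
  assumes "smooth_manifold M" "smooth_fun_on M W f" "smooth_into M S h" "open S"
  shows "smooth_on {t\<in>S. h t \<in> W} (\<lambda>t. f (h t))"
  using assms by (intro smooth_on_compose_smooth_into[OF smooth_manifold_atlas])
    (auto simp: smooth_fun_on_def)

lemma smooth_map_compose_smooth_into:
  assumes M: "injective_atlas M" and F: "smooth_map M N F" and N: "injective_atlas N"
    and h: "smooth_into M S h" "open S"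
  shows "smooth_into N S (\<lambda>t. F (h t))"
proof (rule smooth_intoI)
  show "continuous_map (top_of_set S) (mfd_top N) (\<lambda>t. F (h t))"
    by (rule continuous_map_compose[OF smooth_into_continuous[OF h(1)] smooth_map_continuous[OF F],
          unfolded comp_def])
  fix V \<psi> assume V: "(V, \<psi>) \<in> charts N"
  let ?W = "{x \<in> topspace (mfd_top M). F x \<in> V}"
  note VN = conjunct1[OF injective_atlasD[OF N V]]
  note W = openin_continuous_map_preimage[OF smooth_map_continuous[OF F] VN]
  have "smooth_on (\<phi> ` (U \<inter> ?W)) ((\<psi> \<circ> F) \<circ> inv_into U \<phi>)" if U: "(U, \<phi>) \<in> charts M" for U \<phi>
  proof -
    have "U \<subseteq> topspace (mfd_top M)"
      by (rule openin_subset[OF conjunct1[OF injective_atlasD[OF M U]]])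
    then have "U \<inter> ?W = {x\<in>U. F x \<in> V}" by auto
    then show ?thesis using F U V unfolding smooth_map_def by auto
  qed
  note * = smooth_on_compose_smooth_into[OF M W this h]
  have "{t \<in> S. F (h t) \<in> V} \<subseteq> {t \<in> S. h t \<in> ?W}"
    using smooth_into_topspace[OF h(1)] by blast
  from smooth_on_subset[OF * this]
  show "smooth_on {t \<in> S. F (h t) \<in> V} (\<psi> \<circ> (\<lambda>t. F (h t)))"
    by (simp add: comp_def)
qed

lemma smooth_into_Pair:
  assumes "smooth_into M S h" "smooth_into N S h'"
  shows "smooth_into (prod_manifold M N) S (\<lambda>t. (h t, h' t))"
proof (rule smooth_intoI)
  show "continuous_map (top_of_set S) (mfd_top (prod_manifold M N)) (\<lambda>t. (h t, h' t))"
    using assms unfolding smooth_into_def prod_manifold_def by (simp add: continuous_map_pairedI)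
  fix U \<phi> assume "(U, \<phi>) \<in> charts (prod_manifold M N)"
  then obtain A \<xi> B \<psi> where *: "U = A \<times> B" "\<phi> = map_prod \<xi> \<psi>" "(A, \<xi>) \<in> charts M" "(B, \<psi>) \<in> charts N"
    by (rule prod_manifold_chart_cases)
  then have "smooth_on {t\<in>S. h t \<in> A} (\<xi> \<circ> h)" "smooth_on {t\<in>S. h' t \<in> B} (\<psi> \<circ> h')"
    using assms unfolding smooth_into_def by auto
  then have "smooth_on {t\<in>S. h t \<in> A \<and> h' t \<in> B} (\<lambda>t. ((\<xi> \<circ> h) t, (\<psi> \<circ> h') t))"
    by (intro smooth_on_Pair) (erule smooth_on_subset, blast)+
  then show "smooth_on {t \<in> S. (h t, h' t) \<in> U} (\<phi> \<circ> (\<lambda>t. (h t, h' t)))"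
    using * by (simp add: comp_def)
qed

lemma smooth_into_reparam:
  assumes M: "injective_atlas M" and h: "smooth_into M S h" and S: "open S" "open S'"
    and g: "smooth_on S' g" "\<And>x. x \<in> S' \<Longrightarrow> g x \<in> S"
  shows "smooth_into M S' (\<lambda>x. h (g x))"
proof (rule smooth_intoI)
  have "continuous_map (top_of_set S') (top_of_set S) g"
    using g smooth_on_imp_continuous_on by auto
  then show c: "continuous_map (top_of_set S') (mfd_top M) (\<lambda>x. h (g x))"
    by (rule continuous_map_compose[OF _ smooth_into_continuous[OF h], unfolded comp_def])
  fix U \<phi> assume U: "(U, \<phi>) \<in> charts M"
  have "openin (top_of_set S') {t \<in> S'. h (g t) \<in> U}"
    using openin_continuous_map_preimage[OF c] M U unfolding injective_atlas_def by auto
  then have O: "open {t \<in> S'. h (g t) \<in> U}"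
    using S openin_open_eq by blast
  have "smooth_on {t\<in>S. h t \<in> U} (\<phi> \<circ> h)" using h U unfolding smooth_into_def by auto
  then have "smooth_on {t \<in> S'. h (g t) \<in> U} (\<lambda>x. (\<phi> \<circ> h) (g x))"
    by (rule smooth_on_compose[OF O]) (use g in \<open>auto elim: smooth_on_subset\<close>)
  then show "smooth_on {t \<in> S'. h (g t) \<in> U} (\<phi> \<circ> (\<lambda>x. h (g x)))"
    by (simp add: comp_def)
qed

lemma smooth_into_const: "p \<in> topspace (mfd_top M) \<Longrightarrow> smooth_into M S (\<lambda>_. p)"
  unfolding smooth_into_def by (auto simp: comp_def smooth_on_const)

text \<open>Read in a second chart, the inverse of the first is a transition map, so compatibility
  of the atlas gives smoothness; continuity comes from the chart being a homeomorphism.\<close>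

lemma smooth_into_chart_inverse:
  assumes M: "smooth_manifold M" and U: "(U, \<phi>) \<in> charts M"
  shows "smooth_into M (\<phi> ` U) (inv_into U \<phi>)"
proof (rule smooth_intoI)
  note inj = chart_inj[OF M U]
  show "continuous_map (top_of_set (\<phi> ` U)) (mfd_top M) (inv_into U \<phi>)"
    unfolding continuous_map_def
  proof (intro conjI allI impI)
    show "inv_into U \<phi> \<in> topspace (top_of_set (\<phi> ` U)) \<rightarrow> topspace (mfd_top M)"
      using chart_subset[OF M U] inj by (auto simp: inv_into_f_f)
    fix W assume "openin (mfd_top M) W"
    moreover have "{x \<in> topspace (top_of_set (\<phi> ` U)). inv_into U \<phi> x \<in> W} = \<phi> ` (U \<inter> W)"
      using inj by (auto simp: inv_into_f_f)
    ultimately show "openin (top_of_set (\<phi> ` U)) {x \<in> topspace (top_of_set (\<phi> ` U)). inv_into U \<phi> x \<in> W}"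
      using chart_open_image[OF M U] chart_image_open[OF M U] openin_open_eq by fastforce
  qed
  fix V \<psi> assume "(V, \<psi>) \<in> charts M"
  then have "smooth_on (\<phi> ` (U \<inter> V)) (\<psi> \<circ> inv_into U \<phi>)"
    using M U unfolding smooth_manifold_def by fast
  moreover have "{t \<in> \<phi> ` U. inv_into U \<phi> t \<in> V} = \<phi> ` (U \<inter> V)"
    using inj by (auto simp: inv_into_f_f)
  ultimately show "smooth_on {t \<in> \<phi> ` U. inv_into U \<phi> t \<in> V} (\<psi> \<circ> inv_into U \<phi>)" by simp
qed

text \<open>Testing on chart inverses reduces maps built from group operations to the closure rules
  for \<open>smooth_into\<close>.\<close>

lemma smooth_mapI:
  assumes M: "smooth_manifold M"
    and F: "\<And>U \<phi>. (U, \<phi>) \<in> charts M \<Longrightarrow> smooth_into N (\<phi> ` U) (\<lambda>t. F (inv_into U \<phi> t))"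
  shows "smooth_map M N F"
proof (rule smooth_mapI')
  show "continuous_map (mfd_top M) (mfd_top N) F"
    unfolding continuous_map_def
  proof (intro conjI allI impI)
    have "F x \<in> topspace (mfd_top N)" if x: "x \<in> topspace (mfd_top M)" for x
    proof -
      obtain U \<phi> where U: "(U, \<phi>) \<in> charts M" "x \<in> U"
        using chart_at_point[OF smooth_manifold_atlas[OF M] x] by blast
      then show ?thesis
        using smooth_into_topspace[OF F[OF U(1)], of "\<phi> x"] chart_inj[OF M U(1)] by (auto simp: inv_into_f_f)
    qed
    then show "F \<in> topspace (mfd_top M) \<rightarrow> topspace (mfd_top N)" by blast
    fix W assume W: "openin (mfd_top N) W"
    show "openin (mfd_top M) {x \<in> topspace (mfd_top M). F x \<in> W}"
    proof (subst openin_subopen, intro ballI)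
      fix x assume x: "x \<in> {x \<in> topspace (mfd_top M). F x \<in> W}"
      then obtain U \<phi> where U: "(U, \<phi>) \<in> charts M" "x \<in> U"
        using chart_at_point[OF smooth_manifold_atlas[OF M]] by blast
      have c: "continuous_map (subtopology (mfd_top M) U) (top_of_set (\<phi> ` U)) \<phi>"
        using homeomorphic_imp_continuous_map[OF chart_homeomorphic[OF M U(1)]] .
      have "openin (top_of_set (\<phi> ` U)) {t \<in> topspace (top_of_set (\<phi> ` U)). F (inv_into U \<phi> t) \<in> W}"
        using F[OF U(1)] W openin_continuous_map_preimage unfolding smooth_into_def by blast
      from openin_continuous_map_preimage[OF c this]
      have "openin (subtopology (mfd_top M) U) {x\<in>U. F x \<in> W}"
        using chart_inj[OF M U(1)] chart_subset[OF M U(1)]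
        by (simp add: Int_absorb1 inv_into_f_f conj_commute cong: conj_cong)
      then have "openin (mfd_top M) {x\<in>U. F x \<in> W}"
        using chart_openin[OF M U(1)] openin_trans_full by blast
      then show "\<exists>T. openin (mfd_top M) T \<and> x \<in> T \<and> T \<subseteq> {x \<in> topspace (mfd_top M). F x \<in> W}"
        using U x chart_subset[OF M U(1)] by blast
    qed
  qed
  fix U \<phi> V \<psi> assume U: "(U, \<phi>) \<in> charts M" and V: "(V, \<psi>) \<in> charts N"
  have "\<phi> ` {x\<in>U. F x \<in> V} = {t \<in> \<phi> ` U. F (inv_into U \<phi> t) \<in> V}"
    using chart_inj[OF M U] by (auto simp: inv_into_f_f)
  then show "smooth_on (\<phi> ` {x\<in>U. F x \<in> V}) (\<psi> \<circ> F \<circ> inv_into U \<phi>)"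
    using smooth_intoD[OF F[OF U] V] by (simp add: comp_def)
qed

section \<open>Smooth real functions on a manifold\<close>

lemma smooth_fun_onI:
  assumes M: "smooth_manifold M" and W: "openin (mfd_top M) W"
    and f: "\<And>U \<phi>. (U, \<phi>) \<in> charts M \<Longrightarrow> smooth_on {t \<in> \<phi> ` U. inv_into U \<phi> t \<in> W} (\<lambda>t. f (inv_into U \<phi> t))"
  shows "smooth_fun_on M W f"
proof (rule smooth_fun_onI'[OF W])
  fix U \<phi> assume U: "(U, \<phi>) \<in> charts M"
  have "\<phi> ` (U \<inter> W) = {t \<in> \<phi> ` U. inv_into U \<phi> t \<in> W}"
    using chart_inj[OF M U] by (auto simp: inv_into_f_f)
  then show "smooth_on (\<phi> ` (U \<inter> W)) (f \<circ> inv_into U \<phi>)"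
    using f[OF U] by (simp add: comp_def)
qed

lemma smooth_fun_on_compose_smooth_map:
  assumes M: "smooth_manifold M" and N: "smooth_manifold N"
    and F: "smooth_map M N F" and f: "smooth_fun_on N W f"
  shows "smooth_fun_on M {x \<in> topspace (mfd_top M). F x \<in> W} (\<lambda>x. f (F x))"
proof (rule smooth_fun_onI[OF M])
  show "openin (mfd_top M) {x \<in> topspace (mfd_top M). F x \<in> W}"
    using F f openin_continuous_map_preimage unfolding smooth_map_def smooth_fun_on_def by blast
  fix U \<phi> assume U: "(U, \<phi>) \<in> charts M"
  have "smooth_into N (\<phi> ` U) (\<lambda>t. F (inv_into U \<phi> t))"
    by (rule smooth_map_compose_smooth_into[OF smooth_manifold_atlas[OF M] F
          smooth_manifold_atlas[OF N] smooth_into_chart_inverse[OF M U] chart_image_open[OF M U]])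
  from smooth_fun_on_compose_smooth_into[OF N f this chart_image_open[OF M U]]
  show "smooth_on {t \<in> \<phi> ` U. inv_into U \<phi> t \<in> {x \<in> topspace (mfd_top M). F x \<in> W}} (\<lambda>t. f (F (inv_into U \<phi> t)))"
    by (rule smooth_on_subset) auto
qed

lemma smooth_near_compose_smooth_map:
  assumes "smooth_manifold M" "smooth_manifold N" "smooth_map M N F" "smooth_near N (F p) f"
    "p \<in> topspace (mfd_top M)"
  shows "smooth_near M p (\<lambda>x. f (F x))"
proof -
  obtain W where W: "F p \<in> W" "smooth_fun_on N W f" using assms(4) unfolding smooth_near_def by blast
  show ?thesis
    unfolding smooth_near_def
    using smooth_fun_on_compose_smooth_map[OF assms(1-3) W(2)] assms(5) W(1)
    by (intro exI[of _ "{x \<in> topspace (mfd_top M). F x \<in> W}"]) simp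
qed

lemma smooth_fun_on_openin: "smooth_fun_on M W f \<Longrightarrow> openin (mfd_top M) W"
  unfolding smooth_fun_on_def by blast

lemma smooth_fun_on_subset:
  "smooth_fun_on M W f \<Longrightarrow> openin (mfd_top M) V \<Longrightarrow> V \<subseteq> W \<Longrightarrow> smooth_fun_on M V f"
  by (rule smooth_fun_onI', assumption, erule smooth_on_subset[OF smooth_fun_onD]) auto

lemma smooth_fun_on_cong:
  assumes "smooth_manifold M" "smooth_fun_on M W f" "\<And>x. x \<in> W \<Longrightarrow> f x = g x"
  shows "smooth_fun_on M W g"
proof (rule smooth_fun_onI')
  show W: "openin (mfd_top M) W" using assms smooth_fun_on_openin by blast
  fix U \<phi> assume U: "(U, \<phi>) \<in> charts M"
  show "smooth_on (\<phi> ` (U \<inter> W)) (g \<circ> inv_into U \<phi>)"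
    by (rule smooth_on_cong[OF chart_open_image[OF assms(1) U W], of "f \<circ> inv_into U \<phi>"])
       (use assms(3) chart_inj[OF assms(1) U] smooth_fun_onD[OF assms(2) U] in \<open>auto simp: inv_into_f_f\<close>)
qed

lemma smooth_fun_on_const: "openin (mfd_top M) W \<Longrightarrow> smooth_fun_on M W (\<lambda>_. c)"
  unfolding smooth_fun_on_def by (auto simp: comp_def smooth_on_const)

lemma smooth_fun_on_add:
  "smooth_fun_on M W f \<Longrightarrow> smooth_fun_on M W g \<Longrightarrow> smooth_fun_on M W (\<lambda>x. f x + g x)"
  unfolding smooth_fun_on_def by (auto simp: comp_def intro!: smooth_on_add)

lemma smooth_fun_on_mult:
  "smooth_fun_on M W f \<Longrightarrow> smooth_fun_on M W g \<Longrightarrow> smooth_fun_on M W (\<lambda>x. f x * g x)"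
  unfolding smooth_fun_on_def by (auto simp: comp_def intro!: smooth_on_mult)

lemma smooth_fun_on_sum:
  assumes "openin (mfd_top M) W" "\<And>i. i \<in> I \<Longrightarrow> smooth_fun_on M W (f i)"
  shows "smooth_fun_on M W (\<lambda>x. \<Sum>i\<in>I. f i x)"
  using assms(2) by (induction I rule: infinite_finite_induct)
    (auto intro: smooth_fun_on_const[OF assms(1)] smooth_fun_on_add)

lemma smooth_fun_on_inverse:
  assumes "smooth_manifold M" "smooth_fun_on M W f" "\<And>x. x \<in> W \<Longrightarrow> f x \<noteq> 0"
  shows "smooth_fun_on M W (\<lambda>x. inverse (f x))"
proof (rule smooth_fun_onI'[OF smooth_fun_on_openin[OF assms(2)]])
  fix U \<phi> assume U: "(U, \<phi>) \<in> charts M"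
  have "smooth_on (\<phi> ` (U \<inter> W)) (\<lambda>x. inverse ((f \<circ> inv_into U \<phi>) x))"
    using smooth_fun_onD[OF assms(2) U]
    by (rule smooth_on_inverse[rotated]) (use assms(3) chart_inj[OF assms(1) U] in \<open>auto simp: inv_into_f_f\<close>)
  then show "smooth_on (\<phi> ` (U \<inter> W)) ((\<lambda>x. inverse (f x)) \<circ> inv_into U \<phi>)"
    by (simp add: comp_def)
qed

lemma smooth_fun_on_chart_compose:
  assumes M: "smooth_manifold M" and U: "(U, \<phi>) \<in> charts M" and W: "openin (mfd_top M) W"
    and g: "smooth_on (\<phi> ` (U \<inter> W)) g"
  shows "smooth_fun_on M (U \<inter> W) (\<lambda>x. g (\<phi> x))"
proof (rule smooth_fun_onI[OF M])
  show UW: "openin (mfd_top M) (U \<inter> W)" using chart_openin[OF M U] W by blast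
  fix V \<psi> assume V: "(V, \<psi>) \<in> charts M"
  have eq: "{t \<in> \<psi> ` V. inv_into V \<psi> t \<in> U \<inter> W} = \<psi> ` (V \<inter> (U \<inter> W))"
    using chart_inj[OF M V] by (auto simp: inv_into_f_f)
  have "smooth_on (\<psi> ` (V \<inter> U)) (\<phi> \<circ> inv_into V \<psi>)"
    using M U V unfolding smooth_manifold_def by fast
  then have "smooth_on (\<psi> ` (V \<inter> (U \<inter> W))) (\<phi> \<circ> inv_into V \<psi>)"
    by (rule smooth_on_subset) auto
  then have "smooth_on (\<psi> ` (V \<inter> (U \<inter> W))) (\<lambda>t. g ((\<phi> \<circ> inv_into V \<psi>) t))"
    by (rule smooth_on_compose[OF chart_open_image[OF M V UW] g])
       (use chart_inj[OF M V] in \<open>auto simp: inv_into_f_f\<close>)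
  then show "smooth_on {t \<in> \<psi> ` V. inv_into V \<psi> t \<in> U \<inter> W} (\<lambda>t. g (\<phi> (inv_into V \<psi> t)))"
    unfolding eq by simp
qed

lemma smooth_fun_on_coordinate:
  assumes M: "smooth_manifold M" and U: "(U, \<phi>) \<in> charts M"
  shows "smooth_fun_on M U (\<lambda>x. \<phi> x \<bullet> b)"
  using smooth_fun_on_chart_compose[OF M U chart_openin[OF M U], OF smooth_on_linear[OF bounded_linear_inner_left]] by simp

lemma smooth_near_cong:
  assumes "smooth_manifold M" "openin (mfd_top M) W" "p \<in> W" "\<And>x. x \<in> W \<Longrightarrow> f x = g x" "smooth_near M p f"
  shows "smooth_near M p g"
proof -
  obtain V where V: "p \<in> V" "smooth_fun_on M V f" using assms(5) unfolding smooth_near_def by blast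
  then have "smooth_fun_on M (V \<inter> W) f"
    using assms(2) smooth_fun_on_openin smooth_fun_on_subset by blast
  then have "smooth_fun_on M (V \<inter> W) g"
    by (rule smooth_fun_on_cong[OF assms(1)]) (use assms(4) in auto)
  then show ?thesis using V assms(3) unfolding smooth_near_def by blast
qed

lemma smooth_nearE_Int:
  assumes "smooth_near M p f" "openin (mfd_top M) W" "p \<in> W"
  obtains V where "p \<in> V" "V \<subseteq> W" "smooth_fun_on M V f"
  using assms smooth_fun_on_openin smooth_fun_on_subset unfolding smooth_near_def
  by (metis Int_iff Int_lower1 Int_lower2 openin_Int)

lemma smooth_fun_on_imp_near: "smooth_fun_on M W f \<Longrightarrow> p \<in> W \<Longrightarrow> smooth_near M p f"
  unfolding smooth_near_def by blast

lemma
  assumes "smooth_near M p f" "smooth_near M p g"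
  shows smooth_near_mult: "smooth_near M p (\<lambda>x. f x * g x)"
    and smooth_near_add: "smooth_near M p (\<lambda>x. f x + g x)"
proof -
  obtain W where W: "p \<in> W" "smooth_fun_on M W f" using assms unfolding smooth_near_def by blast
  obtain V where V: "p \<in> V" "V \<subseteq> W" "smooth_fun_on M V g"
    using smooth_nearE_Int[OF assms(2)] W smooth_fun_on_openin by blast
  have "smooth_fun_on M V f" using W V smooth_fun_on_openin smooth_fun_on_subset by blast
  with V show "smooth_near M p (\<lambda>x. f x * g x)" "smooth_near M p (\<lambda>x. f x + g x)"
    unfolding smooth_near_def using smooth_fun_on_mult[of M V f g] smooth_fun_on_add[of M V f g] by blast+
qed

lemma smooth_near_const: "p \<in> topspace (mfd_top M) \<Longrightarrow> smooth_near M p (\<lambda>_. c)"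
  unfolding smooth_near_def using smooth_fun_on_const openin_topspace by blast

lemma smooth_near_sum:
  assumes "p \<in> topspace (mfd_top M)" "\<And>i. i \<in> I \<Longrightarrow> smooth_near M p (f i)"
  shows "smooth_near M p (\<lambda>x. \<Sum>i\<in>I. f i x)"
  using assms(2) by (induction I rule: infinite_finite_induct)
    (auto intro: smooth_near_const[OF assms(1)] smooth_near_add)

section \<open>Tangent vectors as derivatives along curves\<close>

lemma smooth_curve_eventually:
  assumes c: "smooth_curve M c" and W: "openin (mfd_top M) W" "c 0 \<in> W"
  shows "\<forall>\<^sub>F t in nhds 0. c t \<in> W"
proof -
  obtain e where e: "e > 0" "smooth_into M {-e<..<e} c" using c unfolding smooth_curve_iff by blast
  have "open {t\<in>{-e<..<e}. c t \<in> W}"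
    by (rule smooth_into_open_vimage[OF e(2) _ W(1)]) simp
  moreover have "0 \<in> {t\<in>{-e<..<e}. c t \<in> W}" using e W by simp
  ultimately show ?thesis unfolding eventually_nhds by blast
qed

lemma smooth_curve_compose_smooth_map:
  assumes M: "injective_atlas M" and F: "smooth_map M N F" and N: "injective_atlas N"
    and c: "smooth_curve M c"
  shows "smooth_curve N (\<lambda>t. F (c t))"
  using smooth_map_compose_smooth_into[OF M F N] c unfolding smooth_curve_iff by (metis open_greaterThanLessThan)

lemma smooth_near_along_curve:
  assumes M: "smooth_manifold M" and c: "smooth_curve M c" and f: "smooth_near M (c 0) f"
  shows "\<exists>e>0. smooth_on {-e<..<e} (\<lambda>t. f (c t))"
proof -
  obtain e where e: "e > 0" "smooth_into M {-e<..<e} c" using c unfolding smooth_curve_iff by blast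
  obtain W where W: "c 0 \<in> W" "smooth_fun_on M W f" using f unfolding smooth_near_def by blast
  let ?O = "{t\<in>{-e<..<e}. c t \<in> W}"
  have "smooth_on ?O (\<lambda>t. f (c t))"
    by (rule smooth_fun_on_compose_smooth_into[OF M W(2) e(2)]) simp
  moreover have "open ?O"
    by (rule smooth_into_open_vimage[OF e(2) _ smooth_fun_on_openin[OF W(2)]]) simp
  moreover have "0 \<in> ?O" using e W by simp
  ultimately obtain d where "d > 0" "ball 0 d \<subseteq> ?O" using open_contains_ball by blast
  moreover have "ball 0 d = {-d<..<d}" by (auto simp: dist_real_def)
  ultimately show ?thesis using \<open>smooth_on ?O _\<close> smooth_on_subset by metis
qed

lemma smooth_on_real_derivative:
  fixes f :: "real \<Rightarrow> real"
  assumes "smooth_on {-e<..<e} f" "e > 0"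
  shows "(f has_real_derivative deriv f 0) (at 0)"
proof -
  have "f differentiable at 0"
    using smooth_on_has_derivative[OF _ assms(1), of 0] assms(2) unfolding differentiable_def by auto
  then show ?thesis by (simp add: DERIV_deriv_iff_real_differentiable)
qed

text \<open>Turns the total operator \<open>deriv\<close> in \<open>velocity\<close> into a genuine
  derivative. The rules for tangent vectors then follow from the rules for real functions by
  uniqueness of derivatives.\<close>

lemma tangent_vector_curve:
  assumes M: "smooth_manifold M" and v: "v \<in> tangent_space M p"
  obtains c where "smooth_curve M c" "c 0 = p" "v = velocity M c"
    "\<And>f. smooth_near M p f \<Longrightarrow> ((\<lambda>t. f (c t)) has_real_derivative v f) (at 0)"
proof -
  obtain c where c: "smooth_curve M c" "c 0 = p" "v = velocity M c"
    using v unfolding tangent_space_def by blast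
  have "((\<lambda>t. f (c t)) has_real_derivative v f) (at 0)" if "smooth_near M p f" for f
  proof -
    obtain e where "e > 0" "smooth_on {-e<..<e} (\<lambda>t. f (c t))"
      using smooth_near_along_curve[OF M c(1)] c(2) \<open>smooth_near M p f\<close> by blast
    then show ?thesis
      using smooth_on_real_derivative that c unfolding velocity_def by simp
  qed
  with c show thesis using that by blast
qed

lemma tangent_space_topspace:
  assumes "v \<in> tangent_space M p"
  shows "p \<in> topspace (mfd_top M)"
proof -
  obtain c where c: "c 0 = p" "smooth_curve M c"
    using assms unfolding tangent_space_def by blast
  then obtain e where "e > 0" "smooth_into M {-e<..<e} c"
    unfolding smooth_curve_iff by blast
  then show ?thesis using smooth_into_topspace[of M "{-e<..<e}" c 0] c(1) by simp
qed

lemma tangent_vector_not_smooth: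
  "v \<in> tangent_space M p \<Longrightarrow> \<not> smooth_near M p f \<Longrightarrow> v f = 0"
  unfolding tangent_space_def velocity_def by auto

text \<open>Smoothness near \<open>p\<close> is itself local: either both functions are smooth there
  and agree along the representing curve for small times, or both receive the default value
  0.\<close>

lemma tangent_vector_local:
  assumes M: "smooth_manifold M" and v: "v \<in> tangent_space M p"
    and W: "openin (mfd_top M) W" "p \<in> W" and eq: "\<And>x. x \<in> W \<Longrightarrow> f x = g x"
  shows "v f = v g"
proof (cases "smooth_near M p f")
  case True
  then have g: "smooth_near M p g" using smooth_near_cong[OF M W, of f g] eq by blast
  obtain c where c: "smooth_curve M c" "c 0 = p"
    "\<And>f. smooth_near M p f \<Longrightarrow> ((\<lambda>t. f (c t)) has_real_derivative v f) (at 0)"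
    using tangent_vector_curve[OF M v] by blast
  have "\<forall>\<^sub>F t in nhds 0. f (c t) = g (c t)"
    using smooth_curve_eventually[OF c(1) W(1)] c(2) W(2) eq by (auto elim: eventually_mono)
  then have "((\<lambda>t. g (c t)) has_real_derivative v f) (at 0)"
    using c(3)[OF True] DERIV_cong_ev[OF refl _ refl, of "\<lambda>t. f (c t)" "\<lambda>t. g (c t)" 0 "v f"] by blast
  then show ?thesis by (rule DERIV_unique[OF _ c(3)[OF g]])
next
  case False
  then have "\<not> smooth_near M p g" using smooth_near_cong[OF M W, of g f] eq by auto
  then show ?thesis using False tangent_vector_not_smooth[OF v] by simp
qed

lemma
  assumes M: "smooth_manifold M" and v: "v \<in> tangent_space M p"
    and f: "smooth_near M p f" "smooth_near M p g"
  shows tangent_vector_add: "v (\<lambda>x. f x + g x) = v f + v g"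
    and tangent_vector_mult: "v (\<lambda>x. f x * g x) = v f * g p + f p * v g"
proof -
  obtain c where c: "c 0 = p"
    "\<And>f. smooth_near M p f \<Longrightarrow> ((\<lambda>t. f (c t)) has_real_derivative v f) (at 0)"
    using tangent_vector_curve[OF M v] by blast
  note d = c(2)[OF f(1)] c(2)[OF f(2)]
  show "v (\<lambda>x. f x + g x) = v f + v g"
    using DERIV_unique[OF c(2)[OF smooth_near_add[OF f]] DERIV_add[OF d]] .
  show "v (\<lambda>x. f x * g x) = v f * g p + f p * v g"
    using DERIV_unique[OF c(2)[OF smooth_near_mult[OF f]] DERIV_mult[OF d]] c(1)
    by (simp add: algebra_simps)
qed

lemma tangent_vector_const:
  assumes M: "smooth_manifold M" and v: "v \<in> tangent_space M p"
  shows "v (\<lambda>_. k) = 0"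
proof -
  note s = smooth_near_const[OF tangent_space_topspace[OF v], of k]
  obtain c where c: "c 0 = p"
    "\<And>f. smooth_near M p f \<Longrightarrow> ((\<lambda>t. f (c t)) has_real_derivative v f) (at 0)"
    using tangent_vector_curve[OF M v] by blast
  show ?thesis by (rule DERIV_unique[OF c(2)[OF s] DERIV_const])
qed

lemma tangent_vector_sum:
  assumes M: "smooth_manifold M" and v: "v \<in> tangent_space M p"
    and f: "\<And>i. i \<in> I \<Longrightarrow> smooth_near M p (f i)"
  shows "v (\<lambda>x. \<Sum>i\<in>I. f i x) = (\<Sum>i\<in>I. v (f i))"
  using f
proof (induction I rule: infinite_finite_induct)
  case (insert i I)
  then show ?case
    using tangent_vector_add[OF M v _ smooth_near_sum[OF tangent_space_topspace[OF v]], of "f i" I f] by simp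
qed (use tangent_vector_const[OF M v] in auto)

lemma tangent_vector_scale:
  assumes M: "smooth_manifold M" and v: "v \<in> tangent_space M p" and f: "smooth_near M p f"
  shows "v (\<lambda>x. k * f x) = k * v f"
  using tangent_vector_mult[OF M v smooth_near_const[OF tangent_space_topspace[OF v]] f, of k]
    tangent_vector_const[OF M v] by simp

lemma smooth_near_chart:
  assumes M: "smooth_manifold M" and U: "(U, \<phi>) \<in> charts M" and p: "p \<in> U" and f: "smooth_near M p f"
  obtains W where "W \<subseteq> U" "p \<in> W" "smooth_fun_on M W f" "open (\<phi> ` W)" "\<phi> p \<in> \<phi> ` W"
    "smooth_on (\<phi> ` W) (f \<circ> inv_into U \<phi>)"
proof -
  obtain W where W: "p \<in> W" "W \<subseteq> U" "smooth_fun_on M W f"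
    using smooth_nearE_Int[OF f chart_openin[OF M U] p] by blast
  moreover have "U \<inter> W = W" using W by auto
  ultimately show thesis
    using that[of W] chart_open_image[OF M U smooth_fun_on_openin[OF W(3)]] smooth_fun_onD[OF W(3) U] by auto
qed

text \<open>Chain rule along a representing curve. The coordinate velocity of the curve has the
  values of \<open>v\<close> on the coordinate functions as its components, so these values
  determine \<open>v\<close>.\<close>

lemma tangent_vector_in_chart:
  assumes M: "smooth_manifold M" and U: "(U, \<phi>) \<in> charts M" and p: "p \<in> U"
    and v: "v \<in> tangent_space M p" and f: "smooth_near M p f"
  shows "v f = frechet_derivative (f \<circ> inv_into U \<phi>) (at (\<phi> p)) (\<Sum>b\<in>Basis. v (\<lambda>x. \<phi> x \<bullet> b) *\<^sub>R b)"
proof -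
  obtain W where W: "W \<subseteq> U" "p \<in> W" "smooth_fun_on M W f" "open (\<phi> ` W)" "\<phi> p \<in> \<phi> ` W"
    "smooth_on (\<phi> ` W) (f \<circ> inv_into U \<phi>)" using smooth_near_chart[OF M U p f] by blast
  obtain c where c: "smooth_curve M c" "c 0 = p"
    "\<And>f. smooth_near M p f \<Longrightarrow> ((\<lambda>t. f (c t)) has_real_derivative v f) (at 0)"
    using tangent_vector_curve[OF M v] by blast
  let ?d = "\<Sum>b\<in>Basis. v (\<lambda>x. \<phi> x \<bullet> b) *\<^sub>R b"
  have d: "((\<lambda>t. \<phi> (c t)) has_vector_derivative ?d) (at 0)"
  proof -
    have "((\<lambda>t. \<Sum>b\<in>Basis. (\<phi> (c t) \<bullet> b) *\<^sub>R b) has_vector_derivative ?d) (at 0)"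
    proof (rule has_vector_derivative_sum)
      fix b :: 'b assume "b \<in> Basis"
      have "((\<lambda>t. \<phi> (c t) \<bullet> b) has_real_derivative v (\<lambda>x. \<phi> x \<bullet> b)) (at 0)"
        using c(3)[OF smooth_fun_on_imp_near[OF smooth_fun_on_coordinate[OF M U] p]] .
      then show "((\<lambda>t. (\<phi> (c t) \<bullet> b) *\<^sub>R b) has_vector_derivative v (\<lambda>x. \<phi> x \<bullet> b) *\<^sub>R b) (at 0)"
        using has_vector_derivative_scaleR[OF _ has_vector_derivative_const] by fastforce
    qed
    then show ?thesis by (simp add: euclidean_representation)
  qed
  have "((\<lambda>t. (f \<circ> inv_into U \<phi>) (\<phi> (c t))) has_real_derivative
      frechet_derivative (f \<circ> inv_into U \<phi>) (at (\<phi> p)) ?d) (at 0)"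
    using has_real_derivative_compose_vector[OF d, of "f \<circ> inv_into U \<phi>"]
      smooth_on_has_derivative[OF W(4,6,5)] c(2) by auto
  moreover have "\<forall>\<^sub>F t in nhds 0. (f \<circ> inv_into U \<phi>) (\<phi> (c t)) = f (c t)"
    using smooth_curve_eventually[OF c(1) chart_openin[OF M U]] c(2) p chart_inj[OF M U]
    by (auto elim!: eventually_mono simp: inv_into_f_f)
  ultimately have "((\<lambda>t. f (c t)) has_real_derivative
      frechet_derivative (f \<circ> inv_into U \<phi>) (at (\<phi> p)) ?d) (at 0)"
    using DERIV_cong_ev[OF refl _ refl, of "\<lambda>t. (f \<circ> inv_into U \<phi>) (\<phi> (c t))" "\<lambda>t. f (c t)" 0] by blast
  then show ?thesis by (rule DERIV_unique[OF c(3)[OF f]])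
qed

section \<open>Tangent spaces and brackets in a chart\<close>

lemma frechet_derivative_Basis_sum:
  assumes "open S" "smooth_on S f" "x \<in> S"
  shows "frechet_derivative f (at x) (\<Sum>b\<in>Basis. a b *\<^sub>R b) = (\<Sum>b\<in>Basis. a b *\<^sub>R frechet_derivative f (at x) b)"
proof -
  have l: "linear (frechet_derivative f (at x))"
    using smooth_on_has_derivative[OF assms] has_derivative_linear by blast
  show ?thesis by (simp add: linear_sum[OF l] linear_cmul[OF l])
qed

text \<open>A linear parametrisation of the tangent space by coordinate vectors \<open>d\<close>. It
  is needed because representing curves cannot be added, while their coordinate directions
  can.\<close>

definition chart_vector ::
  "('a, 'e::euclidean_space) manifold \<Rightarrow> 'a set \<Rightarrow> ('a \<Rightarrow> 'e) \<Rightarrow> 'a \<Rightarrow> 'e \<Rightarrow> 'a tangent_vector" where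
  "chart_vector M U \<phi> p d =
     (\<lambda>f. if smooth_near M p f then frechet_derivative (f \<circ> inv_into U \<phi>) (at (\<phi> p)) d else 0)"

text \<open>The representing curve is the coordinate line through \<phi> p in direction
  \<open>d\<close>, which stays in the open image of the chart for small times.\<close>

lemma chart_vector_in_tangent_space:
  assumes M: "smooth_manifold M" and U: "(U, \<phi>) \<in> charts M" and p: "p \<in> U"
  shows "chart_vector M U \<phi> p d \<in> tangent_space M p"
proof -
  let ?S = "{t::real. \<phi> p + t *\<^sub>R d \<in> \<phi> ` U}"
  have "?S = (\<lambda>t. \<phi> p + t *\<^sub>R d) -` (\<phi> ` U)" by auto
  then have "open ?S"
    using chart_image_open[OF M U] by (auto intro!: continuous_intros)
  moreover have "0 \<in> ?S" using p by simp
  ultimately obtain e where e: "e > 0" "ball 0 e \<subseteq> ?S" using open_contains_ball by blast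
  have eb: "ball 0 e = {-e<..<e}" by (auto simp: dist_real_def)
  define c where "c = (\<lambda>t. inv_into U \<phi> (\<phi> p + t *\<^sub>R d))"
  have "smooth_on {-e<..<e} (\<lambda>t. \<phi> p + t *\<^sub>R d)"
    by (intro smooth_on_add smooth_on_const smooth_on_linear bounded_linear_scaleR_left)
  then have "smooth_into M {-e<..<e} c"
    unfolding c_def
    by (rule smooth_into_reparam[OF smooth_manifold_atlas[OF M] smooth_into_chart_inverse[OF M U]
          chart_image_open[OF M U], rotated]) (use e eb in auto)
  then have cc: "smooth_curve M c" using e smooth_curve_iff by blast
  have c0: "c 0 = p" unfolding c_def using p chart_inj[OF M U] by (simp add: inv_into_f_f)
  have "velocity M c f = chart_vector M U \<phi> p d f" for f
  proof (cases "smooth_near M p f")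
    case True
    obtain W where W: "W \<subseteq> U" "p \<in> W" "smooth_fun_on M W f" "open (\<phi> ` W)" "\<phi> p \<in> \<phi> ` W"
      "smooth_on (\<phi> ` W) (f \<circ> inv_into U \<phi>)" using smooth_near_chart[OF M U p True] by blast
    have "((\<lambda>t. \<phi> p + t *\<^sub>R d) has_vector_derivative d) (at 0)"
      by (auto intro!: derivative_eq_intros)
    from has_real_derivative_compose_vector[OF this, of "f \<circ> inv_into U \<phi>"]
    have "((\<lambda>t. f (c t)) has_real_derivative frechet_derivative (f \<circ> inv_into U \<phi>) (at (\<phi> p)) d) (at 0)"
      using smooth_on_has_derivative[OF W(4,6,5)] by (simp add: c_def)
    then show ?thesis
      unfolding velocity_def chart_vector_def c0 using True by (simp add: DERIV_imp_deriv)
  qed (simp add: velocity_def chart_vector_def c0)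
  then have "chart_vector M U \<phi> p d = velocity M c" by auto
  then show ?thesis unfolding tangent_space_def using cc c0 by blast
qed

lemma tangent_vector_eq_chart_vector:
  assumes M: "smooth_manifold M" and U: "(U, \<phi>) \<in> charts M" and p: "p \<in> U"
    and v: "v \<in> tangent_space M p"
  shows "v = chart_vector M U \<phi> p (\<Sum>b\<in>Basis. v (\<lambda>x. \<phi> x \<bullet> b) *\<^sub>R b)"
  using tangent_vector_in_chart[OF assms] tangent_vector_not_smooth[OF v]
  unfolding chart_vector_def by auto

lemma tangent_vector_eqI:
  assumes M: "smooth_manifold M" and U: "(U, \<phi>) \<in> charts M" and p: "p \<in> U"
    and v: "v \<in> tangent_space M p" and w: "w \<in> tangent_space M p"
    and eq: "\<And>b. b \<in> Basis \<Longrightarrow> v (\<lambda>x. \<phi> x \<bullet> b) = w (\<lambda>x. \<phi> x \<bullet> b)"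
  shows "v = w"
  using tangent_vector_eq_chart_vector[OF M U p v] tangent_vector_eq_chart_vector[OF M U p w] eq
  by (metis (no_types, lifting) sum.cong)

text \<open>Both vectors are directional derivatives in one chart; combining the directions gives a
  direction of the same kind, and hence again a velocity.\<close>

lemma tangent_space_linear_combination:
  assumes M: "smooth_manifold M" and v: "v \<in> tangent_space M p" and w: "w \<in> tangent_space M p"
  shows "(\<lambda>f. a * v f + b * w f) \<in> tangent_space M p"
proof -
  obtain U \<phi> where U: "(U, \<phi>) \<in> charts M" "p \<in> U"
    using chart_at_point[OF smooth_manifold_atlas[OF M] tangent_space_topspace[OF v]] by blast
  obtain d where d: "v = chart_vector M U \<phi> p d" using tangent_vector_eq_chart_vector[OF M U v] by blast
  obtain d' where d': "w = chart_vector M U \<phi> p d'" using tangent_vector_eq_chart_vector[OF M U w] by blast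
  have "a * v f + b * w f = chart_vector M U \<phi> p (a *\<^sub>R d + b *\<^sub>R d') f" for f
  proof (cases "smooth_near M p f")
    case True
    obtain W where "W \<subseteq> U" "p \<in> W" "smooth_fun_on M W f" and W: "open (\<phi> ` W)" "\<phi> p \<in> \<phi> ` W"
      "smooth_on (\<phi> ` W) (f \<circ> inv_into U \<phi>)" using smooth_near_chart[OF M U True] by blast
    have l: "linear (frechet_derivative (f \<circ> inv_into U \<phi>) (at (\<phi> p)))"
      using smooth_on_has_derivative[OF W(1,3,2)] has_derivative_linear by blast
    show ?thesis unfolding d d' chart_vector_def using True
      by (simp add: linear_add[OF l] linear_cmul[OF l])
  qed (simp add: d d' chart_vector_def)
  then have "(\<lambda>f. a * v f + b * w f) = chart_vector M U \<phi> p (a *\<^sub>R d + b *\<^sub>R d')" by auto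
  then show ?thesis using chart_vector_in_tangent_space[OF M U] by simp
qed

lemma differential_in_tangent_space:
  assumes M: "smooth_manifold M" and N: "smooth_manifold N" and F: "smooth_map M N F"
    and v: "v \<in> tangent_space M p"
  shows "differential M N F p v \<in> tangent_space N (F p)"
proof -
  obtain c where c: "smooth_curve M c" "c 0 = p" "v = velocity M c"
    using v unfolding tangent_space_def by blast
  have p: "p \<in> topspace (mfd_top M)" using tangent_space_topspace[OF v] .
  have "smooth_curve N (\<lambda>t. F (c t))"
    by (rule smooth_curve_compose_smooth_map[OF smooth_manifold_atlas[OF M] F
          smooth_manifold_atlas[OF N] c(1)])
  moreover have "differential M N F p v f = velocity N (\<lambda>t. F (c t)) f" for f
    using smooth_near_compose_smooth_map[OF M N F _ p, of f] c
    unfolding differential_def velocity_def by (simp add: comp_def)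
  ultimately show ?thesis unfolding tangent_space_def using c(2) by (auto intro!: exI[of _ "\<lambda>t. F (c t)"])
qed

lemma differential_apply: "smooth_near N (F p) f \<Longrightarrow> differential M N F p v f = v (\<lambda>x. f (F x))"
  unfolding differential_def comp_def by simp

lemma smooth_fun_on_partial:
  assumes M: "smooth_manifold M" and U: "(U, \<phi>) \<in> charts M" and f: "smooth_fun_on M W f" "W \<subseteq> U"
  shows "smooth_fun_on M W (\<lambda>q. frechet_derivative (f \<circ> inv_into U \<phi>) (at (\<phi> q)) b)"
proof -
  have W: "openin (mfd_top M) W" using smooth_fun_on_openin[OF f(1)] .
  have "U \<inter> W = W" using f by auto
  then show ?thesis
    using smooth_fun_on_chart_compose[OF M U W smooth_on_frechet_derivative[OF chart_open_image[OF M U W] smooth_fun_onD[OF f(1) U]]]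
    by simp
qed

text \<open>In a chart the second-order terms of \<open>X (Y f)\<close> and \<open>Y (X f)\<close> cancel, by the symmetry of
  second derivatives.\<close>

lemma lie_bracket_in_tangent_space:
  assumes M: "smooth_manifold M" and X: "smooth_vector_field_on M W X" and Y: "smooth_vector_field_on M W Y"
    and p: "p \<in> W"
  shows "lie_bracket M X Y p \<in> tangent_space M p"
proof -
  have W: "openin (mfd_top M) W" using X unfolding smooth_vector_field_on_def by blast
  have XT: "\<And>q. q \<in> W \<Longrightarrow> X q \<in> tangent_space M q"
    and XS: "\<And>V f. V \<subseteq> W \<Longrightarrow> smooth_fun_on M V f \<Longrightarrow> smooth_fun_on M V (\<lambda>p. X p f)"
    using X unfolding smooth_vector_field_on_def by blast+
  have YT: "\<And>q. q \<in> W \<Longrightarrow> Y q \<in> tangent_space M q"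
    and YS: "\<And>V f. V \<subseteq> W \<Longrightarrow> smooth_fun_on M V f \<Longrightarrow> smooth_fun_on M V (\<lambda>p. Y p f)"
    using Y unfolding smooth_vector_field_on_def by blast+
  obtain U \<phi> where U: "(U, \<phi>) \<in> charts M" "p \<in> U"
    using chart_at_point[OF smooth_manifold_atlas[OF M] tangent_space_topspace[OF XT[OF p]]] by blast
  let ?x = "\<lambda>b q. \<phi> q \<bullet> b"
  \<comment> \<open>The components of the bracket are its values on the coordinate
    functions.\<close>
  let ?d = "\<Sum>b\<in>Basis. (X p (\<lambda>q. Y q (?x b)) - Y p (\<lambda>q. X q (?x b))) *\<^sub>R b"
  \<comment> \<open>Near \<open>p\<close>, \<open>Z' q f\<close> is the sum of
    \<open>Z' q (?x b)\<close> times the partial derivatives of \<open>f\<close>. The product rule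
    splits its derivative by \<open>Z\<close> into a part with first derivatives of
    \<open>f\<close>, which survives in the bracket, and a part with second derivatives.\<close>
  have expand: "Z p (\<lambda>q. Z' q f) =
      (\<Sum>b\<in>Basis. Z p (\<lambda>q. Z' q (?x b)) * frechet_derivative (f \<circ> inv_into U \<phi>) (at (\<phi> p)) b) +
      (\<Sum>b\<in>Basis. \<Sum>a\<in>Basis. Z' p (?x b) * (Z p (?x a) *
        frechet_derivative (\<lambda>x. frechet_derivative (f \<circ> inv_into U \<phi>) (at x) b) (at (\<phi> p)) a))"
    if ZT: "\<And>q. q \<in> W \<Longrightarrow> Z q \<in> tangent_space M q" and Z'T: "\<And>q. q \<in> W \<Longrightarrow> Z' q \<in> tangent_space M q"
      and Z'S: "\<And>V f. V \<subseteq> W \<Longrightarrow> smooth_fun_on M V f \<Longrightarrow> smooth_fun_on M V (\<lambda>p. Z' p f)"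
      and f: "smooth_near M p f" for Z Z' :: "'a vector_field" and f
  proof -
    let ?f = "f \<circ> inv_into U \<phi>"
    obtain V0 where V0: "p \<in> V0" "V0 \<subseteq> U \<inter> W" "smooth_fun_on M V0 f"
      using smooth_nearE_Int[OF f] W chart_openin[OF M U(1)] U(2) p by (metis IntI openin_Int)
    have V: "openin (mfd_top M) V0" using smooth_fun_on_openin[OF V0(3)] .
    have o: "open (\<phi> ` V0)" and s: "smooth_on (\<phi> ` V0) ?f"
      using chart_open_image[OF M U(1) V] smooth_fun_onD[OF V0(3) U(1)] V0(2) by (auto simp: Int_absorb1)
    let ?F = "\<lambda>b q. frechet_derivative ?f (at (\<phi> q)) b"
    have FS: "smooth_fun_on M V0 (?F b)" for b
      using smooth_fun_on_partial[OF M U(1) V0(3)] V0(2) by blast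
    have xS: "smooth_fun_on M V0 (?x b)" for b
      using smooth_fun_on_subset[OF smooth_fun_on_coordinate[OF M U(1)] V] V0(2) by blast
    have Zx: "smooth_fun_on M V0 (\<lambda>q. Z' q (?x b))" for b
      using Z'S[OF _ xS] V0(2) by blast
    note near = smooth_fun_on_imp_near[OF _ V0(1)]
    have ZF: "Z p (?F b) = (\<Sum>a\<in>Basis. Z p (?x a) * frechet_derivative (\<lambda>x. frechet_derivative ?f (at x) b) (at (\<phi> p)) a)" for b
    proof -
      let ?G = "\<lambda>x. frechet_derivative ?f (at x) b"
      have sG: "smooth_on (\<phi> ` V0) ?G" by (rule smooth_on_frechet_derivative[OF o s])
      have "(?G has_derivative frechet_derivative ?G (at (\<phi> p))) (at (\<phi> p))"
        by (rule smooth_on_has_derivative[OF o sG]) (use V0 in blast)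
      then have "(?F b \<circ> inv_into U \<phi> has_derivative frechet_derivative ?G (at (\<phi> p))) (at (\<phi> p))"
        by (rule has_derivative_transform_within_open[OF _ o])
           (use V0 chart_inj[OF M U(1)] in \<open>auto simp: inv_into_f_f subset_iff\<close>)
      then have "frechet_derivative (?F b \<circ> inv_into U \<phi>) (at (\<phi> p)) = frechet_derivative ?G (at (\<phi> p))"
        using frechet_derivative_at by metis
      then show ?thesis
        using tangent_vector_in_chart[OF M U ZT[OF p] near[OF FS]]
          frechet_derivative_Basis_sum[OF o sG, of "\<phi> p"] V0(1) by simp
    qed
    have "Z p (\<lambda>q. Z' q f) = Z p (\<lambda>q. \<Sum>b\<in>Basis. Z' q (?x b) * ?F b q)"
    proof (rule tangent_vector_local[OF M ZT[OF p] V V0(1)])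
      fix q assume q: "q \<in> V0"
      then have qU: "q \<in> U" "q \<in> W" using V0 by auto
      show "Z' q f = (\<Sum>b\<in>Basis. Z' q (?x b) * ?F b q)"
        using tangent_vector_in_chart[OF M U(1) qU(1) Z'T[OF qU(2)] smooth_fun_on_imp_near[OF V0(3) q]]
          frechet_derivative_Basis_sum[OF o s, of "\<phi> q"] q by simp
    qed
    also have "\<dots> = (\<Sum>b\<in>Basis. Z p (\<lambda>q. Z' q (?x b) * ?F b q))"
      by (rule tangent_vector_sum[OF M ZT[OF p]]) (rule near[OF smooth_fun_on_mult[OF Zx FS]])
    also have "\<dots> = (\<Sum>b\<in>Basis. Z p (\<lambda>q. Z' q (?x b)) * ?F b p + Z' p (?x b) * Z p (?F b))"
      by (intro sum.cong refl tangent_vector_mult[OF M ZT[OF p]] near Zx FS)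
    finally show ?thesis by (simp add: ZF sum.distrib sum_distrib_left)
  qed
  have "lie_bracket M X Y p f = chart_vector M U \<phi> p ?d f" for f
  proof (cases "smooth_near M p f")
    case True
    let ?f = "f \<circ> inv_into U \<phi>"
    obtain V where "V \<subseteq> U" "p \<in> V" "smooth_fun_on M V f" and V: "open (\<phi> ` V)" "\<phi> p \<in> \<phi> ` V" "smooth_on (\<phi> ` V) ?f"
      using smooth_near_chart[OF M U True] by blast
    let ?S = "\<lambda>a b. frechet_derivative (\<lambda>x. frechet_derivative ?f (at x) b) (at (\<phi> p)) a"
    have "(\<Sum>b\<in>Basis. \<Sum>a\<in>Basis. Y p (?x b) * (X p (?x a) * ?S a b)) =
        (\<Sum>a\<in>Basis. \<Sum>b\<in>Basis. Y p (?x b) * (X p (?x a) * ?S a b))"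
      by (rule sum.swap)
    also have "\<dots> = (\<Sum>a\<in>Basis. \<Sum>b\<in>Basis. X p (?x a) * (Y p (?x b) * ?S b a))"
      using frechet_derivative_symmetric[OF V(1,3,2)] by (intro sum.cong refl) (simp add: mult.left_commute)
    finally have "X p (\<lambda>q. Y q f) - Y p (\<lambda>q. X q f) =
        (\<Sum>b\<in>Basis. (X p (\<lambda>q. Y q (?x b)) - Y p (\<lambda>q. X q (?x b))) * frechet_derivative ?f (at (\<phi> p)) b)"
      using expand[OF XT YT YS True] expand[OF YT XT XS True]
      by (simp add: left_diff_distrib sum_subtractf)
    then show ?thesis
      unfolding lie_bracket_def chart_vector_def
      using True frechet_derivative_Basis_sum[OF V(1,3,2)] by simp
  qed (simp add: lie_bracket_def chart_vector_def)
  then have "lie_bracket M X Y p = chart_vector M U \<phi> p ?d" by blast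
  then show ?thesis using chart_vector_in_tangent_space[OF M U] by simp
qed

section \<open>Derivatives of smooth families of functions\<close>

lemma smooth_on_time_derivative:
  fixes \<Phi> :: "'e::euclidean_space \<times> real \<Rightarrow> real"
  assumes "open S" "smooth_on S \<Phi>"
  shows "smooth_on {x. (x, 0) \<in> S} (\<lambda>x. frechet_derivative \<Phi> (at (x, 0)) (0, 1))"
    and "(x, 0) \<in> S \<Longrightarrow>
      ((\<lambda>t. \<Phi> (x, t)) has_real_derivative frechet_derivative \<Phi> (at (x, 0)) (0, 1)) (at 0)"
proof -
  have "{x. (x, 0::real) \<in> S} = (\<lambda>x. (x, 0)) -` S" by auto
  then have o: "open {x. (x, 0::real) \<in> S}"
    using assms(1) by (auto intro!: open_vimage continuous_intros)
  show "smooth_on {x. (x, 0) \<in> S} (\<lambda>x. frechet_derivative \<Phi> (at (x, 0)) (0, 1))"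
    by (rule smooth_on_compose[OF o smooth_on_frechet_derivative[OF assms]])
       (auto intro!: smooth_on_linear bounded_linear_Pair bounded_linear_ident bounded_linear_zero)
  have "((\<lambda>t. (x, t)) has_vector_derivative (0, 1)) (at 0)"
    by (auto intro!: derivative_eq_intros simp: has_vector_derivative_def)
  then show "((\<lambda>t. \<Phi> (x, t)) has_real_derivative frechet_derivative \<Phi> (at (x, 0)) (0, 1)) (at 0)"
    if "(x, 0) \<in> S"
    by (rule has_real_derivative_compose_vector) (rule smooth_on_has_derivative[OF assms that])
qed

text \<open>With a curve \<open>c\<close> for \<open>v\<close>, the value at \<open>q\<close> is the
  time derivative at 0 of a function that is jointly smooth in the coordinates of \<open>q\<close>
  and the time. Asking \<open>F\<close> merely to preserve \<open>smooth_into\<close> covers left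
  translation, right translation and conjugation alike.\<close>

lemma smooth_fun_on_family_derivative:
  fixes M :: "('a, 'e::euclidean_space) manifold" and L :: "('c, 'l::euclidean_space) manifold"
  assumes M: "smooth_manifold M" and N: "smooth_manifold N" and L: "smooth_manifold L"
    and f: "smooth_fun_on L W f" and v: "v \<in> tangent_space N p"
    and F: "\<And>(S :: ('e \<times> real) set) h h'. open S \<Longrightarrow> smooth_into M S h \<Longrightarrow> smooth_into N S h' \<Longrightarrow>
      smooth_into L S (\<lambda>z. F (h z) (h' z))"
    and W': "openin (mfd_top M) W'" "\<And>q. q \<in> W' \<Longrightarrow> F q p \<in> W"
    and near: "\<And>q. q \<in> W' \<Longrightarrow> smooth_near N p (\<lambda>x. f (F q x))"
  shows "smooth_fun_on M W' (\<lambda>q. v (\<lambda>x. f (F q x)))"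
proof (rule smooth_fun_onI[OF M W'(1)])
  fix U \<phi> assume U: "(U, \<phi>) \<in> charts M"
  obtain c where c: "smooth_curve N c" "c 0 = p"
    "\<And>f. smooth_near N p f \<Longrightarrow> ((\<lambda>t. f (c t)) has_real_derivative v f) (at 0)"
    using tangent_vector_curve[OF N v] by blast
  obtain e where e: "e > 0" "smooth_into N {-e<..<e} c" using c(1) unfolding smooth_curve_iff by blast
  let ?S = "\<phi> ` U \<times> {-e<..<e}"
  have S: "open ?S" using chart_image_open[OF M U] by (simp add: open_Times)
  have h: "smooth_into M ?S (\<lambda>z. inv_into U \<phi> (fst z))"
    by (rule smooth_into_reparam[OF smooth_manifold_atlas[OF M] smooth_into_chart_inverse[OF M U]
          chart_image_open[OF M U] S]) (auto intro: smooth_on_linear bounded_linear_fst)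
  have h': "smooth_into N ?S (\<lambda>z. c (snd z))"
    by (rule smooth_into_reparam[OF smooth_manifold_atlas[OF N] e(2) _ S])
       (auto intro: smooth_on_linear bounded_linear_snd)
  let ?h = "\<lambda>z. F (inv_into U \<phi> (fst z)) (c (snd z))"
  let ?O = "{z\<in>?S. ?h z \<in> W}"
  have hs: "smooth_into L ?S ?h" by (rule F[OF S h h'])
  have O: "open ?O" by (rule smooth_into_open_vimage[OF hs S smooth_fun_on_openin[OF f]])
  have s: "smooth_on ?O (\<lambda>z. f (?h z))" by (rule smooth_fun_on_compose_smooth_into[OF L f hs S])
  note D = smooth_on_time_derivative[OF O s]
  let ?A = "{t \<in> \<phi> ` U. inv_into U \<phi> t \<in> W'}"
  have sub: "?A \<subseteq> {x. (x, 0) \<in> ?O}" using e(1) c(2) W'(2) by auto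
  have A: "open ?A"
    by (rule smooth_into_open_vimage[OF smooth_into_chart_inverse[OF M U] chart_image_open[OF M U] W'(1)])
  have "frechet_derivative (\<lambda>z. f (?h z)) (at (x, 0)) (0, 1) = v (\<lambda>y. f (F (inv_into U \<phi> x) y))"
    if "x \<in> ?A" for x
  proof -
    have "(x, 0) \<in> ?O" using that sub by blast
    from D(2)[OF this] c(3)[OF near[of "inv_into U \<phi> x"]] that show ?thesis
      using DERIV_unique by fastforce
  qed
  then show "smooth_on ?A (\<lambda>t. v (\<lambda>x. f (F (inv_into U \<phi> t) x)))"
    by (rule smooth_on_cong[OF A _ smooth_on_subset[OF D(1) sub]])
qed

section \<open>Lie groups and the adjoint action\<close>

lemma smooth_on_line_derivative:
  fixes \<Phi> :: "'p::euclidean_space \<Rightarrow> real"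
  assumes "open S" "smooth_on S \<Phi>" "p \<in> S"
  shows "((\<lambda>t. \<Phi> (p + t *\<^sub>R d)) has_real_derivative frechet_derivative \<Phi> (at p) d) (at 0)"
proof -
  have "((\<lambda>t. p + t *\<^sub>R d) has_vector_derivative d) (at 0)"
    by (auto intro!: derivative_eq_intros)
  from has_real_derivative_compose_vector[OF this, of \<Phi>] smooth_on_has_derivative[OF assms]
  show ?thesis by simp
qed

section \<open>Translations, conjugation and inversion in a Lie group\<close>

locale smooth_group =
  fixes G :: "'a monoid" (structure) and M :: "('a, 'e::euclidean_space) manifold"
  assumes lie_group: "lie_group G M"
begin

lemma group: "group G" and manifold: "smooth_manifold M" and topspace: "topspace (mfd_top M) = carrier G"
  and smooth_mult: "smooth_map (prod_manifold M M) M (\<lambda>(x, y). x \<otimes> y)"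
  and smooth_inv: "smooth_map M M (\<lambda>x. inv x)"
  using lie_group unfolding lie_group_def by blast+

lemmas group_simps = group.is_monoid[OF group] monoid.m_closed[OF group.is_monoid[OF group]]
  monoid.one_closed[OF group.is_monoid[OF group]] group.inv_closed[OF group]
  monoid.l_one[OF group.is_monoid[OF group]] monoid.r_one[OF group.is_monoid[OF group]]
  group.l_inv[OF group] group.r_inv[OF group] monoid.m_assoc[OF group.is_monoid[OF group]]
  group.inv_mult_group[OF group] group.inv_inv[OF group] monoid.inv_one[OF group.is_monoid[OF group]]

lemma inv_cancel:
  assumes "x \<in> carrier G" "y \<in> carrier G"
  shows "inv x \<otimes> (x \<otimes> y) = y" "x \<otimes> (inv x \<otimes> y) = y"
  using assms by (simp_all add: group_simps flip: monoid.m_assoc[OF group.is_monoid[OF group]])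

lemma atlas: "injective_atlas M"
  using smooth_manifold_atlas[OF manifold] .

lemma openin_carrier: "openin (mfd_top M) (carrier G)"
  using openin_topspace[of "mfd_top M"] topspace by simp

lemma smooth_fun_on_carrier: "smooth_fun_on M W f \<Longrightarrow> x \<in> W \<Longrightarrow> x \<in> carrier G"
  using openin_subset[OF smooth_fun_on_openin, of M W f] topspace by auto

lemma smooth_into_mult:
  assumes "smooth_into M S h" "smooth_into M S h'" "open S"
  shows "smooth_into M S (\<lambda>t. h t \<otimes> h' t)"
  using smooth_map_compose_smooth_into[OF injective_atlas_prod[OF atlas atlas] smooth_mult atlas
      smooth_into_Pair[OF assms(1,2)] assms(3)] by simp

lemma smooth_into_inv: "smooth_into M S h \<Longrightarrow> open S \<Longrightarrow> smooth_into M S (\<lambda>t. inv (h t))"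
  by (rule smooth_map_compose_smooth_into[OF atlas smooth_inv atlas])

lemma smooth_into_element: "g \<in> carrier G \<Longrightarrow> smooth_into M S (\<lambda>_. g)"
  using smooth_into_const[of g M S] topspace by simp

lemma smooth_map_left: "g \<in> carrier G \<Longrightarrow> smooth_map M M (\<lambda>x. g \<otimes> x)"
  by (rule smooth_mapI[OF manifold], rule smooth_into_mult, rule smooth_into_element, assumption,
      erule smooth_into_chart_inverse[OF manifold], erule chart_image_open[OF manifold])

lemma smooth_map_right: "g \<in> carrier G \<Longrightarrow> smooth_map M M (\<lambda>x. x \<otimes> g)"
  by (rule smooth_mapI[OF manifold], rule smooth_into_mult,
      erule smooth_into_chart_inverse[OF manifold], erule smooth_into_element, erule chart_image_open[OF manifold])

lemma smooth_map_conj: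
  assumes "g \<in> carrier G"
  shows "smooth_map M M (\<lambda>x. g \<otimes> x \<otimes> inv g)"
proof (rule smooth_mapI[OF manifold])
  fix U \<phi> assume U: "(U, \<phi>) \<in> charts M"
  note o = chart_image_open[OF manifold U]
  have "inv g \<in> carrier G" using assms by (simp add: group_simps)
  then show "smooth_into M (\<phi> ` U) (\<lambda>t. g \<otimes> inv_into U \<phi> t \<otimes> inv g)"
    by (intro smooth_into_mult smooth_into_element smooth_into_chart_inverse[OF manifold U] o assms)
qed

lemma smooth_near_left:
  assumes "smooth_near M q f" "q \<in> carrier G"
  shows "smooth_near M \<one> (\<lambda>x. f (q \<otimes> x))"
  by (rule smooth_near_compose_smooth_map[OF manifold manifold smooth_map_left])
     (use assms topspace in \<open>simp_all add: group_simps\<close>)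

lemma smooth_near_right:
  assumes "smooth_near M q f" "q \<in> carrier G"
  shows "smooth_near M \<one> (\<lambda>x. f (x \<otimes> q))"
  by (rule smooth_near_compose_smooth_map[OF manifold manifold smooth_map_right])
     (use assms topspace in \<open>simp_all add: group_simps\<close>)

lemma smooth_near_conj:
  assumes "smooth_near M \<one> f" "g \<in> carrier G"
  shows "smooth_near M \<one> (\<lambda>x. f (g \<otimes> x \<otimes> inv g))"
  by (rule smooth_near_compose_smooth_map[OF manifold manifold smooth_map_conj])
     (use assms topspace in \<open>simp_all add: group_simps\<close>)

lemma smooth_near_inv:
  assumes "smooth_near M \<one> f"
  shows "smooth_near M \<one> (\<lambda>x. f (inv x))"
  by (rule smooth_near_compose_smooth_map[OF manifold manifold smooth_inv])
     (use assms topspace in \<open>simp_all add: group_simps\<close>)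

text \<open>The derivative along left translates depends smoothly on the base point and may
  therefore be differentiated again, as the bracket of left-invariant fields requires.\<close>

lemma smooth_fun_on_left_family:
  assumes f: "smooth_fun_on M W f" and v: "v \<in> tangent_space M \<one>"
  shows "smooth_fun_on M W (\<lambda>q. v (\<lambda>x. f (q \<otimes> x)))"
proof (rule smooth_fun_on_family_derivative[OF manifold manifold manifold f v])
  show "smooth_into M S (\<lambda>z. h z \<otimes> h' z)"
    if "open S" "smooth_into M S h" "smooth_into M S h'" for S :: "('e \<times> real) set" and h h'
    using smooth_into_mult that by blast
  show "openin (mfd_top M) W" using smooth_fun_on_openin[OF f] .
  fix q assume q: "q \<in> W"
  note qG = smooth_fun_on_carrier[OF f q]
  show "q \<otimes> \<one> \<in> W" using q qG by (simp add: group_simps)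
  show "smooth_near M \<one> (\<lambda>x. f (q \<otimes> x))"
    by (rule smooth_near_left[OF smooth_fun_on_imp_near[OF f q] qG])
qed

lemma smooth_fun_on_right_family:
  assumes f: "smooth_fun_on M W f" and v: "v \<in> tangent_space M \<one>"
  shows "smooth_fun_on M W (\<lambda>q. v (\<lambda>x. f (x \<otimes> q)))"
proof (rule smooth_fun_on_family_derivative[where F = "\<lambda>q x. x \<otimes> q", OF manifold manifold manifold f v])
  show "smooth_into M S (\<lambda>z. h' z \<otimes> h z)"
    if "open S" "smooth_into M S h" "smooth_into M S h'" for S :: "('e \<times> real) set" and h h'
    using smooth_into_mult that by blast
  show "openin (mfd_top M) W" using smooth_fun_on_openin[OF f] .
  fix q assume q: "q \<in> W"
  note qG = smooth_fun_on_carrier[OF f q]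
  show "\<one> \<otimes> q \<in> W" using q qG by (simp add: group_simps)
  show "smooth_near M \<one> (\<lambda>x. f (x \<otimes> q))"
    by (rule smooth_near_right[OF smooth_fun_on_imp_near[OF f q] qG])
qed

lemma smooth_fun_on_conj_family:
  assumes f: "smooth_near M \<one> f" and v: "v \<in> tangent_space M \<one>"
  shows "smooth_fun_on M (carrier G) (\<lambda>q. v (\<lambda>x. f (q \<otimes> x \<otimes> inv q)))"
proof -
  obtain W where W: "\<one> \<in> W" "smooth_fun_on M W f" using f unfolding smooth_near_def by blast
  show ?thesis
  proof (rule smooth_fun_on_family_derivative[where F = "\<lambda>q x. q \<otimes> x \<otimes> inv q", OF manifold manifold manifold W(2) v])
    show "smooth_into M S (\<lambda>z. h z \<otimes> h' z \<otimes> inv (h z))"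
      if "open S" "smooth_into M S h" "smooth_into M S h'" for S :: "('e \<times> real) set" and h h'
      using that by (intro smooth_into_mult smooth_into_inv)
    show "openin (mfd_top M) (carrier G)" by (rule openin_carrier)
    fix q assume q: "q \<in> carrier G"
    show "q \<otimes> \<one> \<otimes> inv q \<in> W" using q W by (simp add: group_simps)
    show "smooth_near M \<one> (\<lambda>x. f (q \<otimes> x \<otimes> inv q))"
      by (rule smooth_near_conj[OF f q])
  qed
qed

text \<open>Group laws hold on the carrier only. Since it is open, they may still be used to rewrite
  the argument of a tangent vector.\<close>

lemma tangent_vector_cong_carrier:
  "v \<in> tangent_space M p \<Longrightarrow> (\<And>x. x \<in> carrier G \<Longrightarrow> f x = g x) \<Longrightarrow> v f = v g"
  using tangent_vector_local[OF manifold _ openin_carrier, of v p f g] tangent_space_topspace[of v M p]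
  unfolding topspace by blast

text \<open>The function \<open>h (c s \<otimes> inv (c t))\<close> of two times is constant on the
  diagonal, so its derivative in direction \<open>(1, 1)\<close> vanishes; this derivative is the
  sum of the two partial ones, which are the two terms of the claim.\<close>

lemma tangent_vector_inv:
  assumes v: "v \<in> tangent_space M \<one>" and h: "smooth_near M \<one> h"
  shows "v (\<lambda>x. h (inv x)) = - v h"
proof -
  obtain c where c: "smooth_curve M c" "c 0 = \<one>"
    "\<And>f. smooth_near M \<one> f \<Longrightarrow> ((\<lambda>t. f (c t)) has_real_derivative v f) (at 0)"
    using tangent_vector_curve[OF manifold v] by blast
  obtain e where e: "e > 0" "smooth_into M {-e<..<e} c" using c(1) unfolding smooth_curve_iff by blast
  obtain W where W: "\<one> \<in> W" "smooth_fun_on M W h" using h unfolding smooth_near_def by blast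
  have cG: "c t \<in> carrier G" if "t \<in> {-e<..<e}" for t
    using smooth_into_topspace[OF e(2) that] topspace by simp
  let ?I = "{-e<..<e} \<times> {-e<..<e}"
  have I: "open ?I" by (simp add: open_Times)
  have c1: "smooth_into M ?I (\<lambda>z. c (fst z))" "smooth_into M ?I (\<lambda>z. c (snd z))"
    by (rule smooth_into_reparam[OF atlas e(2) _ I];
        force intro: smooth_on_linear bounded_linear_fst bounded_linear_snd)+
  let ?H = "\<lambda>z. c (fst z) \<otimes> inv (c (snd z))"
  have H: "smooth_into M ?I ?H" by (intro smooth_into_mult smooth_into_inv c1 I)
  let ?O = "{z\<in>?I. ?H z \<in> W}"
  have O: "open ?O" by (rule smooth_into_open_vimage[OF H I smooth_fun_on_openin[OF W(2)]])
  have s: "smooth_on ?O (\<lambda>z. h (?H z))" by (rule smooth_fun_on_compose_smooth_into[OF manifold W(2) H I])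
  have 0: "(0, 0) \<in> ?O" using e(1) c(2) W(1) by (simp add: group_simps)
  let ?D = "frechet_derivative (\<lambda>z. h (?H z)) (at (0, 0))"
  have ev: "\<forall>\<^sub>F t in nhds 0. t \<in> {-e<..<e}"
    by (rule eventually_nhds_in_open) (use e in auto)
  have d1: "((\<lambda>t. h (?H ((0, 0) + t *\<^sub>R d))) has_real_derivative ?D d) (at 0)" for d
    by (rule smooth_on_line_derivative[OF O s 0])
  have "((\<lambda>t. h (c t)) has_real_derivative ?D (1, 0)) (at 0)"
    by (rule iffD1[OF DERIV_cong_ev[OF refl _ refl] d1[of "(1, 0)"]])
       (use ev in \<open>eventually_elim, use cG c(2) in \<open>simp add: group_simps\<close>\<close>)
  then have "?D (1, 0) = v h" using DERIV_unique[OF _ c(3)[OF h]] by blast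
  moreover have "((\<lambda>t. h (inv (c t))) has_real_derivative ?D (0, 1)) (at 0)"
    by (rule iffD1[OF DERIV_cong_ev[OF refl _ refl] d1[of "(0, 1)"]])
       (use ev in \<open>eventually_elim, use cG c(2) in \<open>simp add: group_simps\<close>\<close>)
  then have "?D (0, 1) = v (\<lambda>x. h (inv x))" using DERIV_unique[OF _ c(3)[OF smooth_near_inv[OF h]]] by blast
  moreover have "((\<lambda>t. h \<one>) has_real_derivative ?D (1, 1)) (at 0)"
    by (rule iffD1[OF DERIV_cong_ev[OF refl _ refl] d1[of "(1, 1)"]])
       (use ev in \<open>eventually_elim, use cG in \<open>simp add: group_simps\<close>\<close>)
  then have "?D (1, 1) = 0" using DERIV_unique[OF _ DERIV_const] by blast
  moreover have "linear ?D"
    using smooth_on_has_derivative[OF O s 0] has_derivative_linear by blast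
  then have "?D ((1, 0) + (0, 1)) = ?D (1, 0) + ?D (0, 1)" by (rule linear_add)
  ultimately show ?thesis by simp
qed

end

section \<open>The Lie algebra and the adjoint action\<close>

locale lie_group_algebra = smooth_group G M
  for G :: "'a monoid" (structure) and M :: "('a, 'e::euclidean_space) manifold" +
  fixes br :: "'g::euclidean_space \<Rightarrow> 'g \<Rightarrow> 'g" and lam :: "'g \<Rightarrow> 'a tangent_vector"
  assumes algebra: "lie_algebra_of_group G M br lam"
begin

lemma lam_bij: "bij_betw lam UNIV (tangent_space M \<one>)"
  and lam_linear: "lam (a *\<^sub>R X + b *\<^sub>R Y) f = a * lam X f + b * lam Y f"
  and lam_bracket: "lam (br X Y) =
        lie_bracket M (left_invariant_field G M (lam X)) (left_invariant_field G M (lam Y)) \<one>"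
  using algebra unfolding lie_algebra_of_group_def by blast+

lemma lam_tangent: "lam X \<in> tangent_space M \<one>"
  using lam_bij bij_betwE by blast

lemma lam_add: "lam (X + Y) f = lam X f + lam Y f"
  using lam_linear[of 1 X 1 Y f] by simp

lemma lam_scale: "lam (a *\<^sub>R X) f = a * lam X f"
  using lam_linear[of a X 0 X f] by simp

lemma lam_eqI:
  assumes "\<And>f. smooth_near M \<one> f \<Longrightarrow> lam X f = lam Y f"
  shows "X = Y"
proof -
  have "lam X f = lam Y f" for f
    using assms tangent_vector_not_smooth[OF lam_tangent] by (cases "smooth_near M \<one> f") auto
  then have "lam X = lam Y" by blast
  then show ?thesis using lam_bij unfolding bij_betw_def inj_on_def by blast
qed

abbreviation "ad g \<equiv> Ad G M lam g"

text \<open>\<open>Ad\<close> is defined by inverting \<open>lam\<close>. This is meaningful because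
  conjugation fixes the identity, so the pushed-forward vector is tangent there and lies in the
  range of \<open>lam\<close>.\<close>

lemma Ad_apply:
  assumes g: "g \<in> carrier G" and f: "smooth_near M \<one> f"
  shows "lam (ad g X) f = lam X (\<lambda>x. f (g \<otimes> x \<otimes> inv g))"
proof -
  let ?D = "differential M M (\<lambda>x. g \<otimes> x \<otimes> inv g) \<one> (lam X)"
  have "g \<otimes> \<one> \<otimes> inv g = \<one>" using g by (simp add: group_simps)
  then have "?D \<in> tangent_space M \<one>" and D: "?D f = lam X (\<lambda>x. f (g \<otimes> x \<otimes> inv g))"
    using differential_in_tangent_space[OF manifold manifold smooth_map_conj[OF g] lam_tangent]
      differential_apply[of M "\<lambda>x. g \<otimes> x \<otimes> inv g" \<one> f] f by simp_all
  then have "lam (ad g X) = ?D"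
    unfolding Ad_def using lam_bij by (simp add: bij_betw_def f_inv_into_f)
  then show ?thesis using D by simp
qed

lemma Ad_mult:
  assumes "g \<in> carrier G" "h \<in> carrier G"
  shows "ad (g \<otimes> h) X = ad g (ad h X)"
proof (rule lam_eqI)
  fix f assume f: "smooth_near M \<one> f"
  have "lam (ad (g \<otimes> h) X) f = lam X (\<lambda>x. f (g \<otimes> h \<otimes> x \<otimes> inv (g \<otimes> h)))"
    by (rule Ad_apply[OF _ f]) (use assms in \<open>simp add: group_simps\<close>)
  also have "\<dots> = lam X (\<lambda>x. f (g \<otimes> (h \<otimes> x \<otimes> inv h) \<otimes> inv g))"
    by (rule tangent_vector_cong_carrier[OF lam_tangent]) (use assms in \<open>simp add: group_simps\<close>)
  also have "\<dots> = lam (ad g (ad h X)) f"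
    using Ad_apply[OF assms(1) f] Ad_apply[OF assms(2) smooth_near_conj[OF f assms(1)]] by simp
  finally show "lam (ad (g \<otimes> h) X) f = lam (ad g (ad h X)) f" .
qed

lemma Ad_one: "ad \<one> X = X"
proof (rule lam_eqI)
  fix f assume f: "smooth_near M \<one> f"
  have "lam (ad \<one> X) f = lam X (\<lambda>x. f (\<one> \<otimes> x \<otimes> inv \<one>))"
    by (rule Ad_apply[OF _ f]) (simp add: group_simps)
  also have "\<dots> = lam X f"
    by (rule tangent_vector_cong_carrier[OF lam_tangent]) (simp add: group_simps)
  finally show "lam (ad \<one> X) f = lam X f" .
qed

lemma Ad_surj:
  assumes "g \<in> carrier G"
  shows "ad g (ad (inv g) X) = X"
  using Ad_mult[of g "inv g" X] Ad_one assms by (simp add: group_simps)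

lemma Ad_linear:
  assumes "g \<in> carrier G"
  shows "linear (ad g)"
proof (rule linearI)
  show "ad g (X + Y) = ad g X + ad g Y" for X Y
    by (rule lam_eqI) (simp add: Ad_apply[OF assms] lam_add)
  show "ad g (r *\<^sub>R X) = r *\<^sub>R ad g X" for r X
    by (rule lam_eqI) (simp add: Ad_apply[OF assms] lam_scale)
qed

text \<open>At the identity a left-invariant field is the tangent vector itself, and at nearby
  points it differentiates along left translates. The abstract bracket thus becomes a difference of
  iterated derivatives.\<close>

lemma lam_br:
  assumes f: "smooth_near M \<one> f"
  shows "lam (br X Y) f = lam X (\<lambda>q. lam Y (\<lambda>x. f (q \<otimes> x))) - lam Y (\<lambda>q. lam X (\<lambda>x. f (q \<otimes> x)))"
proof -
  obtain W where W: "\<one> \<in> W" "smooth_fun_on M W f" using f unfolding smooth_near_def by blast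
  have 1: "lam X (\<lambda>q. left_invariant_field G M (lam Y) q f) = lam X (\<lambda>q. lam Y (\<lambda>x. f (q \<otimes> x)))" for X Y
  proof (rule tangent_vector_local[OF manifold lam_tangent smooth_fun_on_openin[OF W(2)] W(1)])
    fix q assume q: "q \<in> W"
    then have "q \<otimes> \<one> = q" using smooth_fun_on_carrier[OF W(2)] by (simp add: group_simps)
    then show "left_invariant_field G M (lam Y) q f = lam Y (\<lambda>x. f (q \<otimes> x))"
      unfolding left_invariant_field_def
      using differential_apply[of M "\<lambda>x. q \<otimes> x" \<one> f] smooth_fun_on_imp_near[OF W(2) q] by simp
  qed
  have 2: "left_invariant_field G M (lam X) \<one> h = lam X h" for X h
  proof -
    have "lam X (\<lambda>x. h (\<one> \<otimes> x)) = lam X h"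
      by (rule tangent_vector_cong_carrier[OF lam_tangent]) (simp add: group_simps)
    then show ?thesis
      using tangent_vector_not_smooth[OF lam_tangent, of h X]
      unfolding left_invariant_field_def differential_def comp_def by (simp add: group_simps)
  qed
  show ?thesis unfolding lam_bracket lie_bracket_def 1 2 using f by simp
qed

text \<open>Conjugation is a homomorphism, so it carries left translation by \<open>q\<close> to
  left translation by the conjugate of \<open>q\<close>. Both iterated derivatives in
  \<open>lam_br\<close> are therefore transported unchanged.\<close>

lemma Ad_br:
  assumes g: "g \<in> carrier G"
  shows "ad g (br X Y) = br (ad g X) (ad g Y)"
proof (rule lam_eqI)
  fix f assume f: "smooth_near M \<one> f"
  let ?C = "\<lambda>x. g \<otimes> x \<otimes> inv g"
  obtain W where W: "\<one> \<in> W" "smooth_fun_on M W f" using f unfolding smooth_near_def by blast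
  have fC: "smooth_near M \<one> (\<lambda>x. f (?C x))" by (rule smooth_near_conj[OF f g])
  let ?W = "{x \<in> topspace (mfd_top M). ?C x \<in> W}"
  have Wo: "openin (mfd_top M) ?W"
    by (rule openin_continuous_map_preimage[OF smooth_map_continuous[OF smooth_map_conj[OF g]]
          smooth_fun_on_openin[OF W(2)]])
  have W1: "\<one> \<in> ?W" using W(1) g topspace by (simp add: group_simps)
  have 1: "lam (ad g X) (\<lambda>q. lam (ad g Y) (\<lambda>x. f (q \<otimes> x))) = lam X (\<lambda>q. lam Y (\<lambda>x. f (?C (q \<otimes> x))))" for X Y
  proof -
    have "lam (ad g X) (\<lambda>q. lam (ad g Y) (\<lambda>x. f (q \<otimes> x))) = lam X (\<lambda>q. lam (ad g Y) (\<lambda>x. f (?C q \<otimes> x)))"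
      by (rule Ad_apply[OF g smooth_fun_on_imp_near[OF smooth_fun_on_left_family[OF W(2) lam_tangent] W(1)]])
    also have "\<dots> = lam X (\<lambda>q. lam Y (\<lambda>x. f (?C (q \<otimes> x))))"
    proof (rule tangent_vector_local[OF manifold lam_tangent Wo W1])
      fix q assume q: "q \<in> ?W"
      then have qG: "q \<in> carrier G" "?C q \<in> carrier G" "?C q \<in> W" using topspace g by (auto simp: group_simps)
      have "lam (ad g Y) (\<lambda>x. f (?C q \<otimes> x)) = lam Y (\<lambda>x. f (?C q \<otimes> ?C x))"
        by (rule Ad_apply[OF g smooth_near_left[OF smooth_fun_on_imp_near[OF W(2) qG(3)] qG(2)]])
      also have "\<dots> = lam Y (\<lambda>x. f (?C (q \<otimes> x)))"
        by (rule tangent_vector_cong_carrier[OF lam_tangent])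
           (use g qG in \<open>simp add: group_simps inv_cancel\<close>)
      finally show "lam (ad g Y) (\<lambda>x. f (?C q \<otimes> x)) = lam Y (\<lambda>x. f (?C (q \<otimes> x)))" .
    qed
    finally show ?thesis .
  qed
  have "lam (ad g (br X Y)) f = lam (br X Y) (\<lambda>x. f (?C x))" by (rule Ad_apply[OF g f])
  also have "\<dots> = lam (br (ad g X) (ad g Y)) f"
    unfolding lam_br[OF fC] lam_br[OF f] 1 ..
  finally show "lam (ad g (br X Y)) f = lam (br (ad g X) (ad g Y)) f" .
qed

text \<open>With curves \<open>z\<close>, \<open>y\<close> through \<open>\<one>\<close> in the directions \<open>Z\<close>, \<open>Y\<close>, both sides are mixed partial
  derivatives at \<open>0\<close> of \<open>f (z t \<otimes> y s \<otimes> inv (z u))\<close>.\<close>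

lemma lam_Ad_derivative:
  assumes f: "smooth_near M \<one> f"
  shows "lam Z (\<lambda>g. lam Y (\<lambda>x. f (g \<otimes> x \<otimes> inv g))) = lam (br Z Y) f"
proof -
  obtain W where W: "\<one> \<in> W" "smooth_fun_on M W f" using f unfolding smooth_near_def by blast
  have Wo: "openin (mfd_top M) W" using smooth_fun_on_openin[OF W(2)] .
  obtain z where z: "smooth_curve M z" "z 0 = \<one>"
    "\<And>f. smooth_near M \<one> f \<Longrightarrow> ((\<lambda>t. f (z t)) has_real_derivative lam Z f) (at 0)"
    using tangent_vector_curve[OF manifold lam_tangent] by blast
  obtain y where y: "smooth_curve M y" "y 0 = \<one>"
    "\<And>f. smooth_near M \<one> f \<Longrightarrow> ((\<lambda>t. f (y t)) has_real_derivative lam Y f) (at 0)"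
    using tangent_vector_curve[OF manifold lam_tangent] by blast
  obtain ez where ez: "ez > 0" "smooth_into M {-ez<..<ez} z" using z(1) unfolding smooth_curve_iff by blast
  obtain ey where ey: "ey > 0" "smooth_into M {-ey<..<ey} y" using y(1) unfolding smooth_curve_iff by blast
  have zG: "z t \<in> carrier G" if "t \<in> {-ez<..<ez}" for t
    using smooth_into_topspace[OF ez(2) that] topspace by simp
  have yG: "y t \<in> carrier G" if "t \<in> {-ey<..<ey}" for t
    using smooth_into_topspace[OF ey(2) that] topspace by simp
  have evz: "\<forall>\<^sub>F t in nhds 0. t \<in> {-ez<..<ez}" and evy: "\<forall>\<^sub>F t in nhds 0. t \<in> {-ey<..<ey}"
    by (rule eventually_nhds_in_open; use ez ey in force)+
  let ?I = "{-ez<..<ez} \<times> {-ez<..<ez} \<times> {-ey<..<ey}"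
  have I: "open ?I" by (simp add: open_Times)
  have h: "smooth_into M ?I (\<lambda>p. z (fst p))" "smooth_into M ?I (\<lambda>p. z (fst (snd p)))"
    "smooth_into M ?I (\<lambda>p. y (snd (snd p)))"
    by (rule smooth_into_reparam[OF atlas ez(2) _ I] smooth_into_reparam[OF atlas ey(2) _ I];
        force intro!: smooth_on_linear bounded_linear_fst bounded_linear_snd
          bounded_linear_compose[OF bounded_linear_fst bounded_linear_snd]
          bounded_linear_compose[OF bounded_linear_snd bounded_linear_snd])+
  let ?H = "\<lambda>p. z (fst p) \<otimes> y (snd (snd p)) \<otimes> inv (z (fst (snd p)))"
  have H: "smooth_into M ?I ?H" by (intro smooth_into_mult smooth_into_inv h I)
  let ?O = "{p\<in>?I. ?H p \<in> W}"
  let ?P = "\<lambda>p. f (?H p)"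
  have O: "open ?O" by (rule smooth_into_open_vimage[OF H I Wo])
  have s: "smooth_on ?O ?P" by (rule smooth_fun_on_compose_smooth_into[OF manifold W(2) H I])
  have 0: "(0, 0, 0) \<in> ?O" using ez(1) ey(1) z(2) y(2) W(1) by (simp add: group_simps)
  define D where "D = (\<lambda>d p. frechet_derivative ?P (at p) d)"
  have sD: "smooth_on ?O (D d)" for d unfolding D_def by (rule smooth_on_frechet_derivative[OF O s])
  have lineP: "((\<lambda>t. ?P (p + t *\<^sub>R d)) has_real_derivative D d p) (at 0)" if "p \<in> ?O" for p d
    unfolding D_def by (rule smooth_on_line_derivative[OF O s that])
  define DD where "DD = (\<lambda>d' d. frechet_derivative (D d) (at (0, 0, 0)) d')"
  have lineD: "((\<lambda>t. D d ((0, 0, 0) + t *\<^sub>R d')) has_real_derivative DD d' d) (at 0)" for d d'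
    unfolding DD_def by (rule smooth_on_line_derivative[OF O sD 0])
  have sym: "DD d d' = DD d' d" for d d'
    unfolding DD_def D_def by (rule frechet_derivative_symmetric[OF O s 0])
  have evW: "\<forall>\<^sub>F t in nhds 0. z t \<in> W" "\<forall>\<^sub>F t in nhds 0. y t \<in> W"
    using smooth_curve_eventually[OF z(1) Wo] smooth_curve_eventually[OF y(1) Wo] z(2) y(2) W(1) by auto
  have A: "lam Z (\<lambda>g. lam Y (\<lambda>x. f (g \<otimes> x \<otimes> inv g))) = DD (1, 1, 0) (0, 0, 1)"
  proof (rule DERIV_unique)
    show "((\<lambda>t. lam Y (\<lambda>x. f (z t \<otimes> x \<otimes> inv (z t)))) has_real_derivative
        lam Z (\<lambda>g. lam Y (\<lambda>x. f (g \<otimes> x \<otimes> inv g)))) (at 0)"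
      by (rule z(3)) (rule smooth_fun_on_imp_near[OF smooth_fun_on_conj_family[OF f lam_tangent]],
          simp add: group_simps)
    have "\<forall>\<^sub>F t in nhds 0. D (0, 0, 1) ((0, 0, 0) + t *\<^sub>R (1, 1, 0)) = lam Y (\<lambda>x. f (z t \<otimes> x \<otimes> inv (z t)))"
      using evz
    proof eventually_elim
      case (elim t)
      have tO: "(t, t, 0) \<in> ?O" using elim zG[OF elim] ey(1) y(2) W(1) by (simp add: group_simps)
      have "((\<lambda>s. f (z t \<otimes> y s \<otimes> inv (z t))) has_real_derivative D (0, 0, 1) (t, t, 0)) (at 0)"
        using lineP[OF tO, of "(0, 0, 1)"] by simp
      then show ?case
        using DERIV_unique[OF _ y(3)[OF smooth_near_conj[OF f zG[OF elim]]]] by simp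
    qed
    then show "((\<lambda>t. lam Y (\<lambda>x. f (z t \<otimes> x \<otimes> inv (z t)))) has_real_derivative DD (1, 1, 0) (0, 0, 1)) (at 0)"
      by (rule iffD1[OF DERIV_cong_ev[OF refl _ refl] lineD])
  qed
  have B: "lam Z (\<lambda>q. lam Y (\<lambda>x. f (q \<otimes> x))) = DD (1, 0, 0) (0, 0, 1)"
  proof (rule DERIV_unique)
    show "((\<lambda>t. lam Y (\<lambda>x. f (z t \<otimes> x))) has_real_derivative lam Z (\<lambda>q. lam Y (\<lambda>x. f (q \<otimes> x)))) (at 0)"
      by (rule z(3)) (rule smooth_fun_on_imp_near[OF smooth_fun_on_left_family[OF W(2) lam_tangent] W(1)])
    have "\<forall>\<^sub>F t in nhds 0. D (0, 0, 1) ((0, 0, 0) + t *\<^sub>R (1, 0, 0)) = lam Y (\<lambda>x. f (z t \<otimes> x))"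
      using evz evW(1)
    proof eventually_elim
      case (elim t)
      note zt = zG[OF elim(1)]
      have tO: "(t, 0, 0) \<in> ?O" using elim zt ez(1) ey(1) y(2) z(2) W(1) by (simp add: group_simps)
      have "\<forall>\<^sub>F s in nhds 0. ?P ((t, 0, 0) + s *\<^sub>R (0, 0, 1)) = f (z t \<otimes> y s)"
        using evy by eventually_elim (use yG zt z(2) in \<open>simp add: group_simps\<close>)
      then have "((\<lambda>s. f (z t \<otimes> y s)) has_real_derivative D (0, 0, 1) (t, 0, 0)) (at 0)"
        by (rule iffD1[OF DERIV_cong_ev[OF refl _ refl] lineP[OF tO]])
      then show ?case
        using DERIV_unique[OF _ y(3)[OF smooth_near_left[OF smooth_fun_on_imp_near[OF W(2) elim(2)] zt]]] by simp
    qed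
    then show "((\<lambda>t. lam Y (\<lambda>x. f (z t \<otimes> x))) has_real_derivative DD (1, 0, 0) (0, 0, 1)) (at 0)"
      by (rule iffD1[OF DERIV_cong_ev[OF refl _ refl] lineD])
  qed
  \<comment> \<open>The inverse on the second \<open>z\<close> factor causes the minus sign. The
    parameter of \<open>z\<close> is differentiated first here and that of \<open>y\<close> second,
    opposite to \<open>A\<close> and \<open>B\<close>.\<close>
  have C: "lam Y (\<lambda>q. lam Z (\<lambda>x. f (q \<otimes> x))) = - DD (0, 0, 1) (0, 1, 0)"
  proof (rule DERIV_unique)
    show "((\<lambda>t. lam Z (\<lambda>x. f (y t \<otimes> x))) has_real_derivative lam Y (\<lambda>q. lam Z (\<lambda>x. f (q \<otimes> x)))) (at 0)"
      by (rule y(3)) (rule smooth_fun_on_imp_near[OF smooth_fun_on_left_family[OF W(2) lam_tangent] W(1)])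
    have "\<forall>\<^sub>F t in nhds 0. - D (0, 1, 0) ((0, 0, 0) + t *\<^sub>R (0, 0, 1)) = lam Z (\<lambda>x. f (y t \<otimes> x))"
      using evy evW(2)
    proof eventually_elim
      case (elim t)
      note yt = yG[OF elim(1)]
      note n = smooth_near_left[OF smooth_fun_on_imp_near[OF W(2) elim(2)] yt]
      have tO: "(0, 0, t) \<in> ?O" using elim yt ez(1) ey(1) y(2) z(2) W(1) by (simp add: group_simps)
      have "\<forall>\<^sub>F s in nhds 0. ?P ((0, 0, t) + s *\<^sub>R (0, 1, 0)) = f (y t \<otimes> inv (z s))"
        using evz by eventually_elim (use zG yt z(2) in \<open>simp add: group_simps\<close>)
      then have "((\<lambda>s. f (y t \<otimes> inv (z s))) has_real_derivative D (0, 1, 0) (0, 0, t)) (at 0)"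
        by (rule iffD1[OF DERIV_cong_ev[OF refl _ refl] lineP[OF tO]])
      then have "D (0, 1, 0) (0, 0, t) = lam Z (\<lambda>x. f (y t \<otimes> inv x))"
        using DERIV_unique[OF _ z(3)[OF smooth_near_inv[OF n]]] by simp
      then show ?case using tangent_vector_inv[OF lam_tangent n] by simp
    qed
    then show "((\<lambda>t. lam Z (\<lambda>x. f (y t \<otimes> x))) has_real_derivative - DD (0, 0, 1) (0, 1, 0)) (at 0)"
      by (rule iffD1[OF DERIV_cong_ev[OF refl _ refl] DERIV_minus[OF lineD]])
  qed
  \<comment> \<open>The diagonal direction \<open>(1, 1, 0)\<close> of conjugation splits into its
    two unit directions. The first gives the left-translation term \<open>B\<close>; the second,
    after the order of differentiation is exchanged, gives minus the term \<open>C\<close>.\<close>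
  have "linear (frechet_derivative (D (0, 0, 1)) (at (0, 0, 0)))"
    using smooth_on_has_derivative[OF O sD 0] has_derivative_linear by blast
  then have "DD ((1, 0, 0) + (0, 1, 0)) (0, 0, 1) = DD (1, 0, 0) (0, 0, 1) + DD (0, 1, 0) (0, 0, 1)"
    unfolding DD_def by (rule linear_add)
  then show ?thesis
    unfolding lam_br[OF f] A B C using sym[of "(0, 0, 1)" "(0, 1, 0)"] by simp
qed

text \<open>Finitely many functions near the identity recover a Lie algebra element linearly: the
  vector of their derivatives depends injectively on \<open>Y\<close>, and the \<open>c b\<close>
  are the basis values of a linear left inverse.\<close>

lemma lam_coordinates:
  obtains U F and c :: "'e \<Rightarrow> 'g" where "\<one> \<in> U" "\<And>b. smooth_fun_on M U (F b)"
    "\<And>Y. Y = (\<Sum>b\<in>Basis. lam Y (F b) *\<^sub>R c b)"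
proof -
  obtain U \<phi> where U: "(U, \<phi>) \<in> charts M" "\<one> \<in> U"
    using chart_at_point[OF atlas tangent_space_topspace[OF lam_tangent]] by blast
  let ?F = "\<lambda>b x. \<phi> x \<bullet> b"
  let ?l = "\<lambda>Y. \<Sum>b\<in>Basis. lam Y (?F b) *\<^sub>R b"
  have lin: "linear ?l"
    by (rule linearI) (simp_all add: lam_add lam_scale scaleR_add_left sum.distrib scaleR_sum_right)
  have "inj ?l"
  proof (rule injI)
    fix X Y assume eq: "?l X = ?l Y"
    have l0: "lam Z (?F b) = ?l Z \<bullet> b" if "b \<in> Basis" for Z b
      using that by simp
    have "lam X (?F b) = lam Y (?F b)" if b: "b \<in> Basis" for b
    proof -
      have "lam X (?F b) = ?l X \<bullet> b" by (rule l0[OF b])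
      also have "\<dots> = ?l Y \<bullet> b" by (simp only: eq)
      also have "\<dots> = lam Y (?F b)" by (rule l0[OF b, symmetric])
      finally show ?thesis .
    qed
    then have "lam X = lam Y"
      by (rule tangent_vector_eqI[OF manifold U lam_tangent lam_tangent])
    then show "X = Y" by (intro lam_eqI) simp
  qed
  then obtain l where l: "linear l" "l \<circ> ?l = id"
    using linear_injective_left_inverse[OF lin] by blast
  have "Y = (\<Sum>b\<in>Basis. lam Y (?F b) *\<^sub>R l b)" for Y
  proof -
    have "Y = l (?l Y)" using fun_cong[OF l(2), of Y] by simp
    also have "\<dots> = (\<Sum>b\<in>Basis. lam Y (?F b) *\<^sub>R l b)"
      by (simp add: linear_sum[OF l(1)] linear_cmul[OF l(1)])
    finally show ?thesis .
  qed
  then show thesis using that[OF U(2), of ?F l] smooth_fun_on_coordinate[OF manifold U(1)] by blast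
qed

text \<open>\<open>lam_coordinates\<close> replaces the vector \<open>ad g Y\<close> by the numbers
  \<open>lam (ad g Y) (F b)\<close>. They are derivatives along conjugates, so the smooth family
  rule and \<open>lam_Ad_derivative\<close> apply to each of them.\<close>

lemma Ad_smooth: "smooth_fun_on M (carrier G) (\<lambda>g. ad g Y \<bullet> w)"
  and Ad_derivative: "lam Z (\<lambda>g. ad g Y \<bullet> w) = br Z Y \<bullet> w"
proof -
  obtain U F and c :: "'e \<Rightarrow> 'g" where c: "\<one> \<in> U" "\<And>b. smooth_fun_on M U (F b)"
    "\<And>Y. Y = (\<Sum>b\<in>Basis. lam Y (F b) *\<^sub>R c b)" using lam_coordinates by blast
  note n = smooth_fun_on_imp_near[OF c(2,1)]
  let ?h = "\<lambda>b g. lam Y (\<lambda>x. F b (g \<otimes> x \<otimes> inv g))"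
  have hs: "smooth_fun_on M (carrier G) (?h b)" for b
    by (rule smooth_fun_on_conj_family[OF n lam_tangent])
  have cs: "smooth_fun_on M (carrier G) (\<lambda>g. (c b \<bullet> w) * ?h b g)" for b
    by (intro smooth_fun_on_mult hs smooth_fun_on_const openin_carrier)
  have eq: "ad g Y \<bullet> w = (\<Sum>b\<in>Basis. (c b \<bullet> w) * ?h b g)" if "g \<in> carrier G" for g
  proof -
    have "ad g Y \<bullet> w = (\<Sum>b\<in>Basis. lam (ad g Y) (F b) *\<^sub>R c b) \<bullet> w" using c(3) by simp
    then show ?thesis by (simp add: inner_sum_left Ad_apply[OF that n] mult.commute)
  qed
  show "smooth_fun_on M (carrier G) (\<lambda>g. ad g Y \<bullet> w)"
    by (rule smooth_fun_on_cong[OF manifold smooth_fun_on_sum[OF openin_carrier cs]]) (use eq in simp)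
  have one: "\<one> \<in> carrier G" by (simp add: group_simps)
  have "lam Z (\<lambda>g. ad g Y \<bullet> w) = lam Z (\<lambda>g. \<Sum>b\<in>Basis. (c b \<bullet> w) * ?h b g)"
    by (rule tangent_vector_cong_carrier[OF lam_tangent]) (rule eq)
  also have "\<dots> = (\<Sum>b\<in>Basis. lam Z (\<lambda>g. (c b \<bullet> w) * ?h b g))"
    by (rule tangent_vector_sum[OF manifold lam_tangent smooth_fun_on_imp_near[OF cs one]])
  also have "\<dots> = (\<Sum>b\<in>Basis. (c b \<bullet> w) * lam (br Z Y) (F b))"
    by (simp add: tangent_vector_scale[OF manifold lam_tangent smooth_fun_on_imp_near[OF hs one]]
        lam_Ad_derivative[OF n])
  also have "\<dots> = (\<Sum>b\<in>Basis. lam (br Z Y) (F b) *\<^sub>R c b) \<bullet> w"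
    by (simp add: inner_sum_left mult.commute)
  also have "\<dots> = br Z Y \<bullet> w" using c(3) by simp
  finally show "lam Z (\<lambda>g. ad g Y \<bullet> w) = br Z Y \<bullet> w" .
qed

end

section \<open>Connected Lie subgroups and right-invariant fields\<close>

locale lie_subgroup = lie_group_algebra G M br lam
  for G :: "'a monoid" (structure) and M :: "('a, 'e::euclidean_space) manifold"
    and br :: "'g::euclidean_space \<Rightarrow> 'g \<Rightarrow> 'g" and lam :: "'g \<Rightarrow> 'a tangent_vector" +
  fixes \<hh> :: "'g set" and K :: "'a set" and MK :: "('a, 'f::euclidean_space) manifold"
  assumes connected_subgroup: "connected_lie_subgroup G M lam \<hh> K MK"
    and subspace_algebra: "subspace \<hh>"
begin

lemma subgroup: "subgroup K G" and lie_group_K: "lie_group (G\<lparr>carrier := K\<rparr>) MK"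
  and incl: "smooth_map MK M (\<lambda>x. x)"
  and incl_inj: "p \<in> K \<Longrightarrow> inj_on (differential MK M (\<lambda>x. x) p) (tangent_space MK p)"
  and incl_range: "differential MK M (\<lambda>x. x) \<one> ` tangent_space MK \<one> = lam ` \<hh>"
  using connected_subgroup unfolding connected_lie_subgroup_def by blast+

sublocale K: smooth_group "G\<lparr>carrier := K\<rparr>" MK
  using lie_group_K by unfold_locales

lemma manifold_K: "smooth_manifold MK" and topspace_K: "topspace (mfd_top MK) = K"
  using K.manifold K.topspace by simp_all

lemma K_carrier: "x \<in> K \<Longrightarrow> x \<in> carrier G"
  using subgroup.mem_carrier[OF subgroup] .

lemma K_closed: "\<one> \<in> K" "x \<in> K \<Longrightarrow> y \<in> K \<Longrightarrow> x \<otimes> y \<in> K" "x \<in> K \<Longrightarrow> inv x \<in> K"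
  using subgroup.one_closed[OF subgroup] subgroup.m_closed[OF subgroup] subgroup.m_inv_closed[OF subgroup] by blast+

lemma smooth_restrict:
  assumes "smooth_fun_on M (carrier G) f"
  shows "smooth_fun_on MK K f"
proof -
  have "{x \<in> topspace (mfd_top MK). x \<in> carrier G} = K" using topspace_K K_carrier by auto
  then show ?thesis using smooth_fun_on_compose_smooth_map[OF manifold_K manifold incl assms] by simp
qed

abbreviation "sv Y \<equiv> subgroup_vector G M lam MK Y"

lemma sv_tangent:
  assumes "Y \<in> \<hh>"
  shows "sv Y \<in> tangent_space MK \<one>"
    and differential_sv: "differential MK M (\<lambda>x. x) \<one> (sv Y) = lam Y"
proof -
  have "lam Y \<in> differential MK M (\<lambda>x. x) \<one> ` tangent_space MK \<one>" using assms incl_range by blast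
  then show "sv Y \<in> tangent_space MK \<one>" "differential MK M (\<lambda>x. x) \<one> (sv Y) = lam Y"
    unfolding subgroup_vector_def by (rule inv_into_into, rule f_inv_into_f)
qed

lemma sv_apply: "Y \<in> \<hh> \<Longrightarrow> smooth_near M \<one> f \<Longrightarrow> sv Y f = lam Y f"
  using differential_apply[of M "\<lambda>x. x" \<one> f MK "sv Y"] differential_sv[of Y] by simp

lemma tangent_one_eqI:
  assumes "v \<in> tangent_space MK \<one>" "w \<in> tangent_space MK \<one>"
    and "differential MK M (\<lambda>x. x) \<one> v = differential MK M (\<lambda>x. x) \<one> w"
  shows "v = w"
  using inj_onD[OF incl_inj[OF K_closed(1)] assms(3,1,2)] .

lemma tangent_one_sv:
  assumes "v \<in> tangent_space MK \<one>"
  obtains Z where "Z \<in> \<hh>" "v = sv Z"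
proof -
  obtain Z where Z: "Z \<in> \<hh>" "differential MK M (\<lambda>x. x) \<one> v = lam Z"
    using incl_range assms by blast
  then have "v = sv Z" using tangent_one_eqI[OF assms sv_tangent(1)] differential_sv by simp
  then show thesis using that Z by blast
qed

text \<open>\<open>sv\<close> inverts the differential of the inclusion at the identity, so the
  identity is verified after applying this injective differential.\<close>

lemma sv_linear:
  assumes "Y \<in> \<hh>" "Z \<in> \<hh>"
  shows "sv (a *\<^sub>R Y + b *\<^sub>R Z) f = a * sv Y f + b * sv Z f"
proof -
  have h: "a *\<^sub>R Y + b *\<^sub>R Z \<in> \<hh>"
    using assms subspace_algebra by (simp add: subspace_add subspace_scale)
  have "differential MK M (\<lambda>x. x) \<one> (\<lambda>f. a * sv Y f + b * sv Z f) g = lam (a *\<^sub>R Y + b *\<^sub>R Z) g" for g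
    using fun_cong[OF differential_sv[OF assms(1)], of g] fun_cong[OF differential_sv[OF assms(2)], of g]
    by (simp add: differential_def lam_linear split: if_splits)
  then have d: "differential MK M (\<lambda>x. x) \<one> (\<lambda>f. a * sv Y f + b * sv Z f) = lam (a *\<^sub>R Y + b *\<^sub>R Z)"
    by (rule ext)
  have "sv (a *\<^sub>R Y + b *\<^sub>R Z) = (\<lambda>f. a * sv Y f + b * sv Z f)"
    by (rule tangent_one_eqI[OF sv_tangent(1)[OF h] tangent_space_linear_combination[OF manifold_K
          sv_tangent(1)[OF assms(1)] sv_tangent(1)[OF assms(2)]]])
       (simp only: d differential_sv[OF h])
  then show ?thesis by simp
qed

lemma sv_sum:
  assumes "finite I" "\<And>i. i \<in> I \<Longrightarrow> Y i \<in> \<hh>"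
  shows "sv (\<Sum>i\<in>I. a i *\<^sub>R Y i) f = (\<Sum>i\<in>I. a i * sv (Y i) f)"
  using assms
proof (induction I rule: finite_induct)
  case empty
  have "sv (0 *\<^sub>R 0 + 0 *\<^sub>R 0) f = 0 * sv 0 f + 0 * sv 0 f"
    by (rule sv_linear) (use subspace_algebra subspace_0 in blast)+
  then show ?case by simp
next
  case (insert i I)
  then have "(\<Sum>i\<in>I. a i *\<^sub>R Y i) \<in> \<hh>"
    using subspace_algebra by (intro subspace_sum subspace_scale) auto
  then show ?case using sv_linear[of "Y i" "\<Sum>i\<in>I. a i *\<^sub>R Y i" "a i" 1 f] insert by simp
qed

text \<open>The right-invariant field of \<open>Z\<close>. A Toda field has at \<open>k\<close> the
  value of the right-invariant field of \<open>proj (ad k X)\<close>, an element that varies with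
  \<open>k\<close>.\<close>

definition right_field :: "'g \<Rightarrow> 'a vector_field" where
  "right_field Z k = differential MK MK (\<lambda>x. x \<otimes> k) \<one> (sv Z)"

lemma right_field_tangent:
  assumes "Z \<in> \<hh>" "k \<in> K"
  shows "right_field Z k \<in> tangent_space MK k"
  using differential_in_tangent_space[OF manifold_K manifold_K K.smooth_map_right[of k] sv_tangent(1)[OF assms(1)]]
    assms K_carrier unfolding right_field_def by (simp add: group_simps)

lemma right_field_apply:
  assumes "k \<in> K" "smooth_near MK k f"
  shows "right_field Z k f = sv Z (\<lambda>x. f (x \<otimes> k))"
  using differential_apply[of MK "\<lambda>x. x \<otimes> k" \<one> f MK "sv Z"] assms K_carrier
  unfolding right_field_def by (simp add: group_simps)

lemma right_field_linear:
  assumes "Y \<in> \<hh>" "Z \<in> \<hh>"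
  shows "right_field (a *\<^sub>R Y + b *\<^sub>R Z) k f = a * right_field Y k f + b * right_field Z k f"
  using sv_linear[OF assms] unfolding right_field_def differential_def by simp

lemma right_field_smooth:
  assumes "Z \<in> \<hh>" "smooth_fun_on MK V f"
  shows "smooth_fun_on MK V (\<lambda>k. right_field Z k f)"
proof -
  have "smooth_fun_on MK V (\<lambda>q. sv Z (\<lambda>x. f (x \<otimes> q)))"
    using K.smooth_fun_on_right_family[OF assms(2), of "sv Z"] sv_tangent(1)[OF assms(1)] by simp
  then show ?thesis
    by (rule smooth_fun_on_cong[OF manifold_K])
       (use right_field_apply smooth_fun_on_imp_near[OF assms(2)] K.smooth_fun_on_carrier[OF assms(2)] in simp)
qed

text \<open>Right translation by \<open>inv k\<close> moves \<open>v\<close> to the identity, where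
  tangent vectors of \<open>K\<close> are the vectors \<open>sv Z\<close>; translating back recovers
  \<open>v\<close>.\<close>

lemma tangent_vector_right_field:
  assumes v: "v \<in> tangent_space MK k"
  obtains Z where "Z \<in> \<hh>" "v = right_field Z k"
proof -
  have k: "k \<in> K" using tangent_space_topspace[OF v] topspace_K by simp
  have ik: "inv k \<in> K" using K_closed k by blast
  let ?w = "differential MK MK (\<lambda>x. x \<otimes> inv k) k v"
  have kk: "k \<otimes> inv k = \<one>" using K_carrier[OF k] by (simp add: group_simps)
  have w: "?w \<in> tangent_space MK \<one>"
    using differential_in_tangent_space[OF manifold_K manifold_K K.smooth_map_right[of "inv k"] v] ik kk by simp
  obtain Z where Z: "Z \<in> \<hh>" "?w = sv Z" using tangent_one_sv[OF w] by blast
  have "v f = right_field Z k f" for f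
  proof (cases "smooth_near MK k f")
    case True
    have n: "smooth_near MK \<one> (\<lambda>x. f (x \<otimes> k))"
      using K.smooth_near_right[OF True] k by simp
    have "right_field Z k f = ?w (\<lambda>x. f (x \<otimes> k))"
      using right_field_apply[OF k True] Z by simp
    also have "\<dots> = v (\<lambda>x. f (x \<otimes> inv k \<otimes> k))"
      using differential_apply[of MK "\<lambda>x. x \<otimes> inv k" k _ MK v] n kk by simp
    also have "\<dots> = v f"
      by (rule K.tangent_vector_cong_carrier[OF v]) (use K_carrier k ik in \<open>simp add: group_simps\<close>)
    finally show ?thesis ..
  next
    case False
    then show ?thesis
      using tangent_vector_not_smooth[OF v] tangent_vector_not_smooth[OF right_field_tangent[OF Z(1) k]] by simp
  qed
  then show thesis using that Z by blast
qed

lemma Ad_smooth_K: "smooth_fun_on MK K (\<lambda>k. ad k Y \<bullet> w)"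
  by (rule smooth_restrict[OF Ad_smooth])

text \<open>By multiplicativity of \<open>ad\<close>, moving along \<open>x \<otimes> k\<close> is
  moving along \<open>x\<close> with \<open>ad k Y\<close> in place of \<open>Y\<close>; only the
  derivative of the adjoint action at the identity remains.\<close>

lemma right_field_Ad:
  assumes "Z \<in> \<hh>" "k \<in> K"
  shows "right_field Z k (\<lambda>k. ad k Y \<bullet> w) = br Z (ad k Y) \<bullet> w"
proof -
  have "right_field Z k (\<lambda>k. ad k Y \<bullet> w) = sv Z (\<lambda>x. ad (x \<otimes> k) Y \<bullet> w)"
    by (rule right_field_apply[OF assms(2) smooth_fun_on_imp_near[OF Ad_smooth_K assms(2)]])
  also have "\<dots> = sv Z (\<lambda>x. ad x (ad k Y) \<bullet> w)"
    by (rule K.tangent_vector_cong_carrier[OF sv_tangent(1)[OF assms(1)]])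
       (use Ad_mult K_carrier assms in simp)
  also have "\<dots> = lam Z (\<lambda>x. ad x (ad k Y) \<bullet> w)"
    by (rule sv_apply[OF assms(1) smooth_fun_on_imp_near[OF Ad_smooth]]) (simp add: group_simps)
  finally show ?thesis using Ad_derivative by simp
qed

text \<open>If \<open>v\<close> and \<open>w\<close> come from \<open>Z\<close> and
  \<open>Z'\<close>, the hypothesis says that \<open>Z - Z'\<close> commutes with every
  \<open>ad k Y\<close>. These exhaust the Lie algebra, so \<open>Z - Z'\<close> is central.\<close>

lemma tangent_vector_eq_by_Ad:
  assumes center: "\<And>Z. (\<forall>X. br Z X = 0) \<Longrightarrow> Z = 0" and br: "\<And>X Y Z. br (X - Y) Z = br X Z - br Y Z"
    and v: "v \<in> tangent_space MK k" and w: "w \<in> tangent_space MK k"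
    and eq: "\<And>Y u. v (\<lambda>k. ad k Y \<bullet> u) = w (\<lambda>k. ad k Y \<bullet> u)"
  shows "v = w"
proof -
  have k: "k \<in> K" using tangent_space_topspace[OF v] topspace_K by simp
  obtain Z where Z: "Z \<in> \<hh>" "v = right_field Z k" using tangent_vector_right_field[OF v] by blast
  obtain Z' where Z': "Z' \<in> \<hh>" "w = right_field Z' k" using tangent_vector_right_field[OF w] by blast
  have "br (Z - Z') X = 0" for X
  proof -
    let ?Y = "ad (inv k) X"
    have "\<forall>u. br Z (ad k ?Y) \<bullet> u = br Z' (ad k ?Y) \<bullet> u"
      using eq[of ?Y] right_field_Ad[OF Z(1) k] right_field_Ad[OF Z'(1) k] Z(2) Z'(2) by simp
    then have "br Z (ad k ?Y) = br Z' (ad k ?Y)" by (rule vector_eq_rdot[THEN iffD1])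
    then show ?thesis using Ad_surj[OF K_carrier[OF k]] br by simp
  qed
  then have "Z = Z'" using center[of "Z - Z'"] by simp
  then show ?thesis using Z Z' by simp
qed

end

section \<open>The decomposition of the Lie algebra\<close>

text \<open>The eigenvector maximises the Rayleigh quotient.\<close>

lemma symmetric_operator_eigenvector:
  fixes B :: "'g::euclidean_space \<Rightarrow> 'g \<Rightarrow> real"
  assumes B: "bilinear B" and sym: "\<And>x y. B x y = B y x" and pos: "\<And>x. x \<noteq> 0 \<Longrightarrow> B x x > 0"
    and A: "linear A" and Asym: "\<And>x y. B (A x) y = B x (A y)"
    and W: "subspace W" "\<And>x. x \<in> W \<Longrightarrow> A x \<in> W" "W \<noteq> {0}"
  shows "\<exists>x\<in>W. x \<noteq> 0 \<and> (\<exists>c. A x = c *\<^sub>R x)"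
proof -
  let ?S = "sphere 0 1 \<inter> W"
  let ?q = "\<lambda>x. B (A x) x / B x x"
  obtain w where w: "w \<in> W" "w \<noteq> 0" using W(1,3) subspace_0 by blast
  have bB: "bounded_bilinear B" using B bilinear_conv_bounded_bilinear by blast
  have S: "compact ?S" using closed_subspace[OF W(1)] by (intro compact_Int_closed) auto
  have "(1 / norm w) *\<^sub>R w \<in> ?S" using w subspace_scale[OF W(1)] by simp
  then have ne: "?S \<noteq> {}" by blast
  have "continuous_on ?S A" using A linear_continuous_on linear_conv_bounded_linear by blast
  moreover have "B x x \<noteq> 0" if "x \<in> ?S" for x
  proof -
    have "x \<noteq> 0" using that by auto
    then show ?thesis using pos[of x] by simp
  qed
  ultimately have "continuous_on ?S ?q"
    by (intro continuous_on_divide bounded_bilinear.continuous_on[OF bB] continuous_on_id) blast+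
  then obtain x where x: "x \<in> ?S" "\<And>y. y \<in> ?S \<Longrightarrow> ?q y \<le> ?q x"
    using continuous_attains_sup[OF S ne] by blast
  define c where "c = ?q x"
  have x0: "x \<noteq> 0" and xW: "x \<in> W" using x(1) by auto
  \<comment> \<open>The quotient is invariant under scaling, so its maximum on the unit sphere
    bounds it on all of \<open>W\<close>. Multiplied out, the bound includes
    \<open>y = 0\<close>.\<close>
  have le: "B (A y) y - c * B y y \<le> 0" if "y \<in> W" for y
  proof (cases "y = 0")
    case True
    then show ?thesis using B bilinear_lzero[OF B] linear_0[OF A] by simp
  next
    case False
    let ?y = "(1 / norm y) *\<^sub>R y"
    have "?y \<in> ?S" using that False subspace_scale[OF W(1)] by simp
    then have "?q ?y \<le> c" using x(2) c_def by blast
    moreover have "?q ?y = B (A y) y / B y y"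
      using False by (simp add: linear_cmul[OF A] bilinear_lmul[OF B] bilinear_rmul[OF B])
    ultimately show ?thesis using pos[OF False] by (simp add: divide_le_eq)
  qed
  define z where "z = A x - c *\<^sub>R x"
  have zW: "z \<in> W" unfolding z_def using W xW by (simp add: subspace_diff subspace_scale)
  have "z = 0"
  proof (rule ccontr)
    assume "z \<noteq> 0"
    then have s: "B z z > 0" by (rule pos)
    define k where "k = B (A z) z - c * B z z"
    \<comment> \<open>Moving from \<open>x\<close> to \<open>x + t *\<^sub>R z\<close> changes the
      left side of \<open>le\<close> by \<open>2 * t * B z z + t * t * k\<close>. This
      \<open>t\<close> makes \<open>t * \<bar>k\<bar>\<close> at most \<open>B z z\<close>, so the
      second-order term cannot offset the first.\<close>
    define t where "t = B z z / (\<bar>k\<bar> + 1)"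
    have t: "t > 0" unfolding t_def using s by simp
    have "x + t *\<^sub>R z \<in> W" using xW zW W(1) by (simp add: subspace_add subspace_scale)
    from le[OF this]
    have "B (A x) x + t * B (A x) z + t * B (A z) x + t * t * B (A z) z
        - c * (B x x + t * B x z + t * B z x + t * t * B z z) \<le> 0"
      by (simp add: linear_add[OF A] linear_cmul[OF A] bilinear_ladd[OF B] bilinear_radd[OF B]
          bilinear_lmul[OF B] bilinear_rmul[OF B] algebra_simps)
    moreover have "B (A x) x = c * B x x" using pos[OF x0] unfolding c_def by simp
    moreover have "B (A z) x = B (A x) z" using Asym sym by metis
    moreover have "B z x = B x z" by (rule sym)
    moreover have "B (A x) z - c * B x z = B z z"
      unfolding z_def by (simp add: bilinear_lsub[OF B] bilinear_lmul[OF B])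
    ultimately have "2 * t * B z z + t * t * k \<le> 0"
      unfolding k_def by (simp add: algebra_simps)
    then have "t * (2 * B z z + t * k) \<le> 0" by (simp add: algebra_simps)
    then have "2 * B z z + t * k \<le> 0" using t by (simp add: mult_le_0_iff)
    moreover have "t * (\<bar>k\<bar> + 1) = B z z" unfolding t_def by simp
    then have "t * \<bar>k\<bar> \<le> B z z" using t by (simp add: algebra_simps)
    then have "- (t * k) \<le> B z z" using t by (smt (verit) abs_mult abs_of_pos minus_mult_right mult_left_mono)
    ultimately show False using s by linarith
  qed
  then have "A x = c *\<^sub>R x" unfolding z_def by simp
  then show ?thesis using x0 xW by blast
qed

text \<open>In a nonzero invariant subspace \<open>V\<close> of least dimension, an eigenspace of
  one operator is invariant under all the others because they commute, hence is all of
  \<open>V\<close>. So every vector of \<open>V\<close> is a common eigenvector, even for infinitely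
  many operators.\<close>

lemma commuting_operators_eigenvector:
  fixes B :: "'g::euclidean_space \<Rightarrow> 'g \<Rightarrow> real"
  assumes B: "bilinear B" and sym: "\<And>x y. B x y = B y x" and pos: "\<And>x. x \<noteq> 0 \<Longrightarrow> B x x > 0"
    and A: "\<And>i. i \<in> I \<Longrightarrow> linear (A i)" and Asym: "\<And>i x y. i \<in> I \<Longrightarrow> B (A i x) y = B x (A i y)"
    and comm: "\<And>i j x. i \<in> I \<Longrightarrow> j \<in> I \<Longrightarrow> A i (A j x) = A j (A i x)"
    and W: "subspace W" "\<And>i x. i \<in> I \<Longrightarrow> x \<in> W \<Longrightarrow> A i x \<in> W" "W \<noteq> {0}"
  shows "\<exists>x\<in>W. x \<noteq> 0 \<and> (\<forall>i\<in>I. \<exists>c. A i x = c *\<^sub>R x)"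
proof -
  let ?Q = "\<lambda>V. subspace V \<and> V \<subseteq> W \<and> (\<forall>i\<in>I. \<forall>x\<in>V. A i x \<in> V) \<and> V \<noteq> {0}"
  have "?Q W" using W by blast
  then obtain V where V: "?Q V" and min: "\<And>V'. ?Q V' \<Longrightarrow> dim V \<le> dim V'"
    using ex_has_least_nat[of ?Q W dim] by blast
  obtain x where x: "x \<in> V" "x \<noteq> 0" using V subspace_0 by blast
  have "\<exists>c. A i x = c *\<^sub>R x" if i: "i \<in> I" for i
  proof -
    obtain y c where y: "y \<in> V" "y \<noteq> 0" "A i y = c *\<^sub>R y"
      using symmetric_operator_eigenvector[OF B sym pos A[OF i] Asym[OF i], of V] V i by blast
    let ?E = "{z\<in>V. A i z = c *\<^sub>R z}"
    have lin: "linear (A i)" using A[OF i] .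
    have sub: "subspace ?E"
      using V linear_0[OF lin]
      by (auto simp: subspace_def linear_add[OF lin] linear_cmul[OF lin] scaleR_add_right)
    have "A j z \<in> ?E" if "j \<in> I" "z \<in> ?E" for j z
      using that V comm[OF i that(1), of z] linear_cmul[OF A[OF that(1)]] by auto
    moreover have "?E \<noteq> {0}" using y by blast
    ultimately have "?Q ?E" using V sub by blast
    then have "dim V \<le> dim ?E" by (rule min)
    then have "?E = V" using V sub by (intro subspace_dim_equal) auto
    then show ?thesis using x by blast
  qed
  then show ?thesis using x V by blast
qed

lemma trace_commute:
  fixes f g :: "'g::euclidean_space \<Rightarrow> 'g"
  assumes "linear f" "linear g"
  shows "(\<Sum>b\<in>Basis. f (g b) \<bullet> b) = (\<Sum>b\<in>Basis. g (f b) \<bullet> b)"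
proof -
  have *: "f (g b) \<bullet> b = (\<Sum>c\<in>Basis. (g b \<bullet> c) * (f c \<bullet> b))" if "linear f" for f g :: "'g \<Rightarrow> 'g" and b
  proof -
    have "f (g b) = f (\<Sum>c\<in>Basis. (g b \<bullet> c) *\<^sub>R c)" by (simp add: euclidean_representation)
    also have "\<dots> = (\<Sum>c\<in>Basis. (g b \<bullet> c) *\<^sub>R f c)"
      by (simp add: linear_sum[OF that] linear_cmul[OF that])
    finally show ?thesis by (simp add: inner_sum_left)
  qed
  have "(\<Sum>b\<in>Basis. f (g b) \<bullet> b) = (\<Sum>c\<in>Basis. \<Sum>b\<in>Basis. (g b \<bullet> c) * (f c \<bullet> b))"
    unfolding *[OF assms(1), of g] by (rule sum.swap)
  also have "\<dots> = (\<Sum>c\<in>Basis. \<Sum>b\<in>Basis. (f c \<bullet> b) * (g b \<bullet> c))"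
    by (simp add: mult.commute)
  also have "\<dots> = (\<Sum>c\<in>Basis. g (f c) \<bullet> c)" unfolding *[OF assms(2), of f] ..
  finally show ?thesis .
qed

text \<open>Two nested span inductions. Besides closure under brackets it yields orthogonality of
  spans, with the zero subspace of the reals as \<open>V\<close>.\<close>

lemma span_bilinear_induct:
  assumes br: "bilinear br" and V: "subspace V" and ST: "\<And>x y. x \<in> S \<Longrightarrow> y \<in> T \<Longrightarrow> br x y \<in> V"
    and x: "x \<in> span S" and y: "y \<in> span T"
  shows "br x y \<in> V"
proof -
  have 1: "br x y \<in> V" if "x \<in> S" for x
    using y
  proof (induction rule: span_induct)
    case base
    show ?case
      by (rule subspaceI)
         (simp_all add: bilinear_rzero[OF br] bilinear_radd[OF br] bilinear_rmul[OF br]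
           subspace_0[OF V] subspace_add[OF V] subspace_scale[OF V])
  next
    case (step y)
    then show ?case using ST[OF that step] by simp
  qed
  show ?thesis
    using x
  proof (induction rule: span_induct)
    case base
    show ?case
      by (rule subspaceI)
         (simp_all add: bilinear_lzero[OF br] bilinear_ladd[OF br] bilinear_lmul[OF br]
           subspace_0[OF V] subspace_add[OF V] subspace_scale[OF V])
  next
    case (step x)
    then show ?case using 1[OF step] by simp
  qed
qed

section \<open>The Killing form and the inner product of a Cartan involution\<close>

locale cartan_data =
  fixes br :: "'g::euclidean_space \<Rightarrow> 'g \<Rightarrow> 'g" and \<theta> :: "'g \<Rightarrow> 'g" and \<aa> :: "'g set"
    and P :: "('g \<Rightarrow> real) set"
  assumes lie_algebra: "lie_algebra scaleR br" and involution: "cartan_involution br \<theta>"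
    and maximal: "maximal_commutative_in br (cartan_p \<theta>) \<aa>"
    and positive: "positive_system (restricted_roots br \<aa>) P"
begin

lemma br_bilinear: "bilinear br"
  using lie_algebra unfolding lie_algebra_def bilinear_def Real_Vector_Spaces.linear_def by blast

lemma br_self: "br x x = 0" and jacobi: "br x (br y z) + br y (br z x) + br z (br x y) = 0"
  using lie_algebra unfolding lie_algebra_def by blast+

lemma br_linear: "linear (br x)"
  using br_bilinear unfolding bilinear_def by blast

lemmas br_simps = bilinear_ladd[OF br_bilinear] bilinear_radd[OF br_bilinear]
  bilinear_lsub[OF br_bilinear] bilinear_rsub[OF br_bilinear]
  bilinear_lmul[OF br_bilinear] bilinear_rmul[OF br_bilinear]
  bilinear_lneg[OF br_bilinear] bilinear_rneg[OF br_bilinear]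
  bilinear_lzero[OF br_bilinear] bilinear_rzero[OF br_bilinear]

lemma br_skew: "br y x = - br x y"
proof -
  have "br (x + y) (x + y) = br x x + br x y + (br y x + br y y)"
    by (simp only: bilinear_ladd[OF br_bilinear] bilinear_radd[OF br_bilinear] add_ac)
  then have "br x y + br y x = 0" by (simp add: br_self)
  then show ?thesis by (metis add.commute eq_neg_iff_add_eq_0)
qed

lemma br_br: "br (br x y) z = br x (br y z) - br y (br x z)"
proof -
  have "br (br x y) z = - br z (br x y)" by (rule br_skew)
  also have "\<dots> = br x (br y z) + br y (br z x)" using jacobi[of x y z] by (metis neg_eq_iff_add_eq_0 add.commute)
  also have "br y (br z x) = - br y (br x z)" using br_skew[of z x] by (simp add: br_simps)
  finally show ?thesis by simp
qed

lemma theta_linear: "linear \<theta>" and theta_br: "\<theta> (br X Y) = br (\<theta> X) (\<theta> Y)" and theta_theta: "\<theta> (\<theta> X) = X"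
  and killing_theta_pos: "X \<noteq> 0 \<Longrightarrow> - killing_form br X (\<theta> X) > 0"
  using involution unfolding cartan_involution_def by blast+

text \<open>For central \<open>Z\<close> every summand of
  \<open>killing_form br Z (\<theta> Z)\<close> vanishes, against the definiteness demanded of a
  Cartan involution.\<close>

lemma center_trivial: "(\<forall>X. br Z X = 0) \<Longrightarrow> Z = 0"
  using killing_theta_pos[of Z] unfolding killing_form_def by fastforce

lemma br_comp_linear: "linear (\<lambda>b. br X (br Y b))"
  using linear_compose[OF br_linear[of Y] br_linear[of X]] by (simp add: comp_def)

lemma killing_sym: "killing_form br X Y = killing_form br Y X"
  unfolding killing_form_def by (rule trace_commute[OF br_linear br_linear])

lemma killing_bilinear: "bilinear (killing_form br)"
  unfolding bilinear_def killing_form_def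
  by (auto intro!: linearI simp: br_simps inner_add_left sum.distrib sum_distrib_left)

text \<open>Replacing both elements by their images under \<theta> conjugates the operator in the
  trace by \<theta>, which is its own inverse.\<close>

lemma killing_theta: "killing_form br (\<theta> X) (\<theta> Y) = killing_form br X Y"
proof -
  have "killing_form br (\<theta> X) (\<theta> Y) = (\<Sum>b\<in>Basis. \<theta> (br X (br Y (\<theta> b))) \<bullet> b)"
    unfolding killing_form_def by (simp add: theta_br theta_theta)
  also have "\<dots> = (\<Sum>b\<in>Basis. br X (br Y (\<theta> (\<theta> b))) \<bullet> b)"
    by (rule trace_commute[OF theta_linear])
       (use linear_compose[OF theta_linear br_comp_linear] in \<open>simp add: comp_def\<close>)
  finally show ?thesis unfolding killing_form_def theta_theta .
qed

text \<open>Expanding \<open>br X Y\<close> gives two traces of triple products. Cyclicity moves the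
  operator of \<open>X\<close> to the end of one of them, where the two combine to the operator of
  \<open>br X Z\<close>.\<close>

lemma killing_invariant: "killing_form br (br X Y) Z = - killing_form br Y (br X Z)"
proof -
  have "killing_form br (br X Y) Z = (\<Sum>b\<in>Basis. br X (br Y (br Z b)) \<bullet> b) - (\<Sum>b\<in>Basis. br Y (br X (br Z b)) \<bullet> b)"
    unfolding killing_form_def by (simp add: br_br inner_diff_left sum_subtractf)
  also have "(\<Sum>b\<in>Basis. br X (br Y (br Z b)) \<bullet> b) = (\<Sum>b\<in>Basis. br Y (br Z (br X b)) \<bullet> b)"
    by (rule trace_commute[OF br_linear br_comp_linear])
  finally show ?thesis
    unfolding killing_form_def by (simp add: br_br br_simps inner_diff_left sum_subtractf)
qed

definition B\<^sub>\<theta> :: "'g \<Rightarrow> 'g \<Rightarrow> real" where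
  "B\<^sub>\<theta> X Y = - killing_form br X (\<theta> Y)"

lemma B_sym: "B\<^sub>\<theta> X Y = B\<^sub>\<theta> Y X"
  unfolding B\<^sub>\<theta>_def using killing_theta[of Y "\<theta> X"] killing_sym by (simp add: theta_theta)

lemma B_pos: "X \<noteq> 0 \<Longrightarrow> B\<^sub>\<theta> X X > 0"
  unfolding B\<^sub>\<theta>_def by (rule killing_theta_pos)

lemma B_bilinear: "bilinear B\<^sub>\<theta>"
  unfolding bilinear_def B\<^sub>\<theta>_def
  by (auto intro!: linearI simp: linear_add[OF theta_linear] linear_cmul[OF theta_linear]
      bilinear_ladd[OF killing_bilinear] bilinear_radd[OF killing_bilinear]
      bilinear_lmul[OF killing_bilinear] bilinear_rmul[OF killing_bilinear])

text \<open>The operator \<open>br H\<close> is skew for the Killing form, and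
  \<open>\<theta> H = - H\<close> contributes a second sign. This symmetry is what makes the
  operators from \<open>\<aa>\<close> diagonalisable.\<close>

lemma B_br_symmetric:
  assumes "H \<in> cartan_p \<theta>"
  shows "B\<^sub>\<theta> (br H X) Y = B\<^sub>\<theta> X (br H Y)"
proof -
  have "\<theta> (br H Y) = - br H (\<theta> Y)" using assms by (simp add: theta_br cartan_p_def br_simps)
  then show ?thesis
    unfolding B\<^sub>\<theta>_def killing_invariant by (simp add: bilinear_rneg[OF killing_bilinear])
qed

lemma a_subspace: "subspace \<aa>" and a_p: "\<aa> \<subseteq> cartan_p \<theta>"
  and a_comm: "x \<in> \<aa> \<Longrightarrow> y \<in> \<aa> \<Longrightarrow> br x y = 0"
  and a_maximal: "subspace S \<Longrightarrow> S \<subseteq> cartan_p \<theta> \<Longrightarrow> (\<forall>x\<in>S. \<forall>y\<in>S. br x y = 0) \<Longrightarrow> \<aa> \<subseteq> S \<Longrightarrow> S = \<aa>"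
  using maximal unfolding maximal_commutative_in_def Let_def by blast+

lemma theta_a: "H \<in> \<aa> \<Longrightarrow> \<theta> H = - H"
  using a_p unfolding cartan_p_def by blast

lemma k_subspace: "subspace (cartan_k \<theta>)"
  unfolding cartan_k_def subspace_def
  by (simp add: linear_0[OF theta_linear] linear_add[OF theta_linear] linear_cmul[OF theta_linear])

lemma p_subspace: "subspace (cartan_p \<theta>)"
  unfolding cartan_p_def subspace_def
  by (simp add: linear_0[OF theta_linear] linear_add[OF theta_linear] linear_cmul[OF theta_linear])

lemma root_spaceD: "x \<in> root_space br \<aa> \<alpha> \<Longrightarrow> H \<in> \<aa> \<Longrightarrow> br H x = \<alpha> H *\<^sub>R x"
  unfolding root_space_def by blast

lemma theta_root_space:
  assumes "x \<in> root_space br \<aa> \<alpha>"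
  shows "\<theta> x \<in> root_space br \<aa> (\<lambda>H. - \<alpha> H)"
proof -
  have "br H (\<theta> x) = - \<alpha> H *\<^sub>R \<theta> x" if "H \<in> \<aa>" for H
  proof -
    have "br H (\<theta> x) = - br (\<theta> H) (\<theta> x)" using theta_a[OF that] by (simp add: br_simps)
    also have "\<dots> = - \<theta> (br H x)" by (simp add: theta_br)
    also have "\<dots> = - \<alpha> H *\<^sub>R \<theta> x"
      using root_spaceD[OF assms that] by (simp add: linear_cmul[OF theta_linear])
    finally show ?thesis .
  qed
  then show ?thesis unfolding root_space_def by blast
qed

text \<open>Eigenvectors of the symmetric operator \<open>br H\<close> with different eigenvalues
  are orthogonal.\<close>

lemma root_space_orthogonal:
  assumes "x \<in> root_space br \<aa> \<alpha>" "y \<in> root_space br \<aa> \<beta>" "H \<in> \<aa>" "\<alpha> H \<noteq> \<beta> H"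
  shows "B\<^sub>\<theta> x y = 0"
proof -
  have "B\<^sub>\<theta> (br H x) y = B\<^sub>\<theta> x (br H y)" using B_br_symmetric assms(3) a_p by blast
  then have "\<alpha> H * B\<^sub>\<theta> x y = \<beta> H * B\<^sub>\<theta> x y"
    using root_spaceD[OF assms(1,3)] root_spaceD[OF assms(2,3)]
    by (simp add: bilinear_lmul[OF B_bilinear] bilinear_rmul[OF B_bilinear])
  then show ?thesis using assms(4) by simp
qed

lemma root_space_br:
  assumes "x \<in> root_space br \<aa> \<alpha>" "y \<in> root_space br \<aa> \<beta>"
  shows "br x y \<in> root_space br \<aa> (\<lambda>H. \<alpha> H + \<beta> H)"
proof -
  have "br H (br x y) = (\<alpha> H + \<beta> H) *\<^sub>R br x y" if H: "H \<in> \<aa>" for H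
  proof -
    have "br H (br x y) = br (br H x) y + br x (br H y)" using br_br[of H x y] by simp
    then show ?thesis
      using root_spaceD[OF assms(1) H] root_spaceD[OF assms(2) H] by (simp add: br_simps scaleR_add_left)
  qed
  then show ?thesis unfolding root_space_def by blast
qed

lemma P_roots: "\<alpha> \<in> P \<Longrightarrow> \<alpha> \<in> restricted_roots br \<aa>"
  and P_minus: "\<alpha> \<in> restricted_roots br \<aa> \<Longrightarrow> (\<alpha> \<in> P) \<noteq> ((\<lambda>H. - \<alpha> H) \<in> P)"
  and P_add: "\<alpha> \<in> P \<Longrightarrow> \<beta> \<in> P \<Longrightarrow> (\<lambda>H. \<alpha> H + \<beta> H) \<in> restricted_roots br \<aa> \<Longrightarrow> (\<lambda>H. \<alpha> H + \<beta> H) \<in> P"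
  using positive unfolding positive_system_def by blast+

lemma P_dual: "\<alpha> \<in> P \<Longrightarrow> \<alpha> \<in> dual_space \<aa>"
  using P_roots unfolding restricted_roots_def by blast

lemma P_nonzero:
  assumes "\<alpha> \<in> P"
  shows "\<exists>H\<in>\<aa>. \<alpha> H \<noteq> 0"
proof -
  have "\<alpha> \<noteq> (\<lambda>_. 0)" "\<forall>x. x \<notin> \<aa> \<longrightarrow> \<alpha> x = 0"
    using P_roots[OF assms] unfolding restricted_roots_def dual_space_def by blast+
  then show ?thesis by blast
qed

text \<open>Otherwise a root and its negative would both be positive. Agreement on
  \<open>\<aa>\<close> is agreement as functions, since elements of the dual space vanish
  elsewhere.\<close>

lemma P_not_opposite:
  assumes "\<alpha> \<in> P" "\<beta> \<in> P"
  shows "\<exists>H\<in>\<aa>. - \<alpha> H \<noteq> \<beta> H"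
proof (rule ccontr)
  assume "\<not> ?thesis"
  moreover have "\<alpha> H = 0" "\<beta> H = 0" if "H \<notin> \<aa>" for H
    using P_dual assms that unfolding dual_space_def by blast+
  ultimately have "\<beta> = (\<lambda>H. - \<alpha> H)" by (metis (no_types, opaque_lifting) minus_zero)
  then show False using assms P_minus[OF P_roots[OF assms(1)]] by blast
qed

section \<open>The decomposition into \<open>cartan_k \<theta>\<close> and
  \<open>b_minus br \<aa> P\<close>\<close>

abbreviation "\<bb> \<equiv> b_minus br \<aa> P"
abbreviation "n_gens \<equiv> \<Union>\<alpha>\<in>P. root_space br \<aa> (\<lambda>H. - \<alpha> H)"

lemma b_subspace: "subspace \<bb>"
  unfolding b_minus_def by (rule subspace_span)

lemma b_superset: "\<aa> \<union> n_gens \<subseteq> \<bb>"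
  unfolding b_minus_def by (rule span_superset)

text \<open>On \<open>\<aa>\<close>, on the span of the negative root spaces and on its image under
  \<theta> the weights are zero, negative and positive. Weights of different kinds differ at some
  \<open>H\<close>, so the three spaces are pairwise orthogonal.\<close>

lemma n_orthogonal:
  assumes "N \<in> span n_gens"
  shows "H \<in> \<aa> \<Longrightarrow> B\<^sub>\<theta> H N = 0" and "H \<in> \<aa> \<Longrightarrow> B\<^sub>\<theta> H (\<theta> N) = 0"
    and "N' \<in> span n_gens \<Longrightarrow> B\<^sub>\<theta> N' (\<theta> N) = 0"
proof -
  have a0: "H \<in> root_space br \<aa> (\<lambda>_. 0)" if "H \<in> \<aa>" for H
    unfolding root_space_def using a_comm that by simp
  have Bt: "bilinear (\<lambda>x y. B\<^sub>\<theta> x (\<theta> y))"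
    unfolding bilinear_def
    by (auto intro!: linearI simp: linear_add[OF theta_linear] linear_cmul[OF theta_linear]
      bilinear_ladd[OF B_bilinear] bilinear_radd[OF B_bilinear]
      bilinear_lmul[OF B_bilinear] bilinear_rmul[OF B_bilinear])
  have th: "\<theta> y \<in> root_space br \<aa> \<alpha>" if "y \<in> root_space br \<aa> (\<lambda>H. - \<alpha> H)" for y \<alpha>
    using theta_root_space[OF that] by simp
  have 0: "subspace {0::real}" by (simp add: subspace_def)
  have 1: "B\<^sub>\<theta> x y \<in> {0}" if x: "x \<in> \<aa>" and y: "y \<in> n_gens" for x y
  proof -
    obtain \<alpha> where \<alpha>: "\<alpha> \<in> P" "y \<in> root_space br \<aa> (\<lambda>H. - \<alpha> H)" using y by blast
    then obtain H where "H \<in> \<aa>" "\<alpha> H \<noteq> 0" using P_nonzero by blast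
    then show ?thesis using root_space_orthogonal[OF a0[OF x] \<alpha>(2), of H] by simp
  qed
  have 2: "B\<^sub>\<theta> x (\<theta> y) \<in> {0}" if x: "x \<in> \<aa>" and y: "y \<in> n_gens" for x y
  proof -
    obtain \<alpha> where \<alpha>: "\<alpha> \<in> P" "y \<in> root_space br \<aa> (\<lambda>H. - \<alpha> H)" using y by blast
    then obtain H where "H \<in> \<aa>" "\<alpha> H \<noteq> 0" using P_nonzero by blast
    then show ?thesis using root_space_orthogonal[OF a0[OF x] th[OF \<alpha>(2)], of H] by simp
  qed
  have 3: "B\<^sub>\<theta> x (\<theta> y) \<in> {0}" if x: "x \<in> n_gens" and y: "y \<in> n_gens" for x y
  proof -
    obtain \<alpha> where \<alpha>: "\<alpha> \<in> P" "x \<in> root_space br \<aa> (\<lambda>H. - \<alpha> H)" using x by blast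
    obtain \<beta> where \<beta>: "\<beta> \<in> P" "y \<in> root_space br \<aa> (\<lambda>H. - \<beta> H)" using y by blast
    obtain H where "H \<in> \<aa>" "- \<alpha> H \<noteq> \<beta> H" using P_not_opposite[OF \<alpha>(1) \<beta>(1)] by blast
    then show ?thesis using root_space_orthogonal[OF \<alpha>(2) th[OF \<beta>(2)], of H] by simp
  qed
  show "B\<^sub>\<theta> H N = 0" if "H \<in> \<aa>"
    using span_bilinear_induct[OF B_bilinear 0 1 span_base[OF that] assms] by simp
  show "B\<^sub>\<theta> H (\<theta> N) = 0" if "H \<in> \<aa>"
    using span_bilinear_induct[OF Bt 0 2 span_base[OF that] assms] by simp
  show "B\<^sub>\<theta> N' (\<theta> N) = 0" if "N' \<in> span n_gens"
    using span_bilinear_induct[OF Bt 0 3 that assms] by simp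
qed

text \<open>Write \<open>X = H + N\<close>. Invariance under \<theta> reads
  \<open>- H + \<theta> N = H + N\<close>; pairing with \<open>H\<close> removes both terms in
  \<open>N\<close> and forces \<open>H = 0\<close>. Then \<open>N\<close> equals
  \<open>\<theta> N\<close>, to which it is orthogonal.\<close>

lemma k_Int_b:
  assumes k: "X \<in> cartan_k \<theta>" and b: "X \<in> \<bb>"
  shows "X = 0"
proof -
  obtain H N where HN: "X = H + N" "H \<in> span \<aa>" "N \<in> span n_gens"
    using b unfolding b_minus_def span_Un by blast
  have H: "H \<in> \<aa>" using HN(2) by (simp only: span_eq_iff[THEN iffD2, OF a_subspace])
  have eq: "- H + \<theta> N = H + N"
    using k HN(1) theta_a[OF H] by (simp add: cartan_k_def linear_add[OF theta_linear])
  then have "B\<^sub>\<theta> H (- H + \<theta> N) = B\<^sub>\<theta> H (H + N)" by simp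
  then have "B\<^sub>\<theta> H H = 0"
    using n_orthogonal(1,2)[OF HN(3) H]
    by (simp add: bilinear_radd[OF B_bilinear] bilinear_rneg[OF B_bilinear] bilinear_rsub[OF B_bilinear])
  then have "H = 0" using B_pos[of H] by fastforce
  moreover from this eq have "\<theta> N = N" by simp
  then have "B\<^sub>\<theta> N N = 0" using n_orthogonal(3)[OF HN(3) HN(3)] by simp
  then have "N = 0" using B_pos[of N] by fastforce
  ultimately show ?thesis using HN by simp
qed

text \<open>Otherwise the \<open>B\<^sub>\<theta>\<close>-orthogonal complement of the span is
  nonzero. It is invariant under the commuting symmetric operators from \<open>\<aa>\<close> and so
  contains a common eigenvector. That vector belongs to a root space and is thus orthogonal to
  itself.\<close>

lemma root_space_span: "span (\<Union>\<alpha>\<in>dual_space \<aa>. root_space br \<aa> \<alpha>) = UNIV"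
proof (rule ccontr)
  let ?R = "\<Union>\<alpha>\<in>dual_space \<aa>. root_space br \<aa> \<alpha>"
  assume "span ?R \<noteq> UNIV"
  then obtain a where a: "a \<noteq> 0" "\<And>s. s \<in> span ?R \<Longrightarrow> a \<bullet> s = 0"
    using span_not_UNIV_orthogonal[of ?R] by blast
  \<comment> \<open>\<open>?T\<close> expresses \<open>B\<^sub>\<theta>\<close> by the Euclidean
    inner product. Being injective by definiteness it is onto, so the Euclidean normal
    \<open>a\<close> of the span has a preimage that is orthogonal for
    \<open>B\<^sub>\<theta>\<close>.\<close>
  let ?T = "\<lambda>x. \<Sum>b\<in>Basis. B\<^sub>\<theta> x b *\<^sub>R b"
  have T: "?T x \<bullet> y = B\<^sub>\<theta> x y" for x y
  proof -
    have "B\<^sub>\<theta> x y = B\<^sub>\<theta> x (\<Sum>b\<in>Basis. (y \<bullet> b) *\<^sub>R b)" by (simp add: euclidean_representation)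
    also have "\<dots> = (\<Sum>b\<in>Basis. (y \<bullet> b) * B\<^sub>\<theta> x b)"
      using B_bilinear unfolding bilinear_def by (simp add: linear_sum linear_cmul)
    finally show ?thesis by (simp add: inner_sum_left inner_commute[of y] mult.commute)
  qed
  have "linear ?T"
    by (rule linearI) (simp_all add: bilinear_ladd[OF B_bilinear] bilinear_lmul[OF B_bilinear]
        scaleR_add_left sum.distrib scaleR_sum_right)
  moreover have "inj ?T"
  proof (rule injI)
    fix x y assume "?T x = ?T y"
    then have "B\<^sub>\<theta> (x - y) (x - y) = 0" using T[of x "x - y"] T[of y "x - y"]
      by (simp add: bilinear_lsub[OF B_bilinear])
    then show "x = y" using B_pos[of "x - y"] by fastforce
  qed
  ultimately have "surj ?T" by (rule linear_injective_imp_surjective) simp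
  then obtain w0 where w0: "a = ?T w0" by blast
  let ?W = "{w. \<forall>s\<in>span ?R. B\<^sub>\<theta> w s = 0}"
  have "w0 \<in> ?W" using a(2) T w0 by simp
  moreover have "w0 \<noteq> 0" using a(1) w0 by (auto simp: bilinear_lzero[OF B_bilinear])
  ultimately have ne: "?W \<noteq> {0}" by blast
  have sub: "subspace ?W"
    by (simp add: subspace_def bilinear_lzero[OF B_bilinear] bilinear_ladd[OF B_bilinear] bilinear_lmul[OF B_bilinear])
  have inv_R: "br H s \<in> span ?R" if "H \<in> \<aa>" "s \<in> span ?R" for H s
  proof (rule span_bilinear_induct[OF br_bilinear subspace_span _ span_base that(2)])
    show "H \<in> {H}" by simp
    show "br x y \<in> span ?R" if x: "x \<in> {H}" and y: "y \<in> ?R" for x y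
    proof -
      obtain \<alpha> where "y \<in> root_space br \<aa> \<alpha>" using y by blast
      then have "br x y = \<alpha> H *\<^sub>R y" using root_spaceD[of y \<alpha> H] \<open>H \<in> \<aa>\<close> x by simp
      then show ?thesis using span_scale[OF span_base[OF y], of "\<alpha> H"] by simp
    qed
  qed
  have inv_W: "br H w \<in> ?W" if "H \<in> \<aa>" "w \<in> ?W" for H w
    using that inv_R B_br_symmetric a_p by auto
  have comm: "br H (br H' x) = br H' (br H x)" if "H \<in> \<aa>" "H' \<in> \<aa>" for H H' x
    using br_br[of H H' x] a_comm[OF that] by (simp add: br_simps)
  obtain w where w: "w \<in> ?W" "w \<noteq> 0" "\<forall>H\<in>\<aa>. \<exists>c. br H w = c *\<^sub>R w"
    using commuting_operators_eigenvector[where A = br and I = \<aa>, OF B_bilinear B_sym B_pos br_linear _ comm sub inv_W ne]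
      B_br_symmetric a_p by blast
  then obtain c where c: "\<And>H. H \<in> \<aa> \<Longrightarrow> br H w = c H *\<^sub>R w" by metis
  \<comment> \<open>The eigenvalues are extended by 0 outside \<open>\<aa>\<close>, the normal form
    that \<open>dual_space\<close> prescribes.\<close>
  let ?\<alpha> = "\<lambda>H. if H \<in> \<aa> then c H else 0"
  have "c (x + y) = c x + c y" if "x \<in> \<aa>" "y \<in> \<aa>" for x y
  proof -
    have "c (x + y) *\<^sub>R w = (c x + c y) *\<^sub>R w"
      using c that subspace_add[OF a_subspace that] by (metis br_simps(1) scaleR_add_left)
    then show ?thesis using w(2) by simp
  qed
  moreover have "c (r *\<^sub>R x) = r * c x" if "x \<in> \<aa>" for r x
  proof -
    have "c (r *\<^sub>R x) *\<^sub>R w = br (r *\<^sub>R x) w"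
      by (rule c[OF subspace_scale[OF a_subspace that], symmetric])
    also have "\<dots> = (r * c x) *\<^sub>R w" by (simp only: br_simps c[OF that] scaleR_scaleR)
    finally have "c (r *\<^sub>R x) *\<^sub>R w = (r * c x) *\<^sub>R w" .
    then show ?thesis using w(2) by simp
  qed
  ultimately have "?\<alpha> \<in> dual_space \<aa>"
    unfolding dual_space_def using a_subspace by (simp add: subspace_add subspace_scale)
  moreover have "w \<in> root_space br \<aa> ?\<alpha>" unfolding root_space_def using c by simp
  ultimately have "w \<in> span ?R" by (intro span_base) blast
  then have "B\<^sub>\<theta> w w = 0" using w(1) by blast
  then show False using B_pos[OF w(2)] by simp
qed

text \<open>By \<open>root_space_span\<close> it suffices to treat root vectors \<open>x\<close>.
  For a positive root, \<open>x = (x + \<theta> x) - \<theta> x\<close> with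
  \<open>\<theta> x\<close> in a negative root space; for a negative root \<open>x\<close> is
  already in \<open>\<bb>\<close>; for weight 0 maximality of \<open>\<aa>\<close> decides.\<close>

lemma k_plus_b: "\<exists>Y\<in>cartan_k \<theta>. X - Y \<in> \<bb>"
proof -
  let ?S = "{x + y |x y. x \<in> cartan_k \<theta> \<and> y \<in> \<bb>}"
  have S: "subspace ?S" by (rule subspace_sums[OF k_subspace b_subspace])
  have gen: "x \<in> ?S" if \<alpha>: "\<alpha> \<in> dual_space \<aa>" and x: "x \<in> root_space br \<aa> \<alpha>" for x \<alpha>
  \<comment> \<open>The zero vector joins the weight-0 case, so that in the other case the root
    space is not \<open>{0}\<close> and \<alpha> is a restricted root.\<close>
  proof (cases "x = 0 \<or> \<alpha> = (\<lambda>_. 0)")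
    case True
    have x0: "x \<in> root_space br \<aa> (\<lambda>_. 0)"
      using True x by (auto simp: root_space_def br_simps)
    let ?k = "(1/2) *\<^sub>R (x + \<theta> x)" and ?p = "(1/2) *\<^sub>R (x - \<theta> x)"
    have "?k \<in> cartan_k \<theta>"
      unfolding cartan_k_def
      by (simp add: linear_cmul[OF theta_linear] linear_add[OF theta_linear] theta_theta add.commute)
    moreover have p: "?p \<in> cartan_p \<theta>"
      unfolding cartan_p_def
      by (simp add: linear_cmul[OF theta_linear] linear_diff[OF theta_linear] theta_theta
          flip: scaleR_minus_right)
    have c: "br H ?p = 0" if "H \<in> \<aa>" for H
      using root_spaceD[OF x0 that] root_spaceD[OF theta_root_space[OF x0] that] by (simp add: br_simps)
    have c': "br ?p H = 0" if "H \<in> \<aa>" for H using c[OF that] br_skew[of ?p H] by simp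
    \<comment> \<open>The part \<open>?p\<close> of \<open>x\<close> commutes with
      \<open>\<aa>\<close> and lies in \<open>cartan_p \<theta>\<close>. Adjoining it keeps
      \<open>\<aa>\<close> commutative, so by maximality it was there before.\<close>
    have "span (insert ?p \<aa>) = \<aa>"
    proof (rule a_maximal[OF subspace_span])
      show "span (insert ?p \<aa>) \<subseteq> cartan_p \<theta>"
        by (rule span_minimal[OF _ p_subspace]) (use p a_p in simp)
      have "br x y \<in> {0}" if "x \<in> span (insert ?p \<aa>)" "y \<in> span (insert ?p \<aa>)" for x y
        by (rule span_bilinear_induct[OF br_bilinear _ _ that])
           (use c c' a_comm br_self in \<open>auto simp: subspace_def simp del: scaleR_right_diff_distrib\<close>)
      then show "\<forall>x\<in>span (insert ?p \<aa>). \<forall>y\<in>span (insert ?p \<aa>). br x y = 0" by blast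
      show "\<aa> \<subseteq> span (insert ?p \<aa>)" using span_superset[of "insert ?p \<aa>"] by simp
    qed
    then have "?p \<in> \<aa>" using span_base[of ?p "insert ?p \<aa>"] by simp
    then have "?p \<in> \<bb>" using b_superset by blast
    moreover have "x = ?k + ?p" by (simp add: algebra_simps flip: scaleR_2 scaleR_add_left)
    ultimately show ?thesis by blast
  next
    case False
    then have r: "\<alpha> \<in> restricted_roots br \<aa>" unfolding restricted_roots_def using \<alpha> x by blast
    show ?thesis
    proof (cases "\<alpha> \<in> P")
      case True
      have "x + \<theta> x \<in> cartan_k \<theta>"
        unfolding cartan_k_def by (simp add: linear_add[OF theta_linear] theta_theta add.commute)
      moreover have "\<theta> x \<in> \<bb>" using theta_root_space[OF x] True b_superset by blast
      then have "- \<theta> x \<in> \<bb>" using b_subspace subspace_neg by blast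
      moreover have "x = (x + \<theta> x) + - \<theta> x" by simp
      ultimately show ?thesis by blast
    next
      case False
      then have "(\<lambda>H. - \<alpha> H) \<in> P" using P_minus[OF r] by blast
      moreover have "x \<in> root_space br \<aa> (\<lambda>H. - (- \<alpha> H))" using x by simp
      ultimately have "x \<in> \<bb>" using b_superset by blast
      moreover have "0 \<in> cartan_k \<theta>" using k_subspace subspace_0 by blast
      moreover have "x = 0 + x" by simp
      ultimately show ?thesis by blast
    qed
  qed
  have "span (\<Union>\<alpha>\<in>dual_space \<aa>. root_space br \<aa> \<alpha>) \<subseteq> ?S"
    by (rule span_minimal[OF _ S]) (use gen in blast)
  then have "X \<in> ?S" using root_space_span by blast
  then obtain x y where "X = x + y" "x \<in> cartan_k \<theta>" "y \<in> \<bb>" by blast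
  then show ?thesis by (intro bexI[of _ x]) auto
qed

section \<open>The projection onto \<open>cartan_k \<theta>\<close>\<close>

abbreviation "proj \<equiv> projection_along (cartan_k \<theta>) \<bb>"

text \<open>The trivial intersection of the two summands makes the definite description in
  \<open>projection_along\<close> unique.\<close>

lemma proj_eqI:
  assumes "Y \<in> cartan_k \<theta>" "X - Y \<in> \<bb>"
  shows "proj X = Y"
  unfolding projection_along_def
proof (rule the_equality)
  show "Y \<in> cartan_k \<theta> \<and> X - Y \<in> \<bb>" using assms by blast
  fix Z assume Z: "Z \<in> cartan_k \<theta> \<and> X - Z \<in> \<bb>"
  have "(X - Y) - (X - Z) \<in> \<bb>" using assms Z b_subspace subspace_diff by blast
  then have "Z - Y \<in> \<bb>" by simp
  moreover have "Z - Y \<in> cartan_k \<theta>" using assms Z k_subspace subspace_diff by blast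
  ultimately show "Z = Y" using k_Int_b[of "Z - Y"] by simp
qed

lemma proj_k: "proj X \<in> cartan_k \<theta>" and proj_b: "X - proj X \<in> \<bb>"
proof -
  obtain Y where "Y \<in> cartan_k \<theta>" "X - Y \<in> \<bb>" using k_plus_b[of X] by blast
  then show "proj X \<in> cartan_k \<theta>" "X - proj X \<in> \<bb>" using proj_eqI[of Y X] by simp_all
qed

lemma proj_linear: "linear proj"
proof (rule linearI)
  fix X Y
  have "(X - proj X) + (Y - proj Y) \<in> \<bb>" using proj_b b_subspace subspace_add by blast
  moreover have "(X - proj X) + (Y - proj Y) = X + Y - (proj X + proj Y)" by simp
  ultimately show "proj (X + Y) = proj X + proj Y"
    using proj_eqI[of "proj X + proj Y" "X + Y"] proj_k k_subspace subspace_add by metis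
next
  fix r X
  have "r *\<^sub>R (X - proj X) \<in> \<bb>" using proj_b b_subspace subspace_scale by blast
  then show "proj (r *\<^sub>R X) = r *\<^sub>R proj X"
    using proj_eqI[of "r *\<^sub>R proj X" "r *\<^sub>R X"] proj_k k_subspace subspace_scale
    by (metis scaleR_right_diff_distrib)
qed

lemma proj_of_k: "X \<in> cartan_k \<theta> \<Longrightarrow> proj X = X"
  using proj_eqI[of X X] subspace_0[OF b_subspace] by simp

lemma proj_of_b: "X \<in> \<bb> \<Longrightarrow> proj X = 0"
  using proj_eqI[of 0 X] subspace_0[OF k_subspace] by simp

lemma k_subalgebra: "X \<in> cartan_k \<theta> \<Longrightarrow> Y \<in> cartan_k \<theta> \<Longrightarrow> br X Y \<in> cartan_k \<theta>"
  unfolding cartan_k_def by (simp add: theta_br)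

text \<open>A nonzero bracket of two negative root vectors has minus a sum of two positive roots as
  its weight; that sum is then a root, and hence positive. A bracket with an element of
  \<open>\<aa>\<close> only rescales.\<close>

lemma b_subalgebra:
  assumes "X \<in> \<bb>" "Y \<in> \<bb>"
  shows "br X Y \<in> \<bb>"
proof (rule span_bilinear_induct[OF br_bilinear b_subspace _ assms[unfolded b_minus_def]])
  fix x y assume xy: "x \<in> \<aa> \<union> n_gens" "y \<in> \<aa> \<union> n_gens"
  have an: "br x y \<in> \<bb>" if x: "x \<in> \<aa>" and y: "y \<in> n_gens" for x y
  proof -
    obtain \<alpha> where "\<alpha> \<in> P" "y \<in> root_space br \<aa> (\<lambda>H. - \<alpha> H)" using y by blast
    then have "br x y = - \<alpha> x *\<^sub>R y" using root_spaceD[OF _ x] by simp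
    moreover have "y \<in> \<bb>" using b_superset y by blast
    ultimately show ?thesis using subspace_scale[OF b_subspace, of y "- \<alpha> x"] by simp
  qed
  have nn: "br x y \<in> \<bb>" if xn: "x \<in> n_gens" and yn: "y \<in> n_gens" for x y
  proof (cases "br x y = 0")
    case True
    then show ?thesis using b_subspace subspace_0 by simp
  next
    case False
    obtain \<alpha> where \<alpha>: "\<alpha> \<in> P" "x \<in> root_space br \<aa> (\<lambda>H. - \<alpha> H)" using xn by blast
    obtain \<beta> where \<beta>: "\<beta> \<in> P" "y \<in> root_space br \<aa> (\<lambda>H. - \<beta> H)" using yn by blast
    let ?\<gamma> = "\<lambda>H. \<alpha> H + \<beta> H"
    have b: "br x y \<in> root_space br \<aa> (\<lambda>H. - ?\<gamma> H)"
      using root_space_br[OF \<alpha>(2) \<beta>(2)] by (simp add: add.commute)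
    \<comment> \<open>The sum is a root only if its own root space is nonzero. The bracket lies in
      the space of the opposite weight, and \<theta> moves it over.\<close>
    have "\<theta> (br x y) \<in> root_space br \<aa> ?\<gamma>"
      using theta_root_space[OF b] by (simp add: add.commute)
    moreover have "\<theta> (br x y) \<noteq> 0"
      using False theta_theta[of "br x y"] linear_0[OF theta_linear] by metis
    moreover have "?\<gamma> \<in> dual_space \<aa>"
      using P_dual[OF \<alpha>(1)] P_dual[OF \<beta>(1)] unfolding dual_space_def by (simp add: algebra_simps)
    moreover have "?\<gamma> \<noteq> (\<lambda>_. 0)"
    proof
      assume "?\<gamma> = (\<lambda>_. 0)"
      then have "- \<alpha> H = \<beta> H" for H using fun_cong[of ?\<gamma> "\<lambda>_. 0" H] by simp
      then show False using P_not_opposite[OF \<alpha>(1) \<beta>(1)] by blast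
    qed
    ultimately have "?\<gamma> \<in> restricted_roots br \<aa>" unfolding restricted_roots_def by blast
    then have "?\<gamma> \<in> P" using P_add[OF \<alpha>(1) \<beta>(1)] by blast
    then show ?thesis using b b_superset by blast
  qed
  consider "x \<in> \<aa>" "y \<in> \<aa>" | "x \<in> \<aa>" "y \<in> n_gens" | "x \<in> n_gens" "y \<in> \<aa>" | "x \<in> n_gens" "y \<in> n_gens"
    using xy by blast
  then show "br x y \<in> \<bb>"
  proof cases
    case 1
    then show ?thesis using a_comm b_subspace subspace_0 by simp
  next
    case 3
    then show ?thesis using an[of y x] br_skew[of x y] b_subspace subspace_neg by metis
  qed (use an nn in blast)+
qed

text \<open>Writing \<open>M\<close> for \<open>proj\<close>, \<open>[Mx, y] + [x, My] - [Mx, My] - [x, y] = - [x - Mx, y - My]\<close> lies in the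
  subalgebra \<open>\<bb>\<close>, which \<open>M\<close> annihilates.\<close>

lemma proj_br:
  "proj (br (proj x) y) - proj (br (proj y) x) - br (proj x) (proj y) = proj (br x y)"
proof -
  have "proj (br (proj x) y) - proj (br (proj y) x) - proj (br (proj x) (proj y)) - proj (br x y) =
     proj (br (proj x) y - br (proj y) x - br (proj x) (proj y) - br x y)"
    by (simp only: linear_diff[OF proj_linear])
  also have "br (proj x) y - br (proj y) x - br (proj x) (proj y) - br x y = - br (x - proj x) (y - proj y)"
    using br_skew[of x "proj y"] by (simp add: br_simps)
  also have "proj \<dots> = 0"
    using proj_of_b[OF subspace_neg[OF b_subspace b_subalgebra[OF proj_b[of x] proj_b[of y]]]] .
  finally show ?thesis using proj_of_k[OF k_subalgebra[OF proj_k proj_k]] by simp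
qed

end

section \<open>Toda fields\<close>

text \<open>Continuity of \<open>g\<close> is available for its coordinate expressions, so openness
  is shown in the image of a chart and pulled back by the chart.\<close>

lemma openin_smooth_nonzero:
  assumes M: "smooth_manifold M" and g: "smooth_fun_on M W g"
  shows "openin (mfd_top M) {x\<in>W. g x \<noteq> 0}"
proof (subst openin_subopen, intro ballI)
  fix x assume x: "x \<in> {x\<in>W. g x \<noteq> 0}"
  have W: "openin (mfd_top M) W" using smooth_fun_on_openin[OF g] .
  then have "x \<in> topspace (mfd_top M)" using x openin_subset by blast
  then obtain U \<phi> where U: "(U, \<phi>) \<in> charts M" "x \<in> U"
    using chart_at_point[OF smooth_manifold_atlas[OF M]] by blast
  note U' = U(1)
  let ?g = "g \<circ> inv_into U \<phi>"
  let ?O = "{t \<in> \<phi> ` (U \<inter> W). ?g t \<noteq> 0}"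
  have c: "continuous_on (\<phi> ` (U \<inter> W)) ?g"
    by (rule smooth_on_imp_continuous_on[OF smooth_fun_onD[OF g U']])
  have "?O = \<phi> ` (U \<inter> W) \<inter> ?g -` (- {0})" by auto
  then have "open ?O"
    using continuous_on_open_vimage[OF chart_open_image[OF M U' W], of ?g] c by (auto simp: Int_commute)
  then have o: "openin (top_of_set (\<phi> ` U)) ?O"
    by (intro open_subset) auto
  have "openin (subtopology (mfd_top M) U) {y \<in> topspace (subtopology (mfd_top M) U). \<phi> y \<in> ?O}"
    by (rule openin_continuous_map_preimage[OF homeomorphic_imp_continuous_map[OF chart_homeomorphic[OF M U']] o])
  then have "openin (mfd_top M) {y \<in> topspace (subtopology (mfd_top M) U). \<phi> y \<in> ?O}"
    by (rule openin_trans_full) (rule chart_openin[OF M U'])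
  moreover have "\<phi> y \<in> ?O \<longleftrightarrow> y \<in> W \<and> g y \<noteq> 0" if "y \<in> U" for y
    using that chart_inj[OF M U'] by (auto simp: inv_into_f_f inj_on_def)
  then have "{y \<in> topspace (subtopology (mfd_top M) U). \<phi> y \<in> ?O} = {y\<in>U. y \<in> W \<and> g y \<noteq> 0}"
    using chart_subset[OF M U'] by (simp only: topspace_subtopology) blast
  ultimately have "openin (mfd_top M) {y\<in>U. y \<in> W \<and> g y \<noteq> 0}" by (simp only:)
  then show "\<exists>T. openin (mfd_top M) T \<and> x \<in> T \<and> T \<subseteq> {x\<in>W. g x \<noteq> 0}"
    using x U(2) by (intro exI[of _ "{y\<in>U. y \<in> W \<and> g y \<noteq> 0}"]) blast
qed

lemma smooth_fun_on_divide:
  assumes M: "smooth_manifold M" and f: "smooth_fun_on M W f" and g: "smooth_fun_on M W g"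
  shows "smooth_fun_on M {x\<in>W. g x \<noteq> 0} (\<lambda>x. f x / g x)"
proof -
  have o: "openin (mfd_top M) {x\<in>W. g x \<noteq> 0}" by (rule openin_smooth_nonzero[OF M g])
  have "smooth_fun_on M {x\<in>W. g x \<noteq> 0} f" "smooth_fun_on M {x\<in>W. g x \<noteq> 0} g"
    by (rule smooth_fun_on_subset[OF f o] smooth_fun_on_subset[OF g o]; blast)+
  then show ?thesis
    unfolding divide_inverse by (intro smooth_fun_on_mult smooth_fun_on_inverse[OF M]) auto
qed

text \<open>The product rule for \<open>f = (f / g) * g\<close>, solved for the derivative of the
  quotient. The factorisation holds near \<open>p\<close>, which is enough for a tangent
  vector.\<close>

lemma tangent_vector_divide:
  assumes M: "smooth_manifold M" and v: "v \<in> tangent_space M p"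
    and f: "smooth_fun_on M W f" and g: "smooth_fun_on M W g" and p: "p \<in> W" "g p \<noteq> 0"
  shows "v (\<lambda>x. f x / g x) = (v f * g p - f p * v g) / (g p)\<^sup>2"
proof -
  let ?W = "{x\<in>W. g x \<noteq> 0}"
  have pW: "p \<in> ?W" using p by blast
  have "v f = v (\<lambda>x. f x / g x * g x)"
    by (rule tangent_vector_local[OF M v openin_smooth_nonzero[OF M g] pW]) simp
  also have "\<dots> = v (\<lambda>x. f x / g x) * g p + f p / g p * v g"
    by (rule tangent_vector_mult[OF M v smooth_fun_on_imp_near[OF smooth_fun_on_divide[OF M f g] pW]
          smooth_fun_on_imp_near[OF g p(1)]])
  finally show ?thesis using p(2) by (simp add: field_simps power2_eq_square)
qed

lemma smooth_vector_fieldD: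
  assumes "smooth_vector_field_on M W X"
  shows "openin (mfd_top M) W" "p \<in> W \<Longrightarrow> X p \<in> tangent_space M p"
    "V \<subseteq> W \<Longrightarrow> smooth_fun_on M V f \<Longrightarrow> smooth_fun_on M V (\<lambda>p. X p f)"
  using assms unfolding smooth_vector_field_on_def by blast+

lemma smooth_vector_field_scale:
  assumes M: "smooth_manifold M" and X: "smooth_vector_field_on M W X" and f: "smooth_fun_on M W f"
  shows "smooth_vector_field_on M W (scale_field f X)"
  unfolding smooth_vector_field_on_def
proof (intro conjI ballI allI impI)
  show "openin (mfd_top M) W" by (rule smooth_vector_fieldD(1)[OF X])
  show "scale_field f X p \<in> tangent_space M p" if "p \<in> W" for p
    using tangent_space_linear_combination[OF M smooth_vector_fieldD(2)[OF X that]
        smooth_vector_fieldD(2)[OF X that], of "f p" 0] unfolding scale_field_def by simp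
  show "smooth_fun_on M V (\<lambda>p. scale_field f X p h)" if V: "V \<subseteq> W" "smooth_fun_on M V h" for V h
    unfolding scale_field_def
    by (rule smooth_fun_on_mult[OF smooth_fun_on_subset[OF f smooth_fun_on_openin[OF V(2)] V(1)]
          smooth_vector_fieldD(3)[OF X V]])
qed

text \<open>The product rule in both iterated derivatives; the terms in which the inner field is
  differentiated assemble to the bracket of \<open>X\<close> and \<open>Y\<close>. For
  \<open>h\<close> not smooth near \<open>p\<close> all terms are the default 0.\<close>

lemma lie_bracket_scale:
  assumes M: "smooth_manifold M" and X: "smooth_vector_field_on M W X" and Y: "smooth_vector_field_on M W Y"
    and f: "smooth_fun_on M W f" and g: "smooth_fun_on M W g" and p: "p \<in> W"
  shows "lie_bracket M (scale_field f X) (scale_field g Y) p h =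
    f p * g p * lie_bracket M X Y p h + f p * X p g * Y p h - g p * Y p f * X p h"
proof (cases "smooth_near M p h")
  case True
  obtain V where V: "p \<in> V" "V \<subseteq> W" "smooth_fun_on M V h"
    using smooth_nearE_Int[OF True smooth_vector_fieldD(1)[OF X] p] by blast
  have *: "smooth_near M p (\<lambda>q. Z q h)" if "smooth_vector_field_on M W Z" for Z
    by (rule smooth_fun_on_imp_near[OF smooth_vector_fieldD(3)[OF that V(2,3)] V(1)])
  note n = smooth_fun_on_imp_near[OF f p] smooth_fun_on_imp_near[OF g p]
  have "X p (\<lambda>q. g q * Y q h) = X p g * Y p h + g p * X p (\<lambda>q. Y q h)"
    by (rule tangent_vector_mult[OF M smooth_vector_fieldD(2)[OF X p] n(2) *[OF Y]])
  moreover have "Y p (\<lambda>q. f q * X q h) = Y p f * X p h + f p * Y p (\<lambda>q. X q h)"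
    by (rule tangent_vector_mult[OF M smooth_vector_fieldD(2)[OF Y p] n(1) *[OF X]])
  ultimately show ?thesis
    using True unfolding lie_bracket_def scale_field_def by (simp add: algebra_simps)
next
  case False
  then show ?thesis
    using tangent_vector_not_smooth[OF smooth_vector_fieldD(2)[OF X p] False]
      tangent_vector_not_smooth[OF smooth_vector_fieldD(2)[OF Y p] False]
    unfolding lie_bracket_def by simp
qed

lemma smooth_vector_field_subset:
  assumes "smooth_vector_field_on M W X" "openin (mfd_top M) V" "V \<subseteq> W"
  shows "smooth_vector_field_on M V X"
  unfolding smooth_vector_field_on_def
proof (intro conjI ballI allI impI assms(2))
  show "X p \<in> tangent_space M p" if "p \<in> V" for p
    using smooth_vector_fieldD(2)[OF assms(1)] that assms(3) by blast
  show "smooth_fun_on M V' (\<lambda>p. X p f)" if "V' \<subseteq> V" "smooth_fun_on M V' f" for V' f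
    using smooth_vector_fieldD(3)[OF assms(1) _ that(2)] that(1) assms(3) by blast
qed

lemma bilinear_inner_expansion:
  fixes b :: "'g::euclidean_space \<Rightarrow> 'g \<Rightarrow> 'h::real_inner"
  assumes "bilinear b"
  shows "b x y \<bullet> u = (\<Sum>i\<in>Basis. \<Sum>j\<in>Basis. (b i j \<bullet> u) * ((x \<bullet> i) * (y \<bullet> j)))"
proof -
  have l: "linear (b z)" "linear (\<lambda>z. b z w)" for z w using assms unfolding bilinear_def by blast+
  have "b x y = b (\<Sum>i\<in>Basis. (x \<bullet> i) *\<^sub>R i) (\<Sum>j\<in>Basis. (y \<bullet> j) *\<^sub>R j)"
    by (simp add: euclidean_representation)
  also have "\<dots> = (\<Sum>i\<in>Basis. b ((x \<bullet> i) *\<^sub>R i) (\<Sum>j\<in>Basis. (y \<bullet> j) *\<^sub>R j))"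
    by (rule linear_sum[OF l(2)])
  also have "\<dots> = (\<Sum>i\<in>Basis. \<Sum>j\<in>Basis. ((x \<bullet> i) * (y \<bullet> j)) *\<^sub>R b i j)"
    by (simp only: linear_sum[OF l(1)] bilinear_lmul[OF assms] bilinear_rmul[OF assms] scaleR_sum_right
        scaleR_scaleR mult.commute)
  finally show ?thesis by (simp add: inner_sum_left mult_ac)
qed

section \<open>Smoothness and brackets of Toda fields\<close>

locale toda_group = cartan_data br \<theta> \<aa> P + lie_subgroup G MG br lam "cartan_k \<theta>" K MK
  for br :: "'g::euclidean_space \<Rightarrow> 'g \<Rightarrow> 'g" and \<theta> :: "'g \<Rightarrow> 'g" and \<aa> :: "'g set"
    and P :: "('g \<Rightarrow> real) set" and G :: "'a monoid" (structure)
    and MG :: "('a, 'e::euclidean_space) manifold" and lam :: "'g \<Rightarrow> 'a tangent_vector"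
    and K :: "'a set" and MK :: "('a, 'f::euclidean_space) manifold"
begin

abbreviation "toda \<equiv> toda_field br \<theta> \<aa> P G MG lam MK"

lemma toda_right_field: "toda X k = right_field (proj (ad k X)) k"
  unfolding toda_field_def right_field_def ..

lemma toda_tangent: "k \<in> K \<Longrightarrow> toda X k \<in> tangent_space MK k"
  unfolding toda_right_field by (rule right_field_tangent[OF proj_k])

lemma openin_K: "openin (mfd_top MK) K"
  using openin_topspace[of "mfd_top MK"] topspace_K by simp

lemma toda_linear:
  assumes "k \<in> K"
  shows "toda (a *\<^sub>R X + b *\<^sub>R Y) k f = a * toda X k f + b * toda Y k f"
proof -
  have "proj (ad k (a *\<^sub>R X + b *\<^sub>R Y)) = a *\<^sub>R proj (ad k X) + b *\<^sub>R proj (ad k Y)"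
    using Ad_linear[OF K_carrier[OF assms]] proj_linear by (simp add: linear_add linear_cmul)
  then show ?thesis unfolding toda_right_field using right_field_linear[OF proj_k proj_k] by simp
qed

text \<open>Expanding \<open>ad k X\<close> in the basis presents the Toda field as a combination of
  the right-invariant fields of \<open>proj b\<close>, with smooth coefficients
  \<open>ad k X \<bullet> b\<close>.\<close>

lemma toda_smooth:
  assumes f: "smooth_fun_on MK V f"
  shows "smooth_fun_on MK V (\<lambda>k. toda X k f)"
proof -
  have VK: "V \<subseteq> K" using openin_subset[OF smooth_fun_on_openin[OF f]] topspace_K by simp
  have "smooth_fun_on MK V (\<lambda>k. \<Sum>b\<in>Basis. (ad k X \<bullet> b) * right_field (proj b) k f)"
    by (intro smooth_fun_on_sum smooth_fun_on_openin[OF f] smooth_fun_on_mult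
        smooth_fun_on_subset[OF Ad_smooth_K] VK right_field_smooth[OF proj_k f])
  then show ?thesis
  proof (rule smooth_fun_on_cong[OF manifold_K])
    fix k assume k: "k \<in> V"
    then have kK: "k \<in> K" and n: "smooth_near MK k f" using VK smooth_fun_on_imp_near[OF f] by auto
    have "proj (ad k X) = proj (\<Sum>b\<in>Basis. (ad k X \<bullet> b) *\<^sub>R b)" by (simp add: euclidean_representation)
    also have "\<dots> = (\<Sum>b\<in>Basis. (ad k X \<bullet> b) *\<^sub>R proj b)"
      by (simp add: linear_sum[OF proj_linear] linear_cmul[OF proj_linear])
    finally show "(\<Sum>b\<in>Basis. (ad k X \<bullet> b) * right_field (proj b) k f) = toda X k f"
      unfolding toda_right_field right_field_apply[OF kK n] using sv_sum[of Basis proj "\<lambda>b. ad k X \<bullet> b"] proj_k by simp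
  qed
qed

lemma toda_smooth_vector_field: "smooth_vector_field_on MK K (toda X)"
  unfolding smooth_vector_field_on_def using openin_K toda_tangent toda_smooth by blast

lemma toda_Ad: "k \<in> K \<Longrightarrow> toda X k (\<lambda>k. ad k Y \<bullet> u) = br (proj (ad k X)) (ad k Y) \<bullet> u"
  unfolding toda_right_field by (rule right_field_Ad[OF proj_k])

text \<open>The product rule for a bilinear expression. As tangent vectors act on scalar functions,
  it is carried out on the components and reassembled.\<close>

lemma toda_bilinear_Ad:
  assumes k: "k \<in> K" and b: "bilinear b"
  shows "toda X k (\<lambda>q. b (ad q Y) (ad q Z) \<bullet> u) =
    (b (br (proj (ad k X)) (ad k Y)) (ad k Z) + b (ad k Y) (br (proj (ad k X)) (ad k Z))) \<bullet> u"
proof -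
  let ?v = "toda X k"
  have v: "?v \<in> tangent_space MK k" by (rule toda_tangent[OF k])
  have A: "smooth_near MK k (\<lambda>q. ad q Y \<bullet> i)" for Y i
    by (rule smooth_fun_on_imp_near[OF Ad_smooth_K k])
  note m = smooth_near_mult[OF A A]
  have kt: "k \<in> topspace (mfd_top MK)" using k topspace_K by simp
  have s: "smooth_near MK k (\<lambda>q. (b i j \<bullet> u) * ((ad q Y \<bullet> i) * (ad q Z \<bullet> j)))" for i j
    by (rule smooth_near_mult[OF smooth_near_const[OF kt] m])
  have "?v (\<lambda>q. b (ad q Y) (ad q Z) \<bullet> u) =
      ?v (\<lambda>q. \<Sum>i\<in>Basis. \<Sum>j\<in>Basis. (b i j \<bullet> u) * ((ad q Y \<bullet> i) * (ad q Z \<bullet> j)))"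
    by (rule arg_cong[where f = ?v], rule ext, rule bilinear_inner_expansion[OF b])
  also have "\<dots> = (\<Sum>i\<in>Basis. \<Sum>j\<in>Basis. ?v (\<lambda>q. (b i j \<bullet> u) * ((ad q Y \<bullet> i) * (ad q Z \<bullet> j))))"
    by (simp only: tangent_vector_sum[OF manifold_K v] smooth_near_sum[OF kt] s)
  also have "\<dots> = (\<Sum>i\<in>Basis. \<Sum>j\<in>Basis. (b i j \<bullet> u) *
      (?v (\<lambda>q. ad q Y \<bullet> i) * (ad k Z \<bullet> j) + (ad k Y \<bullet> i) * ?v (\<lambda>q. ad q Z \<bullet> j)))"
    by (simp only: tangent_vector_scale[OF manifold_K v m] tangent_vector_mult[OF manifold_K v A A])
  also have "\<dots> = b (br (proj (ad k X)) (ad k Y)) (ad k Z) \<bullet> u + b (ad k Y) (br (proj (ad k X)) (ad k Z)) \<bullet> u"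
    unfolding toda_Ad[OF k] bilinear_inner_expansion[OF b, of "br (proj (ad k X)) (ad k Y)"]
      bilinear_inner_expansion[OF b, of "ad k Y"]
    by (simp only: distrib_left sum.distrib)
  finally show ?thesis by (simp add: inner_add_left)
qed

text \<open>The functions \<open>k \<mapsto> Ad\<^sub>k V \<bullet> u\<close> separate tangent vectors of \<open>K\<close> because \<open>\<gg>\<close> has trivial
  centre, so the bracket only has to be computed on them.\<close>

lemma toda_bracket:
  assumes k: "k \<in> K"
  shows "lie_bracket MK (toda X) (toda Y) k = toda (br X Y) k"
proof (rule tangent_vector_eq_by_Ad[OF center_trivial])
  show "br (X - Y) Z = br X Z - br Y Z" for X Y Z by (simp add: br_simps)
  show "lie_bracket MK (toda X) (toda Y) k \<in> tangent_space MK k"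
    by (rule lie_bracket_in_tangent_space[OF manifold_K toda_smooth_vector_field toda_smooth_vector_field k])
  show "toda (br X Y) k \<in> tangent_space MK k" by (rule toda_tangent[OF k])
  fix V u
  \<comment> \<open>\<open>toda Y\<close> differentiates \<open>ad q V\<close> to this form at
    \<open>ad q Y\<close> and \<open>ad q V\<close>; its bilinearity gives the second derivative by
    \<open>toda_bilinear_Ad\<close>.\<close>
  have b: "bilinear (\<lambda>x y. br (proj x) y)"
    unfolding bilinear_def
    by (auto intro!: linearI simp: br_simps linear_add[OF proj_linear] linear_cmul[OF proj_linear])
  let ?x = "ad k X" and ?y = "ad k Y" and ?v = "ad k V"
  have 1: "toda X k (\<lambda>q. toda Y q (\<lambda>k. ad k V \<bullet> u)) =
      (br (proj (br (proj (ad k X)) (ad k Y))) ?v + br (proj (ad k Y)) (br (proj (ad k X)) ?v)) \<bullet> u" for X Y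
  proof -
    have "toda X k (\<lambda>q. toda Y q (\<lambda>k. ad k V \<bullet> u)) = toda X k (\<lambda>q. br (proj (ad q Y)) (ad q V) \<bullet> u)"
      by (rule tangent_vector_local[OF manifold_K toda_tangent[OF k] openin_K k toda_Ad])
    then show ?thesis using toda_bilinear_Ad[OF k b] by simp
  qed
  \<comment> \<open>The Jacobi identity merges the two nested brackets into minus the bracket of the
    projections. The collected first argument is then exactly the left side of
    \<open>proj_br\<close>.\<close>
  have "br (proj (br (proj ?x) ?y)) ?v + br (proj ?y) (br (proj ?x) ?v) -
      (br (proj (br (proj ?y) ?x)) ?v + br (proj ?x) (br (proj ?y) ?v)) =
      br (proj (br (proj ?x) ?y) - proj (br (proj ?y) ?x) - br (proj ?x) (proj ?y)) ?v"
    using br_br[of "proj ?x" "proj ?y" ?v] by (simp add: br_simps)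
  also have "\<dots> = br (proj (ad k (br X Y))) ?v"
    unfolding proj_br Ad_br[OF K_carrier[OF k]] ..
  finally show "lie_bracket MK (toda X) (toda Y) k (\<lambda>k. ad k V \<bullet> u) = toda (br X Y) k (\<lambda>k. ad k V \<bullet> u)"
    unfolding lie_bracket_def toda_Ad[OF k] 1
    using smooth_fun_on_imp_near[OF Ad_smooth_K k] by (simp flip: inner_diff_left)
qed

end

section \<open>Matrix coefficients and their quotients\<close>

locale toda_representation = toda_group br \<theta> \<aa> P G MG lam K MK
  for br :: "'g::euclidean_space \<Rightarrow> 'g \<Rightarrow> 'g" and \<theta> :: "'g \<Rightarrow> 'g" and \<aa> :: "'g set"
    and P :: "('g \<Rightarrow> real) set" and G :: "'a monoid" (structure)
    and MG :: "('a, 'e::euclidean_space) manifold" and lam :: "'g \<Rightarrow> 'a tangent_vector"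
    and K :: "'a set" and MK :: "('a, 'f::euclidean_space) manifold" +
  fixes \<rho> :: "'g \<Rightarrow> 'v::euclidean_space \<Rightarrow> 'v" and R :: "'a \<Rightarrow> 'v \<Rightarrow> 'v" and vm :: 'v
  assumes bottom: "bottom_weight_representation br \<aa> P \<rho> vm"
    and integrates: "integrates_to G MG lam \<rho> R"
    and compatible: "compatible_inner_product \<theta> K \<rho> R"
begin

lemma rho_bilinear: "bilinear \<rho>"
  using bottom unfolding bottom_weight_representation_def lie_representation_def by blast

lemma R_linear: "g \<in> carrier G \<Longrightarrow> linear (R g)"
  and R_one: "R \<one> = id"
  and R_mult: "g \<in> carrier G \<Longrightarrow> h \<in> carrier G \<Longrightarrow> R (g \<otimes> h) = R g \<circ> R h"
  and R_smooth: "smooth_fun_on MG (carrier G) (\<lambda>g. R g u \<bullet> w)"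
  and R_derivative: "lam X (\<lambda>g. R g u \<bullet> w) = \<rho> X u \<bullet> w"
  using integrates unfolding integrates_to_def by blast+

lemma R_orthogonal: "k \<in> K \<Longrightarrow> R k u \<bullet> R k w = u \<bullet> w"
  and rho_p: "L \<in> cartan_p \<theta> \<Longrightarrow> \<rho> L u \<bullet> w = u \<bullet> \<rho> L w"
  and rho_k: "A \<in> cartan_k \<theta> \<Longrightarrow> \<rho> A u \<bullet> w = - (u \<bullet> \<rho> A w)"
  using compatible unfolding compatible_inner_product_def by blast+

lemma R_inverse:
  assumes "g \<in> carrier G"
  shows "R g (R (inv g) u) = u" "R (inv g) (R g u) = u"
  using R_mult[of g "inv g"] R_mult[of "inv g" g] R_one assms
  by (simp_all add: group_simps fun_eq_iff)

text \<open>\<open>X + \<theta> X\<close> acts skew-symmetrically and \<open>X - \<theta> X\<close>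
  symmetrically; the claim is half the sum of these two relations.\<close>

lemma rho_transpose: "\<rho> X u \<bullet> w = - (u \<bullet> \<rho> (\<theta> X) w)"
proof -
  let ?k = "X + \<theta> X" and ?p = "X - \<theta> X"
  have "?k \<in> cartan_k \<theta>"
    unfolding cartan_k_def by (simp add: linear_add[OF theta_linear] theta_theta add.commute)
  from rho_k[OF this, of u w] have 1: "\<rho> X u \<bullet> w + \<rho> (\<theta> X) u \<bullet> w = - (u \<bullet> \<rho> X w) - u \<bullet> \<rho> (\<theta> X) w"
    by (simp add: bilinear_ladd[OF rho_bilinear] inner_add_left inner_add_right)
  have "?p \<in> cartan_p \<theta>"
    unfolding cartan_p_def by (simp add: linear_diff[OF theta_linear] theta_theta)
  from rho_p[OF this, of u w] have 2: "\<rho> X u \<bullet> w - \<rho> (\<theta> X) u \<bullet> w = u \<bullet> \<rho> X w - u \<bullet> \<rho> (\<theta> X) w"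
    by (simp add: bilinear_lsub[OF rho_bilinear] inner_diff_left inner_diff_right)
  show ?thesis using 1 2 by linarith
qed

text \<open>The derivative at \<open>x = \<one>\<close> of the identity that
  \<open>R (g \<otimes> x \<otimes> inv g)\<close> maps \<open>R g u\<close> to
  \<open>R g (R x u)\<close>. Passing to the adjoint of \<open>R g\<close> restores the shape of
  function that \<open>R_derivative\<close> can differentiate.\<close>

lemma rho_Ad:
  assumes g: "g \<in> carrier G"
  shows "\<rho> (ad g X) (R g u) = R g (\<rho> X u)"
proof -
  have "\<rho> (ad g X) (R g u) \<bullet> w = R g (\<rho> X u) \<bullet> w" for w
  proof -
    have one: "\<one> \<in> carrier G" by (simp add: group_simps)
    have "\<rho> (ad g X) (R g u) \<bullet> w = lam (ad g X) (\<lambda>x. R x (R g u) \<bullet> w)"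
      by (simp add: R_derivative)
    also have "\<dots> = lam X (\<lambda>x. R (g \<otimes> x \<otimes> inv g) (R g u) \<bullet> w)"
      by (rule Ad_apply[OF g smooth_fun_on_imp_near[OF R_smooth one]])
    also have "\<dots> = lam X (\<lambda>x. R x u \<bullet> adjoint (R g) w)"
    proof (rule tangent_vector_cong_carrier[OF lam_tangent])
      fix x assume x: "x \<in> carrier G"
      have "R (g \<otimes> x \<otimes> inv g) (R g u) = R g (R x (R (inv g) (R g u)))"
        using g x by (simp add: R_mult group_simps)
      then show "R (g \<otimes> x \<otimes> inv g) (R g u) \<bullet> w = R x u \<bullet> adjoint (R g) w"
        using R_inverse[OF g] adjoint_works[OF R_linear[OF g]] by simp
    qed
    also have "\<dots> = R g (\<rho> X u) \<bullet> w"
      unfolding R_derivative by (rule adjoint_works[OF R_linear[OF g]])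
    finally show ?thesis .
  qed
  then show ?thesis by (simp only: vector_eq_rdot[THEN iffD1, OF allI])
qed

text \<open>Having \<open>vm\<close> as an eigenvector is a linear condition on \<open>X\<close>, so
  generators suffice: \<open>\<aa>\<close> scales \<open>vm\<close> and the negative root spaces
  annihilate it.\<close>

lemma rho_b:
  assumes "X \<in> \<bb>"
  shows "\<exists>c. \<rho> X vm = c *\<^sub>R vm"
  using assms unfolding b_minus_def
proof (induction rule: span_induct)
  case base
  show ?case
    unfolding subspace_def mem_Collect_eq
  proof (intro conjI ballI allI)
    show "\<exists>c. \<rho> 0 vm = c *\<^sub>R vm" by (intro exI[of _ 0]) (simp add: bilinear_lzero[OF rho_bilinear])
    fix X assume "X \<in> {X. \<exists>c. \<rho> X vm = c *\<^sub>R vm}"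
    then obtain c where c: "\<rho> X vm = c *\<^sub>R vm" by blast
    show "\<exists>c. \<rho> (r *\<^sub>R X) vm = c *\<^sub>R vm" for r
      by (intro exI[of _ "r * c"]) (simp add: bilinear_lmul[OF rho_bilinear] c)
    fix Y assume "Y \<in> {X. \<exists>c. \<rho> X vm = c *\<^sub>R vm}"
    then obtain d where d: "\<rho> Y vm = d *\<^sub>R vm" by blast
    show "\<exists>c. \<rho> (X + Y) vm = c *\<^sub>R vm"
      by (intro exI[of _ "c + d"]) (simp add: bilinear_ladd[OF rho_bilinear] c d scaleR_add_left)
  qed
next
  case (step X)
  have "\<forall>\<alpha>\<in>P. \<forall>x\<in>root_space br \<aa> (\<lambda>H. - \<alpha> H). \<rho> x vm = 0"
    and "\<exists>\<omega>\<in>dual_space \<aa>. \<forall>h\<in>\<aa>. \<rho> h vm = \<omega> h *\<^sub>R vm"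
    using bottom unfolding bottom_weight_representation_def by blast+
  moreover have "\<exists>c. \<rho> X vm = c *\<^sub>R vm" if "\<rho> X vm = 0"
    by (intro exI[of _ 0]) (simp add: that)
  ultimately show ?case using step by blast
qed

lemma F_smooth: "smooth_fun_on MK K (\<lambda>k. R k u \<bullet> w)"
  by (rule smooth_restrict[OF R_smooth])

text \<open>Modulo a multiple of the function itself, the projection along \<open>\<bb>\<close> is not seen by
  \<open>R k u \<bullet> vm\<close>, as \<open>vm\<close> is an eigenvector of \<open>\<bb>\<close>.\<close>

lemma toda_F:
  assumes k: "k \<in> K"
  obtains c where "\<And>u. toda X k (\<lambda>k. R k u \<bullet> vm) = R k (\<rho> (\<theta> X) u) \<bullet> vm + c * (R k u \<bullet> vm)"
proof -
  let ?A = "proj (ad k X)"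
  note kG = K_carrier[OF k]
  have one: "\<one> \<in> carrier G" by (simp add: group_simps)
  obtain c where c: "\<rho> (ad k X - ?A) vm = c *\<^sub>R vm" using rho_b[OF proj_b] by blast
  have "toda X k (\<lambda>k. R k u \<bullet> vm) = R k (\<rho> (\<theta> X) u) \<bullet> vm + c * (R k u \<bullet> vm)" for u
  proof -
    have "toda X k (\<lambda>k. R k u \<bullet> vm) = sv ?A (\<lambda>x. R (x \<otimes> k) u \<bullet> vm)"
      unfolding toda_right_field by (rule right_field_apply[OF k smooth_fun_on_imp_near[OF F_smooth k]])
    also have "\<dots> = sv ?A (\<lambda>x. R x (R k u) \<bullet> vm)"
      by (rule K.tangent_vector_cong_carrier[OF sv_tangent(1)[OF proj_k]])
         (use R_mult K_carrier k in simp)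
    also have "\<dots> = \<rho> ?A (R k u) \<bullet> vm"
      using sv_apply[OF proj_k smooth_fun_on_imp_near[OF R_smooth one]] R_derivative by simp
    also have "\<dots> = - (R k u \<bullet> \<rho> ?A vm)" by (rule rho_k[OF proj_k])
    also have "\<rho> ?A vm = \<rho> (ad k X) vm - c *\<^sub>R vm"
      using c by (simp add: bilinear_lsub[OF rho_bilinear] algebra_simps)
    \<comment> \<open>Conjugation by \<open>R k\<close> removes the adjoint action, so that
      orthogonality of \<open>R k\<close> can cancel it against \<open>R k u\<close>; the transpose
      then moves \<open>X\<close> onto \<open>u\<close>.\<close>
    also have "\<rho> (ad k X) vm = R k (\<rho> X (R (inv k) vm))"
      using rho_Ad[OF kG, of X "R (inv k) vm"] R_inverse[OF kG] by simp
    also have "- (R k u \<bullet> (R k (\<rho> X (R (inv k) vm)) - c *\<^sub>R vm)) = - (u \<bullet> \<rho> X (R (inv k) vm)) + c * (R k u \<bullet> vm)"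
      by (simp add: inner_diff_right R_orthogonal[OF k])
    also have "- (u \<bullet> \<rho> X (R (inv k) vm)) = \<rho> (\<theta> X) u \<bullet> R (inv k) vm"
      using rho_transpose[of "\<theta> X" u] by (simp add: theta_theta)
    also have "\<dots> = R k (\<rho> (\<theta> X) u) \<bullet> vm"
      using R_orthogonal[OF k, of "\<rho> (\<theta> X) u" "R (inv k) vm"] R_inverse[OF kG] by simp
    finally show ?thesis .
  qed
  then show thesis using that by blast
qed

lemma toda_F_ratio:
  assumes k: "k \<in> K" and nz: "R k w \<bullet> vm \<noteq> 0"
  shows "toda X k (\<lambda>k. R k u \<bullet> vm / (R k w \<bullet> vm)) =
    ((R k (\<rho> (\<theta> X) u) \<bullet> vm) * (R k w \<bullet> vm) - (R k u \<bullet> vm) * (R k (\<rho> (\<theta> X) w) \<bullet> vm)) / (R k w \<bullet> vm)\<^sup>2"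
proof -
  obtain c where c: "\<And>u. toda X k (\<lambda>k. R k u \<bullet> vm) = R k (\<rho> (\<theta> X) u) \<bullet> vm + c * (R k u \<bullet> vm)"
    using toda_F[OF k] by blast
  have "toda X k (\<lambda>k. R k u \<bullet> vm / (R k w \<bullet> vm)) =
    (toda X k (\<lambda>k. R k u \<bullet> vm) * (R k w \<bullet> vm) - (R k u \<bullet> vm) * toda X k (\<lambda>k. R k w \<bullet> vm)) / (R k w \<bullet> vm)\<^sup>2"
    by (rule tangent_vector_divide[OF manifold_K toda_tangent[OF k] F_smooth F_smooth k nz])
  then show ?thesis unfolding c by (simp add: algebra_simps)
qed

text \<open>At zeros of the denominator the value is the default 0 of division; smoothness is
  claimed on \<open>regular w\<close>.\<close>

definition ratio :: "'v \<Rightarrow> 'v \<Rightarrow> 'a \<Rightarrow> real" where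
  "ratio u w = (\<lambda>k. R k u \<bullet> vm / (R k w \<bullet> vm))"

abbreviation "regular w \<equiv> {k\<in>K. R k w \<bullet> vm \<noteq> 0}"

lemma ratio_smooth: "smooth_fun_on MK (regular w) (ratio u w)"
  unfolding ratio_def by (rule smooth_fun_on_divide[OF manifold_K F_smooth F_smooth])

lemma toda_dom: "smooth_vector_field_on MK (regular w) (toda X)"
  by (rule smooth_vector_field_subset[OF toda_smooth_vector_field smooth_fun_on_openin[OF ratio_smooth]]) blast

lemma scaled_toda_smooth: "smooth_vector_field_on MK (regular w) (scale_field (ratio u w) (toda X))"
  by (rule smooth_vector_field_scale[OF manifold_K toda_dom ratio_smooth])

lemma toda_ratio_zero:
  assumes "k \<in> regular w" "\<rho> (\<theta> X) u = 0" "\<rho> (\<theta> X) w = 0"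
  shows "toda X k (ratio u w) = 0"
  unfolding ratio_def using toda_F_ratio[of k w X u] assms linear_0[OF R_linear] K_carrier by simp

text \<open>As \<theta> negates \<Lambda>, the vectors \<open>u\<close> and \<open>w\<close> have
  eigenvalues \<open>- a\<close> and \<open>- b\<close> for
  \<open>\<rho> (\<theta> \<Lambda>)\<close>, and the quotient rule leaves their difference.\<close>

lemma toda_ratio_weight:
  assumes k: "k \<in> regular w" and \<Lambda>: "\<Lambda> \<in> \<aa>" and u: "\<rho> \<Lambda> u = a *\<^sub>R u" and w: "\<rho> \<Lambda> w = b *\<^sub>R w"
  shows "toda \<Lambda> k (ratio u w) = - (a - b) * ratio u w k"
proof -
  have kK: "k \<in> K" and nz: "R k w \<bullet> vm \<noteq> 0" using k by auto
  have "\<rho> (\<theta> \<Lambda>) u = - a *\<^sub>R u" "\<rho> (\<theta> \<Lambda>) w = - b *\<^sub>R w"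
    using theta_a[OF \<Lambda>] u w by (simp_all add: bilinear_lneg[OF rho_bilinear])
  then have "toda \<Lambda> k (ratio u w) =
      (- a * (R k u \<bullet> vm) * (R k w \<bullet> vm) - (R k u \<bullet> vm) * (- b * (R k w \<bullet> vm))) / (R k w \<bullet> vm)\<^sup>2"
    using toda_F_ratio[OF kK nz, of \<Lambda> u] linear_cmul[OF R_linear[OF K_carrier[OF kK]]]
      linear_neg[OF R_linear[OF K_carrier[OF kK]]]
    unfolding ratio_def by (simp add: inner_minus_left)
  also have "\<dots> = - (a - b) * ratio u w k"
    using nz unfolding ratio_def by (simp add: field_simps power2_eq_square)
  finally show ?thesis .
qed

lemma toda_scaled_toda_commute:
  assumes k: "k \<in> regular w" and \<Lambda>: "\<Lambda> \<in> \<aa>" and e: "e \<in> root_space br \<aa> \<alpha>"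
    and u: "\<rho> \<Lambda> u = a *\<^sub>R u" and w: "\<rho> \<Lambda> w = b *\<^sub>R w" and ab: "a - b = \<alpha> \<Lambda>"
  shows "lie_bracket MK (toda \<Lambda>) (scale_field (ratio u w) (toda e)) k = (\<lambda>_. 0)"
proof
  fix h
  have kK: "k \<in> K" using k by blast
  \<comment> \<open>Writing the unscaled field as its multiple by the constant 1 brings the bracket
    into the form of \<open>lie_bracket_scale\<close>; the derivative of the constant then
    vanishes.\<close>
  have one: "scale_field (\<lambda>_. 1) (toda \<Lambda>) = toda \<Lambda>" unfolding scale_field_def by simp
  have "lie_bracket MK (scale_field (\<lambda>_. 1) (toda \<Lambda>)) (scale_field (ratio u w) (toda e)) k h =
     1 * ratio u w k * lie_bracket MK (toda \<Lambda>) (toda e) k h + 1 * toda \<Lambda> k (ratio u w) * toda e k h -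
     ratio u w k * toda e k (\<lambda>_. 1) * toda \<Lambda> k h"
    by (rule lie_bracket_scale[OF manifold_K toda_dom toda_dom
          smooth_fun_on_const[OF smooth_fun_on_openin[OF ratio_smooth]] ratio_smooth k])
  also have "toda e k (\<lambda>_. 1) = 0" by (rule tangent_vector_const[OF manifold_K toda_tangent[OF kK]])
  also have "lie_bracket MK (toda \<Lambda>) (toda e) k h = \<alpha> \<Lambda> * toda e k h"
    unfolding toda_bracket[OF kK] root_spaceD[OF e \<Lambda>] using toda_linear[OF kK, of "\<alpha> \<Lambda>" e 0 e h] by simp
  also have "toda \<Lambda> k (ratio u w) = - (a - b) * ratio u w k" by (rule toda_ratio_weight[OF k \<Lambda> u w])
  finally show "lie_bracket MK (toda \<Lambda>) (scale_field (ratio u w) (toda e)) k h = 0"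
    unfolding one ab by simp
qed

end

theorem mainTheorem1:
  fixes br :: "'g::euclidean_space \<Rightarrow> 'g \<Rightarrow> 'g"
    and sc :: "complex \<Rightarrow> 'c::ab_group_add \<Rightarrow> 'c" and brc :: "'c \<Rightarrow> 'c \<Rightarrow> 'c" and \<iota> :: "'g \<Rightarrow> 'c"
    and \<theta> :: "'g \<Rightarrow> 'g" and \<aa> :: "'g set" and P :: "('g \<Rightarrow> real) set"
    and G :: "'a monoid" and MG :: "('a, 'e::euclidean_space) manifold"
    and lam :: "'g \<Rightarrow> 'a tangent_vector"
    and K :: "'a set" and MK :: "('a, 'f::euclidean_space) manifold"
    and T :: "'g \<Rightarrow> 'a vector_field"
    and \<alpha> \<beta> :: "'g \<Rightarrow> real" and e\<^sub>\<alpha> e\<^sub>\<beta> :: 'g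
    and \<rho>\<^sub>\<alpha> :: "'g \<Rightarrow> 'v::euclidean_space \<Rightarrow> 'v" and R\<^sub>\<alpha> :: "'a \<Rightarrow> 'v \<Rightarrow> 'v"
    and vm\<^sub>\<alpha> :: 'v and v :: "nat \<Rightarrow> 'v" and \<omega> :: "nat \<Rightarrow> 'g \<Rightarrow> real"
    and \<rho>\<^sub>\<beta> :: "'g \<Rightarrow> 'w::euclidean_space \<Rightarrow> 'w" and R\<^sub>\<beta> :: "'a \<Rightarrow> 'w \<Rightarrow> 'w"
    and vm\<^sub>\<beta> :: 'w and v' :: "nat \<Rightarrow> 'w" and \<omega>' :: "nat \<Rightarrow> 'g \<Rightarrow> real"
    and i j k l :: nat
    and T\<^sub>\<alpha> T\<^sub>\<beta> :: "'a vector_field"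
  assumes "noncompact_real_form br sc brc \<iota>"
    and "cartan_involution br \<theta>"
    and "maximal_commutative_in br (cartan_p \<theta>) \<aa>"
    and "positive_system (restricted_roots br \<aa>) P"
    and "lie_group G MG" and "simply_connected_space (mfd_top MG)"
    and "lie_algebra_of_group G MG br lam"
    and "connected_lie_subgroup G MG lam (cartan_k \<theta>) K MK"
    and "T = toda_field br \<theta> \<aa> P G MG lam MK"
    and "\<alpha> \<in> P" and "\<beta> \<in> P"
    and "e\<^sub>\<alpha> \<in> root_space br \<aa> \<alpha>" and "e\<^sub>\<alpha> \<noteq> 0"
    and "e\<^sub>\<beta> \<in> root_space br \<aa> \<beta>" and "e\<^sub>\<beta> \<noteq> 0"
    and "br e\<^sub>\<alpha> e\<^sub>\<beta> = 0"
    and "bottom_weight_representation br \<aa> P \<rho>\<^sub>\<alpha> vm\<^sub>\<alpha>"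
    and "integrates_to G MG lam \<rho>\<^sub>\<alpha> R\<^sub>\<alpha>"
    and "compatible_inner_product \<theta> K \<rho>\<^sub>\<alpha> R\<^sub>\<alpha>"
    and "adapted_basis \<aa> \<rho>\<^sub>\<alpha> vm\<^sub>\<alpha> v \<omega>"
    and "bottom_weight_representation br \<aa> P \<rho>\<^sub>\<beta> vm\<^sub>\<beta>"
    and "integrates_to G MG lam \<rho>\<^sub>\<beta> R\<^sub>\<beta>"
    and "compatible_inner_product \<theta> K \<rho>\<^sub>\<beta> R\<^sub>\<beta>"
    and "adapted_basis \<aa> \<rho>\<^sub>\<beta> vm\<^sub>\<beta> v' \<omega>'"
    and "i \<in> {1..DIM('v)}" and "j \<in> {1..DIM('v)}" and "\<forall>h\<in>\<aa>. \<omega> j h - \<omega> i h = \<alpha> h"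
    and "k \<in> {1..DIM('w)}" and "l \<in> {1..DIM('w)}" and "\<forall>h\<in>\<aa>. \<omega>' l h - \<omega>' k h = \<beta> h"
    and "\<rho>\<^sub>\<alpha> (\<theta> e\<^sub>\<beta>) (v i) = 0" and "\<rho>\<^sub>\<alpha> (\<theta> e\<^sub>\<beta>) (v j) = 0"
    and "\<rho>\<^sub>\<beta> (\<theta> e\<^sub>\<alpha>) (v' k) = 0" and "\<rho>\<^sub>\<beta> (\<theta> e\<^sub>\<alpha>) (v' l) = 0"
    and "T\<^sub>\<alpha> = scale_field (\<lambda>x. F_coeff R\<^sub>\<alpha> v vm\<^sub>\<alpha> j x / F_coeff R\<^sub>\<alpha> v vm\<^sub>\<alpha> i x) (T e\<^sub>\<alpha>)"
    and "T\<^sub>\<beta> = scale_field (\<lambda>x. F_coeff R\<^sub>\<beta> v' vm\<^sub>\<beta> l x / F_coeff R\<^sub>\<beta> v' vm\<^sub>\<beta> k x) (T e\<^sub>\<beta>)"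
  shows "smooth_vector_field_on MK {x\<in>K. F_coeff R\<^sub>\<alpha> v vm\<^sub>\<alpha> i x \<noteq> 0} T\<^sub>\<alpha> \<and>
    smooth_vector_field_on MK {x\<in>K. F_coeff R\<^sub>\<beta> v' vm\<^sub>\<beta> k x \<noteq> 0} T\<^sub>\<beta> \<and>
    (\<forall>x\<in>K. F_coeff R\<^sub>\<alpha> v vm\<^sub>\<alpha> i x \<noteq> 0 \<and> F_coeff R\<^sub>\<beta> v' vm\<^sub>\<beta> k x \<noteq> 0 \<longrightarrow>
       lie_bracket MK T\<^sub>\<alpha> T\<^sub>\<beta> x = (\<lambda>_. 0)) \<and>
    (\<forall>\<Lambda>\<in>\<aa>.
       (\<forall>x\<in>K. F_coeff R\<^sub>\<alpha> v vm\<^sub>\<alpha> i x \<noteq> 0 \<longrightarrow> lie_bracket MK (T \<Lambda>) T\<^sub>\<alpha> x = (\<lambda>_. 0)) \<and>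
       (\<forall>x\<in>K. F_coeff R\<^sub>\<beta> v' vm\<^sub>\<beta> k x \<noteq> 0 \<longrightarrow> lie_bracket MK (T \<Lambda>) T\<^sub>\<beta> x = (\<lambda>_. 0)))"
proof -
  have algebra: "lie_algebra scaleR br"
    using assms(1) unfolding noncompact_real_form_def real_form_def by blast
  interpret cartan_data br \<theta> \<aa> P
    by unfold_locales (rule algebra assms(2-4))+
  interpret A: toda_representation br \<theta> \<aa> P G MG lam K MK \<rho>\<^sub>\<alpha> R\<^sub>\<alpha> vm\<^sub>\<alpha>
    by unfold_locales (rule assms(5,7,8,17-19) k_subspace)+
  interpret B: toda_representation br \<theta> \<aa> P G MG lam K MK \<rho>\<^sub>\<beta> R\<^sub>\<beta> vm\<^sub>\<beta>
    by unfold_locales (rule assms(21-23))+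
  let ?f = "A.ratio (v j) (v i)" and ?g = "B.ratio (v' l) (v' k)"
  let ?V = "A.regular (v i)" and ?W = "B.regular (v' k)"
  note T = assms(9)
  have T\<^sub>\<alpha>: "T\<^sub>\<alpha> = scale_field ?f (T e\<^sub>\<alpha>)"
    unfolding assms(35) F_coeff_def A.ratio_def ..
  have T\<^sub>\<beta>: "T\<^sub>\<beta> = scale_field ?g (T e\<^sub>\<beta>)"
    unfolding assms(36) F_coeff_def B.ratio_def ..
  have weight\<^sub>\<alpha>: "\<rho>\<^sub>\<alpha> h (v n) = \<omega> n h *\<^sub>R v n" if "n \<in> {1..DIM('v)}" "h \<in> \<aa>" for n h
    using assms(20) that unfolding adapted_basis_def by blast
  have weight\<^sub>\<beta>: "\<rho>\<^sub>\<beta> h (v' n) = \<omega>' n h *\<^sub>R v' n" if "n \<in> {1..DIM('w)}" "h \<in> \<aa>" for n h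
    using assms(24) that unfolding adapted_basis_def by blast
  have "lie_bracket MK T\<^sub>\<alpha> T\<^sub>\<beta> x = (\<lambda>_. 0)" if V: "x \<in> ?V" and W: "x \<in> ?W" for x
  proof
    fix h
    have x: "x \<in> K" using V by blast
    \<comment> \<open>The product rule asks for one open set on which both fields and both quotients
      are smooth.\<close>
    have o: "openin (mfd_top MK) (?V \<inter> ?W)"
      by (rule openin_Int[OF smooth_fun_on_openin[OF A.ratio_smooth] smooth_fun_on_openin[OF B.ratio_smooth]])
    have "lie_bracket MK T\<^sub>\<alpha> T\<^sub>\<beta> x h =
        ?f x * ?g x * lie_bracket MK (T e\<^sub>\<alpha>) (T e\<^sub>\<beta>) x h + ?f x * T e\<^sub>\<alpha> x ?g * T e\<^sub>\<beta> x h - ?g x * T e\<^sub>\<beta> x ?f * T e\<^sub>\<alpha> x h"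
      unfolding T\<^sub>\<alpha> T\<^sub>\<beta> T
      by (rule lie_bracket_scale[OF A.manifold_K
            smooth_vector_field_subset[OF A.toda_dom o Int_lower1] smooth_vector_field_subset[OF A.toda_dom o Int_lower1]
            smooth_fun_on_subset[OF A.ratio_smooth o Int_lower1] smooth_fun_on_subset[OF B.ratio_smooth o Int_lower2]])
         (use V W in blast)
    \<comment> \<open>The bracket is the Toda field of 0, which vanishes by linearity with zero
      coefficients.\<close>
    also have "lie_bracket MK (T e\<^sub>\<alpha>) (T e\<^sub>\<beta>) x h = 0"
      unfolding T A.toda_bracket[OF x] assms(16) using A.toda_linear[OF x, of 0 0 0 0 h] by simp
    \<comment> \<open>The field and the quotient belong to different roots: this quotient lives in
      the representation for \<beta>, where \<open>\<theta> e\<^sub>\<alpha>\<close> kills the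
      vectors of both numerator and denominator.\<close>
    also have "T e\<^sub>\<alpha> x ?g = 0"
      unfolding T by (rule B.toda_ratio_zero[OF W assms(34,33)])
    also have "T e\<^sub>\<beta> x ?f = 0"
      unfolding T by (rule A.toda_ratio_zero[OF V assms(32,31)])
    finally show "lie_bracket MK T\<^sub>\<alpha> T\<^sub>\<beta> x h = 0" by simp
  qed
  moreover have "lie_bracket MK (T \<Lambda>) T\<^sub>\<alpha> x = (\<lambda>_. 0)" if "\<Lambda> \<in> \<aa>" "x \<in> ?V" for \<Lambda> x
    unfolding T T\<^sub>\<alpha>
    by (rule A.toda_scaled_toda_commute[OF that(2,1) assms(12) weight\<^sub>\<alpha>[OF assms(26) that(1)]
          weight\<^sub>\<alpha>[OF assms(25) that(1)]]) (use assms(27) that(1) in blast)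
  moreover have "lie_bracket MK (T \<Lambda>) T\<^sub>\<beta> x = (\<lambda>_. 0)" if "\<Lambda> \<in> \<aa>" "x \<in> ?W" for \<Lambda> x
    unfolding T T\<^sub>\<beta>
    by (rule B.toda_scaled_toda_commute[OF that(2,1) assms(14) weight\<^sub>\<beta>[OF assms(29) that(1)]
          weight\<^sub>\<beta>[OF assms(28) that(1)]]) (use assms(30) that(1) in blast)
  moreover have "smooth_vector_field_on MK ?V T\<^sub>\<alpha>" "smooth_vector_field_on MK ?W T\<^sub>\<beta>"
    unfolding T\<^sub>\<alpha> T\<^sub>\<beta> T by (rule A.scaled_toda_smooth B.scaled_toda_smooth)+
  ultimately show ?thesis unfolding F_coeff_def by blast
qed

end
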